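(* Let $V$ be a $k$-vector space of dimension $n\ge2$. The nil-elliptic conjugacy classes $\mathcal C$ in $\mathfrak{sl}(V_F)$ obtained from almost commuting pairs $(N,f)$ with $f$ a $Q'_{SL(V)}$-action (i.e. containing an element $N$ that almost commutes with some $Q'_{SL(V)}$-action) are precisely those with $$\mathrm{char}_{\mathcal C}(\mu)=\mu^n-b\pi^s,\quad b\in k^*,\ s>0,\ (s,n)=1,\ (\mathrm{char}'\,k,n)=1.$$ Fixing a basis $\underline e=(e_1,\dots,e_n)$ of $V$, such a class has the matrix representative $N_{bs}$ whose only nonzero entries are $1$ in positions $(i,i+1)$ for $1\le i\le n-1$ and $b\pi^s$ in position $(n,1)$ (so $N_{bs}e_{i+1}=e_i$ for $1\le i\le n-1$ and $N_{bs}e_1=b\pi^se_n$). Each $N_{bs}$ almost commutes with exponent $s$ with the $Q'$-action $f$, diagonal with respect to $\underline e$, given by $f(\lambda)\pi^me_i=\lambda^{\nu(m,i)}\pi^me_i$ with $\nu(m,i)=nm-is$.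
   Context: $k$ is an algebraically closed field, $F=k((\pi))$, $A=k[[\pi]]$, $V_F=V\otimes_kF$, $V_A=V\otimes_kA$. $\mathrm{char}'\,k$ is the characteristic exponent ($1$ if $\mathrm{char}\,k=0$, and $\mathrm{char}\,k$ otherwise). Conjugacy in $\mathfrak{sl}(V_F)$ is under $SL(V_F)$. A regular semisimple element of $\mathfrak{sl}(V_F)$ is a trace-zero endomorphism with $n$ distinct eigenvalues in an algebraic closure of $F$. It is elliptic if its centralizer in $SL(V_F)$ is an elliptic torus, i.e. a torus with no nontrivial cocharacter defined over $F$. An element is nil if it is conjugate to some $N'\in\mathfrak{sl}(V_A)$ whose image in $\mathfrak{sl}(V)$ ($\pi\mapsto0$) is nilpotent. Nil-elliptic means nil, regular semisimple and elliptic. $k^*$ acts on $F$ by $k$-algebra automorphisms with $\lambda\cdot\pi^m=\lambda^m\pi^m$, hence on $V_F$, and by $N\mapsto N^\lambda$ on $\mathfrak{sl}(V_F)$. $Q'_{SL(V)}=PGL(V)\times k^*$ acts on $\mathfrak{sl}(V_F)$ by $(g,\lambda)\cdot N=\mathrm{Ad}(g)N^\lambda$; a $Q'_{SL(V)}$-action is given by an algebraic homomorphism $f:k^*\to Q'_{SL(V)}$, and it almost commutes with $N$ with exponent $s$ if $s$ is a nonzero integer and $f(\lambda)\cdot N=\lambda^sN$ for all $\lambda\in k^*$. Likewise $Q'=GL(V)\times k^*$ acts on $V_F$ by $k$-linear automorphisms; a $Q'$-action is a $k^*$-action on $V_F$ coming from an algebraic homomorphism $f:k^*\to Q'$. It induces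 a $Q'_{SL(V)}$-action via $GL(V)\to PGL(V)$, and it almost commutes with $N$ with exponent $s$ if $f(\lambda)N=\lambda^sNf(\lambda)$ for all $\lambda\in k^*$. *)

theory Defs
  imports
    "HOL-Computational_Algebra.Formal_Laurent_Series"
    "HOL-Algebra.Product_Groups"
    "HOL-Algebra.Algebraic_Closure_Type"
    "Jordan_Normal_Form.Char_Poly"
    "Jordan_Normal_Form.VS_Connect"
begin

text \<open>Conventions. \<open>k\<close> is the type \<open>'k\<close>, \<open>F = k((\<pi>))\<close> is \<open>'k fls\<close>, \<open>A = k[[\<pi>]]\<close> is \<open>'k fps\<close>,
  and \<open>V = k\<^sup>n\<close>, so that \<open>V\<^sub>F\<close>, \<open>V\<^sub>A\<close> are column vectors over \<open>F\<close>, \<open>A\<close> and \<open>v \<mapsto> v \<otimes> 1\<close> is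
  \<open>map_vec fls_const\<close>.  The basis \<open>e\<close> of \<open>V\<close> appearing later need not be the standard one.\<close>


subsection \<open>Algebraic maps between affine varieties\<close>

text \<open>An affine variety is a set \<open>S\<close> of points over an algebraically closed field \<open>K\<close> together with a
  set \<open>G\<close> of functions generating (for \<open>C = UNIV\<close>) its coordinate ring.  For a subfield \<open>C\<close> of \<open>K\<close>,
  \<open>regular C S G\<close> is the \<open>C\<close>-algebra generated by \<open>G\<close>, where functions only count by their
  values on \<open>S\<close>.\<close>

inductive_set regular :: "'a::field set \<Rightarrow> 'p set \<Rightarrow> ('p \<Rightarrow> 'a) set \<Rightarrow> ('p \<Rightarrow> 'a) set"
  for C :: "'a set" and S :: "'p set" and G :: "('p \<Rightarrow> 'a) set" where
  gen: "h \<in> G \<Longrightarrow> h \<in> regular C S G"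
| const: "c \<in> C \<Longrightarrow> (\<lambda>_. c) \<in> regular C S G"
| add: "h \<in> regular C S G \<Longrightarrow> h' \<in> regular C S G \<Longrightarrow> (\<lambda>x. h x + h' x) \<in> regular C S G"
| mult: "h \<in> regular C S G \<Longrightarrow> h' \<in> regular C S G \<Longrightarrow> (\<lambda>x. h x * h' x) \<in> regular C S G"
| cong: "h \<in> regular C S G \<Longrightarrow> \<forall>x\<in>S. h' x = h x \<Longrightarrow> h' \<in> regular C S G"

definition variety_morphism ::
  "'a::field set \<Rightarrow> 'p set \<Rightarrow> ('p \<Rightarrow> 'a) set \<Rightarrow> 'q set \<Rightarrow> ('q \<Rightarrow> 'a) set \<Rightarrow> ('p \<Rightarrow> 'q) \<Rightarrow> bool" where
  "variety_morphism C S G T H \<phi> \<longleftrightarrow> \<phi> \<in> S \<rightarrow> T \<and> (\<forall>h\<in>H. h \<circ> \<phi> \<in> regular C S G)"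

text \<open>Homomorphism of algebraic groups, defined over \<open>C\<close>.\<close>

definition algebraic_hom ::
  "'a::field set \<Rightarrow> ('p, 'm) monoid_scheme \<Rightarrow> ('p \<Rightarrow> 'a) set \<Rightarrow>
    ('q, 'l) monoid_scheme \<Rightarrow> ('q \<Rightarrow> 'a) set \<Rightarrow> ('p \<Rightarrow> 'q) \<Rightarrow> bool" where
  "algebraic_hom C G coG H coH \<phi> \<longleftrightarrow>
     \<phi> \<in> hom G H \<and> variety_morphism C (carrier G) coG (carrier H) coH \<phi>"


subsection \<open>The groups\<close>

definition Gm :: "'a::field monoid" where
  "Gm = \<lparr>carrier = - {0}, monoid.mult = (*), one = 1\<rparr>"

definition Gm_coords :: "('a::field \<Rightarrow> 'a) set" where
  "Gm_coords = {\<lambda>t. t, \<lambda>t. inverse t}"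

definition GL :: "nat \<Rightarrow> 'a::field mat monoid" where
  "GL n = units_of (ring_mat TYPE('a) n ())"

definition GL_coords :: "nat \<Rightarrow> ('a::field mat \<Rightarrow> 'a) set" where
  "GL_coords n = {(\<lambda>g. g $$ (i, j)) | i j. i < n \<and> j < n} \<union> {\<lambda>g. inverse (det g)}"

definition PGL :: "nat \<Rightarrow> 'a::field mat set monoid" where
  "PGL n = GL n Mod {c \<cdot>\<^sub>m 1\<^sub>m n | c. c \<noteq> 0}"

text \<open>The coordinate ring of \<open>PGL\<^sub>n = GL\<^sub>n/\<bbbG>\<^sub>m\<close> is the part of degree \<open>0\<close> of
  \<open>K[x\<^sub>i\<^sub>j, 1/det]\<close>.  It is spanned by the \<open>M/det\<^sup>r\<close> with \<open>M\<close> a monomial of degree \<open>r n\<close> in the \<open>x\<^sub>i\<^sub>j\<close>;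
  such a function is constant on each coset \<open>x\<close>.\<close>

definition PGL_coords :: "nat \<Rightarrow> ('a::field mat set \<Rightarrow> 'a) set" where
  "PGL_coords n =
     {(\<lambda>x. the_elem ((\<lambda>g. prod_list (map (\<lambda>ij. g $$ ij) ps) / det g ^ r) ` x)) | ps r.
        length ps = r * n \<and> set ps \<subseteq> {..<n} \<times> {..<n}}"

definition prod_coords :: "('p \<Rightarrow> 'a) set \<Rightarrow> ('q \<Rightarrow> 'a) set \<Rightarrow> ('p \<times> 'q \<Rightarrow> 'a) set" where
  "prod_coords G H = (\<lambda>h. h \<circ> fst) ` G \<union> (\<lambda>h. h \<circ> snd) ` H"

definition torus :: "nat \<Rightarrow> (nat \<Rightarrow> 'a::field) monoid" where
  "torus r = product_group {..<r} (\<lambda>_. Gm)"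

definition torus_coords :: "nat \<Rightarrow> ((nat \<Rightarrow> 'a::field) \<Rightarrow> 'a) set" where
  "torus_coords r = {(\<lambda>t. t i) | i. i < r} \<union> {(\<lambda>t. inverse (t i)) | i. i < r}"

definition SL :: "nat \<Rightarrow> 'a::field mat set" where
  "SL n = {g \<in> carrier_mat n n. det g = 1}"

definition trace_mat :: "'a::comm_ring_1 mat \<Rightarrow> 'a" where
  "trace_mat M = sum_list (diag_mat M)"

definition sl :: "nat \<Rightarrow> 'a::comm_ring_1 mat set" where
  "sl n = {M \<in> carrier_mat n n. trace_mat M = 0}"

definition Ad :: "nat \<Rightarrow> 'a::field mat \<Rightarrow> 'a mat \<Rightarrow> 'a mat" where
  "Ad n g M = g * M * inv\<^bsub>GL n\<^esub> g"


subsection \<open>Nil-elliptic conjugacy classes\<close>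

definition conj_class :: "nat \<Rightarrow> 'a::field mat \<Rightarrow> 'a mat set" where
  "conj_class n N = (\<lambda>g. Ad n g N) ` SL n"

definition conj_classes :: "nat \<Rightarrow> 'a::field mat set set" where
  "conj_classes n = conj_class n ` sl n"

definition class_char_poly :: "'a::field mat set \<Rightarrow> 'a poly" where
  "class_char_poly C = the_elem (char_poly ` C)"

definition regular_semisimple :: "nat \<Rightarrow> 'a::field mat \<Rightarrow> bool" where
  "regular_semisimple n N \<longleftrightarrow>
     N \<in> sl n \<and> card {x. eigenvalue (map_mat to_ac N) x} = n"

text \<open>The centralizer as an algebraic group over \<open>F\<close>, given by its points over the algebraic closure.\<close>

definition centralizer_SL :: "nat \<Rightarrow> 'a::field mat \<Rightarrow> 'a alg_closure mat monoid" where
  "centralizer_SL n N =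
     (GL n)\<lparr>carrier := {g \<in> SL n. g * map_mat to_ac N = map_mat to_ac N * g}\<rparr>"

definition is_torus :: "nat \<Rightarrow> 'a::field mat monoid \<Rightarrow> bool" where
  "is_torus n T \<longleftrightarrow> (\<exists>r \<phi>. \<phi> \<in> iso (torus r) T \<and>
     algebraic_hom UNIV (torus r) (torus_coords r) T (GL_coords n) \<phi> \<and>
     algebraic_hom UNIV T (GL_coords n) (torus r) (torus_coords r)
       (inv_into (carrier (torus r)) \<phi>))"

definition elliptic :: "nat \<Rightarrow> 'a::field mat \<Rightarrow> bool" where
  "elliptic n N \<longleftrightarrow> is_torus n (centralizer_SL n N) \<and>
     (\<forall>c. algebraic_hom (range to_ac) Gm Gm_coords (centralizer_SL n N) (GL_coords n) c \<longrightarrow>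
        (\<forall>t\<in>carrier Gm. c t = 1\<^sub>m n))"

definition nil :: "nat \<Rightarrow> 'k::field fls mat \<Rightarrow> bool" where
  "nil n N \<longleftrightarrow> (\<exists>M :: 'k fps mat. M \<in> sl n \<and> map_mat fps_to_fls M \<in> conj_class n N \<and>
     (\<exists>r. map_mat (\<lambda>h. fps_nth h 0) M ^\<^sub>m r = 0\<^sub>m n n))"

definition nil_elliptic :: "nat \<Rightarrow> 'k::field fls mat \<Rightarrow> bool" where
  "nil_elliptic n N \<longleftrightarrow> nil n N \<and> regular_semisimple n N \<and> elliptic n N"

definition nil_elliptic_classes :: "nat \<Rightarrow> 'k::field fls mat set set" where
  "nil_elliptic_classes n = conj_class n ` {N \<in> sl n. nil_elliptic n N}"


subsection \<open>Almost commuting pairs\<close>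

text \<open>The action of \<open>k\<^sup>*\<close> on \<open>F\<close> with \<open>\<lambda> \<cdot> \<pi>\<^sup>m = \<lambda>\<^sup>m \<pi>\<^sup>m\<close>; it acts entrywise on \<open>V\<^sub>F\<close> and, as
  \<open>N \<mapsto> N\<^sup>\<lambda>\<close>, on matrices.\<close>

lift_definition rescale :: "'k::field \<Rightarrow> 'k fls \<Rightarrow> 'k fls" is
  "\<lambda>l h m. l powi m * h m"
  by (auto elim: eventually_mono)

definition QSL :: "nat \<Rightarrow> ('k::field mat set \<times> 'k) monoid" where
  "QSL n = PGL n \<times>\<times> Gm"

definition Q :: "nat \<Rightarrow> ('k::field mat \<times> 'k) monoid" where
  "Q n = GL n \<times>\<times> Gm"

definition QSL_act :: "nat \<Rightarrow> 'k::field mat set \<times> 'k \<Rightarrow> 'k fls mat \<Rightarrow> 'k fls mat" where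
  "QSL_act n x N =
     the_elem ((\<lambda>g. Ad n (map_mat fls_const g) (map_mat (rescale (snd x)) N)) ` fst x)"

definition Q_act :: "'k::field mat \<times> 'k \<Rightarrow> 'k fls vec \<Rightarrow> 'k fls vec" where
  "Q_act x v = map_mat fls_const (fst x) *\<^sub>v map_vec (rescale (snd x)) v"

definition QSL_action :: "nat \<Rightarrow> ('k::field \<Rightarrow> 'k mat set \<times> 'k) \<Rightarrow> bool" where
  "QSL_action n f \<longleftrightarrow>
     algebraic_hom UNIV Gm Gm_coords (QSL n) (prod_coords (PGL_coords n) Gm_coords) f"

definition Q_action :: "nat \<Rightarrow> ('k::field \<Rightarrow> 'k mat \<times> 'k) \<Rightarrow> bool" where
  "Q_action n f \<longleftrightarrow>
     algebraic_hom UNIV Gm Gm_coords (Q n) (prod_coords (GL_coords n) Gm_coords) f"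

definition QSL_almost_commutes ::
  "nat \<Rightarrow> 'k::field fls mat \<Rightarrow> ('k \<Rightarrow> 'k mat set \<times> 'k) \<Rightarrow> int \<Rightarrow> bool" where
  "QSL_almost_commutes n N f s \<longleftrightarrow> s \<noteq> 0 \<and>
     (\<forall>l\<in>carrier Gm. QSL_act n (f l) N = fls_const (l powi s) \<cdot>\<^sub>m N)"

definition Q_almost_commutes ::
  "nat \<Rightarrow> 'k::field fls mat \<Rightarrow> ('k \<Rightarrow> 'k mat \<times> 'k) \<Rightarrow> int \<Rightarrow> bool" where
  "Q_almost_commutes n N f s \<longleftrightarrow> s \<noteq> 0 \<and>
     (\<forall>l\<in>carrier Gm. \<forall>v\<in>carrier_vec n.
        Q_act (f l) (N *\<^sub>v v) = fls_const (l powi s) \<cdot>\<^sub>v (N *\<^sub>v Q_act (f l) v))"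


subsection \<open>The representatives\<close>

definition char_exponent :: "'k::field itself \<Rightarrow> nat" where
  "char_exponent _ = (if CHAR('k) = 0 then 1 else CHAR('k))"

definition admissible :: "nat \<Rightarrow> 'k::field \<Rightarrow> int \<Rightarrow> bool" where
  "admissible n b s \<longleftrightarrow>
     b \<noteq> 0 \<and> s > 0 \<and> coprime s (int n) \<and> coprime (char_exponent TYPE('k)) n"

text \<open>Matrix indices start at \<open>0\<close>, those of a basis \<open>e\<close> at \<open>1\<close>.\<close>

definition N_mat :: "nat \<Rightarrow> 'k::field \<Rightarrow> int \<Rightarrow> 'k fls mat" where
  "N_mat n b s = mat n n (\<lambda>(i, j).
     if j = i + 1 then 1
     else if i = n - 1 \<and> j = 0 then fls_const b * fls_X_intpow s
     else 0)"

definition is_basis :: "nat \<Rightarrow> (nat \<Rightarrow> 'k::field vec) \<Rightarrow> bool" where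
  "is_basis n e \<longleftrightarrow> inj_on e {1..n} \<and>
     vectorspace.basis class_ring (module_vec TYPE('k) n) (e ` {1..n})"

text \<open>The endomorphism \<open>N\<close> of \<open>V\<^sub>F\<close> has matrix \<open>M\<close> with respect to the basis \<open>e\<close> of \<open>V\<close>.\<close>

definition has_matrix :: "nat \<Rightarrow> (nat \<Rightarrow> 'k::field vec) \<Rightarrow> 'k fls mat \<Rightarrow> 'k fls mat \<Rightarrow> bool" where
  "has_matrix n e N M \<longleftrightarrow> N \<in> carrier_mat n n \<and> M \<in> carrier_mat n n \<and>
     (let E = mat_of_cols n (map (\<lambda>i. map_vec fls_const (e i)) [1..<n + 1]) in N * E = E * M)"

end

theory Submission
  imports Defs "Jordan_Normal_Form.Jordan_Normal_Form" "Jordan_Normal_Form.DL_Rank"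
begin

text \<open>If \<open>f(\<lambda>)\<close> rescales \<open>\<pi>\<close> by \<open>\<lambda>\<^bsup>d\<^esup>\<close>, comparing the characteristic polynomials of \<open>f(\<lambda>) \<cdot> N\<close> and
  \<open>\<lambda>\<^bsup>s\<^esup> N\<close> shows that the coefficient of \<open>\<mu>\<^bsup>i\<^esup>\<close> is supported in the degrees \<open>m\<close> with \<open>d m = s (n - i)\<close>.
  So the characteristic polynomial is a homogeneous form over \<open>k\<close> in powers of \<open>\<mu>\<close> and \<open>\<pi>\<close>, which splits
  into binomials.  Ellipticity makes it irreducible, because the projection defined by a factor splits off a
  cocharacter; so it is a single binomial \<open>\<mu>\<^bsup>n\<^esup> - b \<pi>\<^bsup>u\<^esup>\<close> with \<open>(u, n) = 1\<close>.  Separability gives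
  \<open>(char' k, n) = 1\<close> and nilpotency of the reduction gives \<open>u > 0\<close>.

  Conversely, a matrix with such a characteristic polynomial has a cyclic vector, so it is \<open>GL\<close>-conjugate to
  the representative; the conjugating matrix can be given determinant \<open>1\<close> because the determinant maps the
  centralizer onto \<open>F\<^sup>*\<close>.\<close>

text \<open>Both uses of ellipticity rest on one dictionary: a cocharacter defined over
  \<open>F\<close> is a Laurent polynomial whose coefficients are \<open>F\<close>-rational
  projections commuting with \<open>N\<close>, and conversely such a projection yields a
  cocharacter. Rationality is therefore always a statement about coefficients, and no Galois group
  enters. In the converse direction, ellipticity is not deduced from irreducibility of mu^n - b
  pi^s. A rational projection of rank r commuting with \<open>N\<close> produces an element of
  \<open>F\<close>, the determinant of \<open>N\<close> on the image, whose n-th power is (b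
  pi^s)^r. Valuations give n | s r, hence n | r. The exponent of almost commutation is not tied to
  the exponent of pi: if pi is rescaled by lambda^d, the constant coefficient b pi^u only gives d u
  = s n. The action attached to the representative takes d = n, which makes u = s. Conjugacy is
  under SL over \<open>F\<close>, while a cyclic vector controls a matrix only up to GL. Correcting
  the determinant is what requires n-th roots of Laurent series.\<close>

lemma GL_inverseI:
  fixes P Q :: "'a::field mat"
  assumes P: "P \<in> carrier_mat n n" and Q: "Q \<in> carrier_mat n n" and PQ: "P * Q = 1\<^sub>m n"
  shows "P \<in> carrier (GL n)" "inv\<^bsub>GL n\<^esub> P = Q"
proof -
  interpret R: ring "ring_mat TYPE('a) n ()" by (rule ring_mat)
  have QP: "Q * P = 1\<^sub>m n" using mat_mult_left_right_inverse[OF P Q PQ] .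
  have U: "P \<in> Units (ring_mat TYPE('a) n ())"
    using P Q PQ QP unfolding Units_def by (auto simp: ring_mat_simps)
  then show "P \<in> carrier (GL n)" by (simp add: GL_def units_of_def)
  have "inv\<^bsub>ring_mat TYPE('a) n ()\<^esub> P = Q"
    using R.inv_char[of P Q] P Q PQ QP by (simp add: ring_mat_simps)
  then show "inv\<^bsub>GL n\<^esub> P = Q" using R.units_of_inv[OF U] by (simp add: GL_def)
qed

lemma det_nonzero_inverse:
  fixes P :: "'a::field mat"
  assumes P: "P \<in> carrier_mat n n" and "det P \<noteq> 0"
  obtains Q where "Q \<in> carrier_mat n n" "P * Q = 1\<^sub>m n" "Q * P = 1\<^sub>m n"
  using det_non_zero_imp_unit[OF assms, of "()"]
  unfolding Units_def by (auto simp: ring_mat_simps)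

lemma mem_carrier_GL: "(g :: 'a::field mat) \<in> carrier (GL n) \<longleftrightarrow> g \<in> carrier_mat n n \<and> det g \<noteq> 0"
proof
  assume "g \<in> carrier (GL n)"
  then have "g \<in> Units (ring_mat TYPE('a) n ())" by (simp add: GL_def units_of_def)
  then show "g \<in> carrier_mat n n \<and> det g \<noteq> 0"
    using unit_imp_det_non_zero by (auto simp: Units_def ring_mat_simps)
next
  assume "g \<in> carrier_mat n n \<and> det g \<noteq> 0"
  then show "g \<in> carrier (GL n)" using det_nonzero_inverse GL_inverseI by metis
qed

lemma mult_GL [simp]: "x \<otimes>\<^bsub>GL n\<^esub> y = x * y"
  by (simp add: GL_def units_of_def ring_mat_simps)

lemma Ad_eq:
  fixes P Q :: "'a::field mat"
  assumes "P \<in> carrier_mat n n" "Q \<in> carrier_mat n n" "P * Q = 1\<^sub>m n"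
  shows "Ad n P M = P * M * Q"
  using GL_inverseI(2)[OF assms] by (simp add: Ad_def)

lemma trace_mat_eq_sum: "M \<in> carrier_mat n n \<Longrightarrow> trace_mat M = (\<Sum>i<n. M $$ (i, i))"
  by (simp add: trace_mat_def diag_mat_def sum_list_sum_nth lessThan_atLeast0)

lemma char_poly_in_conj_class:
  fixes N :: "'a::field mat"
  assumes N: "N \<in> carrier_mat n n" and M: "M \<in> conj_class n N"
  shows "M \<in> carrier_mat n n" "char_poly M = char_poly N"
proof -
  obtain g where g: "g \<in> SL n" "M = Ad n g N" using M by (auto simp: conj_class_def)
  then have gc: "g \<in> carrier_mat n n" "det g \<noteq> 0" by (auto simp: SL_def)
  obtain h where h: "h \<in> carrier_mat n n" "g * h = 1\<^sub>m n" "h * g = 1\<^sub>m n"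
    using det_nonzero_inverse[OF gc] .
  have M: "M = g * N * h" using g Ad_eq[OF gc(1) h(1,2)] by simp
  then show "M \<in> carrier_mat n n" using gc h N by auto
  then have "similar_mat_wit M N g h" using M N gc h by (intro similar_mat_witI[of _ _ n]) auto
  then show "char_poly M = char_poly N"
    by (intro char_poly_similar) (auto simp: similar_mat_def)
qed

lemma conj_class_self: "N \<in> carrier_mat n n \<Longrightarrow> N \<in> conj_class n (N :: 'a::field mat)"
  unfolding conj_class_def
  by (rule image_eqI[of _ _ "1\<^sub>m n"]) (auto simp: SL_def Ad_eq[of _ n "1\<^sub>m n"])

text \<open>\<open>class_char_poly\<close> is a \<open>the_elem\<close>; it becomes usable once the
  characteristic polynomials of a class are known to form a singleton.\<close>

lemma class_char_poly_conj_class: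
  fixes N :: "'a::field mat"
  assumes N: "N \<in> carrier_mat n n"
  shows "class_char_poly (conj_class n N) = char_poly N"
proof -
  have "char_poly ` conj_class n N = {char_poly N}"
    using char_poly_in_conj_class(2)[OF N] conj_class_self[OF N] by blast
  then show ?thesis by (simp add: class_char_poly_def)
qed

subsection \<open>Matrices that are diagonal in a fixed frame\<close>

lemma det_mat_diag: "det (mat_diag n f) = (\<Prod>i<n. f i)"
  by (subst det_upper_triangular[of _ n])
     (auto simp: upper_triangular_def mat_diag_def diag_mat_def prod.list_conv_set_nth lessThan_atLeast0)

lemma triple_mult_index:
  fixes A B C :: "'a::semiring_0 mat"
  assumes "A \<in> carrier_mat n n" "B \<in> carrier_mat n n" "C \<in> carrier_mat n n" "i < n" "j < n"
  shows "(A * B * C) $$ (i, j) = (\<Sum>b<n. (\<Sum>a<n. A $$ (i, a) * B $$ (a, b)) * C $$ (b, j))"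
proof -
  have "(A * B * C) $$ (i, j) = (\<Sum>b<n. (A * B) $$ (i, b) * C $$ (b, j))"
    using assms by (subst index_mult_mat(1)) (auto simp: scalar_prod_def lessThan_atLeast0)
  also have "\<dots> = (\<Sum>b<n. (\<Sum>a<n. A $$ (i, a) * B $$ (a, b)) * C $$ (b, j))"
    using assms by (intro sum.cong refl) (auto simp: scalar_prod_def lessThan_atLeast0)
  finally show ?thesis .
qed

text \<open>The columns of \<open>P\<close> are a basis and \<open>Q\<close> computes coordinates,
  so algebra with the matrices \<open>D f\<close> is pointwise algebra of functions on the indices.
  The locale is used for eigenbases over the algebraic closure of \<open>F\<close>, for the given
  basis over \<open>k\<close>, and for its extension to \<open>F\<close>.\<close>

locale frame =
  fixes n :: nat and P Q :: "'a::field mat"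
  assumes P_carrier [simp, intro]: "P \<in> carrier_mat n n"
    and Q_carrier [simp, intro]: "Q \<in> carrier_mat n n"
    and PQ: "P * Q = 1\<^sub>m n" and QP: "Q * P = 1\<^sub>m n"
begin

definition D :: "(nat \<Rightarrow> 'a) \<Rightarrow> 'a mat" where
  "D f = P * mat_diag n f * Q"

lemma frame_dims [simp]: "dim_row P = n" "dim_col P = n" "dim_row Q = n" "dim_col Q = n"
  using P_carrier Q_carrier by blast+

lemma framed_carrier [simp]: "A \<in> carrier_mat n n \<Longrightarrow> P * A * Q \<in> carrier_mat n n"
  and unframed_carrier [simp]: "A \<in> carrier_mat n n \<Longrightarrow> Q * A * P \<in> carrier_mat n n"
  by (auto intro!: mult_carrier_mat[of _ n n])

lemma D_carrier [simp]: "D f \<in> carrier_mat n n"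
  by (simp add: D_def)

lemma D_dims [simp]: "dim_row (D f) = n" "dim_col (D f) = n"
  using D_carrier by blast+

lemma D_cong: "(\<And>i. i < n \<Longrightarrow> f i = g i) \<Longrightarrow> D f = D g"
proof -
  assume "\<And>i. i < n \<Longrightarrow> f i = g i"
  then have "mat_diag n f = mat_diag n g" by (auto simp: mat_diag_def intro!: eq_matI)
  then show ?thesis by (simp add: D_def)
qed

lemma unframe:
  assumes M: "M \<in> carrier_mat n n"
  shows "P * (Q * M * P) * Q = M"
proof -
  have "P * (Q * M * P) * Q = (P * Q) * M * (P * Q)"
    using M by (simp add: assoc_mult_mat[of _ n n _ n _ n] mult_carrier_mat[of _ n n])
  then show ?thesis using M by (simp add: PQ)
qed

lemma reframe:
  assumes M: "M \<in> carrier_mat n n"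
  shows "Q * (P * M * Q) * P = M"
proof -
  have "Q * (P * M * Q) * P = (Q * P) * M * (Q * P)"
    using M by (simp add: assoc_mult_mat[of _ n n _ n _ n] mult_carrier_mat[of _ n n])
  then show ?thesis using M by (simp add: QP)
qed

lemma framed_mult:
  assumes "A \<in> carrier_mat n n" "B \<in> carrier_mat n n"
  shows "(P * A * Q) * (P * B * Q) = P * (A * B) * Q"
proof -
  have "(P * A * Q) * (P * B * Q) = P * A * (Q * P) * B * Q"
    using assms by (simp add: assoc_mult_mat[of _ n n _ n _ n] mult_carrier_mat[of _ n n])
  also have "\<dots> = P * (A * B) * Q"
    using assms by (simp add: QP assoc_mult_mat[of _ n n _ n _ n] mult_carrier_mat[of _ n n])
  finally show ?thesis .
qed

lemma D_mult: "D f * D g = D (\<lambda>i. f i * g i)"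
  by (simp add: D_def framed_mult)

lemma D_index:
  assumes "a < n" "b < n"
  shows "D f $$ (a, b) = (\<Sum>i<n. P $$ (a, i) * f i * Q $$ (i, b))"
proof -
  have "D f = mat n n (\<lambda>(i, j). P $$ (i, j) * f j) * Q"
    by (simp add: D_def mat_diag_mult_right[OF P_carrier])
  then show ?thesis using assms
    by (auto simp: scalar_prod_def lessThan_atLeast0 intro!: sum.cong)
qed

lemma D_add: "D f + D g = D (\<lambda>i. f i + g i)"
  by (intro eq_matI) (simp_all add: D_index distrib_left distrib_right sum.distrib)

lemma D_smult: "c \<cdot>\<^sub>m D f = D (\<lambda>i. c * f i)"
  by (intro eq_matI) (simp_all add: D_index sum_distrib_left ac_simps)

lemma D_one: "D (\<lambda>_. 1) = 1\<^sub>m n"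
  by (simp add: D_def PQ right_mult_one_mat[OF P_carrier])

lemma D_pow: "D f ^\<^sub>m k = D (\<lambda>i. f i ^ k)"
  by (induction k) (simp_all add: D_one D_mult mult.commute)

lemma D_const: "D (\<lambda>_. c) = c \<cdot>\<^sub>m 1\<^sub>m n"
  using D_smult[of c "\<lambda>_. 1"] by (simp add: D_one)

lemma det_D: "det (D f) = (\<Prod>i<n. f i)"
proof -
  have 1: "det P * det Q = 1" using det_mult[OF P_carrier Q_carrier] PQ by simp
  have "det (D f) = det P * det (mat_diag n f) * det Q"
    unfolding D_def by (simp add: det_mult[of _ n] mult_carrier_mat[of _ n n])
  then show ?thesis using 1 by (simp add: det_mat_diag ac_simps)
qed

lemma framed_D: "Q * D f * P = mat_diag n f"
  unfolding D_def by (rule reframe) simp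

lemma D_eqD:
  assumes "D f = D g" "i < n"
  shows "f i = g i"
proof -
  have "mat_diag n f = mat_diag n g"
    by (simp only: framed_D[symmetric] assms(1))
  then have "mat_diag n f $$ (i, i) = mat_diag n g $$ (i, i)" by simp
  then show ?thesis using assms(2) by (simp add: mat_diag_def)
qed

text \<open>In coordinates, entry (i, j) of the commutation relation reads
  \<open>M' $$ (i, j) * d j = d i * M' $$ (i, j)\<close>, so distinct eigenvalues kill everything
  off the diagonal.\<close>

lemma commutes_with_D:
  assumes M: "M \<in> carrier_mat n n" and comm: "M * D d = D d * M" and inj: "inj_on d {..<n}"
  shows "M = D (\<lambda>i. (Q * M * P) $$ (i, i))"
proof -
  define M' where "M' = Q * M * P"
  have M': "M' \<in> carrier_mat n n" and MM': "M = P * M' * Q"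
    using M unframe[OF M] by (simp_all add: M'_def)
  have *: "P * (M' * mat_diag n d) * Q = P * (mat_diag n d * M') * Q"
    using comm M' unfolding MM' D_def by (simp add: framed_mult)
  have "M' * mat_diag n d = Q * (P * (M' * mat_diag n d) * Q) * P"
    by (rule reframe[symmetric]) (use M' in \<open>auto simp: mat_diag_def\<close>)
  also have "\<dots> = Q * (P * (mat_diag n d * M') * Q) * P" by (simp only: *)
  also have "\<dots> = mat_diag n d * M'"
    by (rule reframe) (use M' in \<open>auto simp: mat_diag_def\<close>)
  finally have eq: "M' * mat_diag n d = mat_diag n d * M'" .
  have "M' $$ (i, j) = 0" if "i < n" "j < n" "i \<noteq> j" for i j
  proof -
    have "(M' * mat_diag n d) $$ (i, j) = (mat_diag n d * M') $$ (i, j)" using eq by simp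
    then have "M' $$ (i, j) * d j = d i * M' $$ (i, j)"
      using that M' by (simp add: mat_diag_mult_left[OF M'] mat_diag_mult_right[OF M'])
    then show ?thesis using that inj by (auto simp: inj_on_def mult.commute)
  qed
  then have "M' = mat_diag n (\<lambda>i. M' $$ (i, i))"
    using M' by (auto simp: mat_diag_def intro!: eq_matI)
  then have "M = D (\<lambda>i. M' $$ (i, i))" unfolding D_def MM' by simp
  then show ?thesis by (simp only: M'_def)
qed

end

section \<open>Diagonalization of matrices with distinct eigenvalues\<close>

lemma mat_diag_mult_vec:
  "v \<in> carrier_vec n \<Longrightarrow> mat_diag n f *\<^sub>v v = vec n (\<lambda>i. f i * v $ i)"
  for f :: "nat \<Rightarrow> 'a::semiring_1"
proof -
  assume v: "v \<in> carrier_vec n"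
  have "(\<Sum>j = 0..<n. (if i = j then f j else 0) * v $ j) = (\<Sum>j = 0..<n. if i = j then f j * v $ j else 0)" for i
    by (rule sum.cong) auto
  then show ?thesis using v by (intro eq_vecI) (auto simp: mat_diag_def scalar_prod_def)
qed

lemma eigenvalues_eq_roots:
  "A \<in> carrier_mat n n \<Longrightarrow> {x. eigenvalue A x} = {x. poly (char_poly A) x = 0}"
  for A :: "'a::field mat"
  by (simp add: eigenvalue_root_char_poly)

lemma diagonalizable_if_distinct_eigenvalues:
  fixes N :: "'a::field mat"
  assumes N: "N \<in> carrier_mat n n" and card: "card {x. eigenvalue N x} = n"
  obtains P Q d where "frame n P Q" "N = frame.D n P Q d" "inj_on d {..<n}"
    "d ` {..<n} = {x. eigenvalue N x}"
proof -
  have "char_poly N \<noteq> 0" using degree_monic_char_poly[OF N] by auto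
  then have "finite {x. eigenvalue N x}"
    using eigenvalues_eq_roots[OF N] poly_roots_finite by simp
  then obtain d where d: "bij_betw d {..<n} {x. eigenvalue N x}"
    using card ex_bij_betw_nat_finite lessThan_atLeast0 by metis
  have "\<exists>v. eigenvector N v (d i)" if "i < n" for i
    using d that by (auto simp: bij_betw_def eigenvalue_def)
  then obtain v where v: "\<And>i. i < n \<Longrightarrow> eigenvector N (v i) (d i)" by metis
  have vc: "v i \<in> carrier_vec n" "v i \<noteq> 0\<^sub>v n" "N *\<^sub>v v i = d i \<cdot>\<^sub>v v i" if "i < n" for i
    using v[OF that] N by (auto simp: eigenvector_def)
  define P where "P = mat_of_cols n (map v [0..<n])"
  have P: "P \<in> carrier_mat n n" by (auto simp: P_def mat_of_cols_def)
  have Pcol: "col P i = v i" if "i < n" for i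
    using that vc by (simp add: P_def)
  have Pidx: "P $$ (a, i) = v i $ a" if "i < n" "a < n" for a i
    using that by (simp add: P_def mat_of_cols_index)
  have NP: "N * P = P * mat_diag n d"
  proof (rule eq_matI)
    fix a i assume "a < dim_row (P * mat_diag n d)" "i < dim_col (P * mat_diag n d)"
    then have ai: "a < n" "i < n" using P by (auto simp: mat_diag_def)
    have "(N * P) $$ (a, i) = (N *\<^sub>v v i) $ a"
      using ai N P by (simp add: Pcol)
    also have "\<dots> = d i * v i $ a" using ai vc(1,3)[of i] by simp
    also have "\<dots> = (P * mat_diag n d) $$ (a, i)"
      using ai by (simp add: mat_diag_mult_right[OF P] Pidx)
    finally show "(N * P) $$ (a, i) = (P * mat_diag n d) $$ (a, i)" .
  qed (use N P in \<open>auto simp: mat_diag_def\<close>)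
  have "det P \<noteq> 0"
  proof
    assume "det P = 0"
    then obtain u where u: "u \<in> carrier_vec n" "u \<noteq> 0\<^sub>v n" "P *\<^sub>v u = 0\<^sub>v n"
      using det_0_iff_vec_prod_zero_field[OF P] by blast
    \<comment> \<open>As \<open>N * P = P * mat_diag n d\<close>, the kernel of \<open>P\<close> is
      stable under multiplying coordinates by \<open>poly p (d i)\<close>. A polynomial vanishing at
      all eigenvalues but \<open>d i\<close> then isolates the coordinate
      \<open>u $ i\<close>.\<close>
    have ND: "P *\<^sub>v vec n (\<lambda>i. poly p (d i) * u $ i) = 0\<^sub>v n" for p
    proof (induction p)
      case 0
      show ?case using P by (auto intro!: eq_vecI simp: scalar_prod_def)
    next
      case (pCons c p)
      let ?w = "vec n (\<lambda>i. poly p (d i) * u $ i)"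
      have "vec n (\<lambda>i. poly (pCons c p) (d i) * u $ i) = c \<cdot>\<^sub>v u + mat_diag n d *\<^sub>v ?w"
        using u by (auto simp: mat_diag_mult_vec algebra_simps)
      then have "P *\<^sub>v vec n (\<lambda>i. poly (pCons c p) (d i) * u $ i)
          = P *\<^sub>v (c \<cdot>\<^sub>v u) + P *\<^sub>v (mat_diag n d *\<^sub>v ?w)"
        using u by (simp add: mat_diag_mult_vec mult_add_distrib_mat_vec[OF P])
      also have "P *\<^sub>v (mat_diag n d *\<^sub>v ?w) = (N * P) *\<^sub>v ?w"
        unfolding NP by (rule assoc_mult_mat_vec[OF P, symmetric]) auto
      also have "\<dots> = N *\<^sub>v (P *\<^sub>v ?w)"
        by (rule assoc_mult_mat_vec[OF N P]) auto
      also have "\<dots> = 0\<^sub>v n" using N by (auto simp: pCons.IH intro!: eq_vecI)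
      also have "P *\<^sub>v (c \<cdot>\<^sub>v u) = c \<cdot>\<^sub>v (P *\<^sub>v u)"
        by (rule mult_mat_vec[OF P u(1)])
      also have "\<dots> = 0\<^sub>v n" by (auto simp: u(3))
      finally show ?case by simp
    qed
    have "u $ i = 0" if i: "i < n" for i
    proof -
      define p where "p = (\<Prod>l\<in>{..<n} - {i}. [:- d l, 1:])"
      have p0: "poly p (d j) = 0" if "j < n" "j \<noteq> i" for j
        using that by (auto simp: p_def poly_prod)
      have p1: "poly p (d i) \<noteq> 0"
        using i d by (auto simp: p_def poly_prod bij_betw_def inj_on_def)
      have "\<exists>a<n. v i $ a \<noteq> 0"
      proof (rule ccontr)
        assume "\<not> (\<exists>a<n. v i $ a \<noteq> 0)"
        then have "v i = 0\<^sub>v n" using vc(1)[OF i] by (intro eq_vecI) auto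
        then show False using vc(2)[OF i] by simp
      qed
      then obtain a where a: "a < n" "v i $ a \<noteq> 0" by blast
      have "0 = (P *\<^sub>v vec n (\<lambda>i. poly p (d i) * u $ i)) $ a" using ND a by simp
      also have "\<dots> = (\<Sum>j<n. v j $ a * (poly p (d j) * u $ j))"
        using a P by (auto simp: scalar_prod_def lessThan_atLeast0 Pidx intro!: sum.cong)
      also have "\<dots> = (\<Sum>j<n. if j = i then v i $ a * (poly p (d i) * u $ i) else 0)"
        by (intro sum.cong) (auto simp: p0)
      also have "\<dots> = v i $ a * (poly p (d i) * u $ i)" using i by simp
      finally show ?thesis using a p1 by simp
    qed
    then show False using u by (auto intro!: eq_vecI)
  qed
  then obtain Q where Q: "Q \<in> carrier_mat n n" "P * Q = 1\<^sub>m n" "Q * P = 1\<^sub>m n"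
    using det_nonzero_inverse[OF P] by blast
  interpret frame n P Q using P Q by unfold_locales auto
  have "N = N * (P * Q)" using N Q by simp
  also have "\<dots> = N * P * Q" using N by (simp add: assoc_mult_mat[of _ n n _ n _ n])
  also have "\<dots> = D d" by (simp only: D_def NP)
  finally show ?thesis using that[OF frame_axioms] d by (auto simp: bij_betw_def)
qed

subsection \<open>Algebraic homomorphisms out of the multiplicative group\<close>

lemma carrier_Gm [simp]: "carrier Gm = - {0}"
  and mult_Gm [simp]: "x \<otimes>\<^bsub>Gm\<^esub> y = x * y"
  and one_Gm [simp]: "\<one>\<^bsub>Gm\<^esub> = 1"
  by (simp_all add: Gm_def)

lemma group_Gm: "group (Gm :: 'a::field monoid)"
proof (rule groupI)
  fix x :: 'a assume "x \<in> carrier Gm"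
  then show "\<exists>y\<in>carrier Gm. y \<otimes>\<^bsub>Gm\<^esub> x = \<one>\<^bsub>Gm\<^esub>"
    by (intro bexI[of _ "inverse x"]) auto
qed auto

lemma regular_sum:
  assumes "0 \<in> C" "finite A" "\<And>a. a \<in> A \<Longrightarrow> h a \<in> regular C S G"
  shows "(\<lambda>x. \<Sum>a\<in>A. h a x) \<in> regular C S G"
  using assms(2,3)
proof (induction A rule: finite_induct)
  case empty
  show ?case using regular.const[OF assms(1)] by simp
next
  case (insert a A)
  then show ?case using regular.add[of "h a" C S G "\<lambda>x. \<Sum>a\<in>A. h a x"] by simp
qed

lemma regular_prod:
  assumes "1 \<in> C" "finite A" "\<And>a. a \<in> A \<Longrightarrow> h a \<in> regular C S G"
  shows "(\<lambda>x. \<Prod>a\<in>A. h a x) \<in> regular C S G"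
  using assms(2,3)
proof (induction A rule: finite_induct)
  case empty
  show ?case using regular.const[OF assms(1)] by simp
next
  case (insert a A)
  then show ?case using regular.mult[of "h a" C S G "\<lambda>x. \<Prod>a\<in>A. h a x"] by simp
qed

lemma regular_power:
  assumes "1 \<in> C" "h \<in> regular C S G"
  shows "(\<lambda>x. h x ^ k) \<in> regular C S G"
  using regular_prod[of C "{..<k}" "\<lambda>_. h" S G] assms by simp

lemma regular_Gm_powi:
  assumes "1 \<in> C"
  shows "(\<lambda>t. t powi m) \<in> regular C S Gm_coords"
proof -
  have "(\<lambda>t. t ^ k) \<in> regular C S Gm_coords" "(\<lambda>t. inverse t ^ k) \<in> regular C S Gm_coords" for k
    by (rule regular_power[OF assms regular.gen]; simp add: Gm_coords_def)+
  then show ?thesis by (cases "m \<ge> 0") (simp_all add: power_int_def)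
qed

text \<open>The numerator keeps its coefficients in the image of \<open>\<phi>\<close>, which is how
  being defined over a subfield survives. It is applied with \<open>to_ac\<close> for cocharacters
  over \<open>F\<close>, and with \<open>id\<close> for characters over a closed field.\<close>

lemma regular_Gm_imp_Laurent:
  fixes \<phi> :: "'a::field \<Rightarrow> 'b::field"
  assumes "field_hom \<phi>" and h: "h \<in> regular (range \<phi>) (- {0}) Gm_coords"
  shows "\<exists>q k. \<forall>t. t \<noteq> 0 \<longrightarrow> h t * t ^ k = poly (map_poly \<phi> q) t"
proof -
  interpret \<phi>: field_hom \<phi> by fact
  interpret mp: map_poly_comm_ring_hom \<phi> ..
  have X: "map_poly \<phi> [:0, 1:] = [:0, 1:]" by simp
  show ?thesis using h
  proof (induction rule: regular.induct)
    case (gen h)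
    then consider "h = (\<lambda>t. t)" | "h = (\<lambda>t. inverse t)" by (auto simp: Gm_coords_def)
    then show ?case
    proof cases
      case 1
      then show ?thesis by (intro exI[of _ "[:0, 1:]"] exI[of _ 0]) simp
    next
      case 2
      then show ?thesis by (intro exI[of _ "1"] exI[of _ 1]) simp
    qed
  next
    case (const c)
    then obtain a where "c = \<phi> a" by auto
    moreover have "poly (map_poly \<phi> [:a:]) t = \<phi> a" for t by (cases "a = 0") simp_all
    ultimately show ?case by (intro exI[of _ "[:a:]"] exI[of _ 0]) (simp del: map_poly_pCons)
  next
    case (add h h')
    then obtain q k q' k' where
      *: "\<And>t. t \<noteq> 0 \<Longrightarrow> h t * t ^ k = poly (map_poly \<phi> q) t"
         "\<And>t. t \<noteq> 0 \<Longrightarrow> h' t * t ^ k' = poly (map_poly \<phi> q') t" by blast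
    have "(h t + h' t) * t ^ (k + k')
        = poly (map_poly \<phi> (q * [:0, 1:] ^ k' + q' * [:0, 1:] ^ k)) t" if "t \<noteq> 0" for t
    proof -
      have "(h t + h' t) * t ^ (k + k') = (h t * t ^ k) * t ^ k' + (h' t * t ^ k') * t ^ k"
        by (simp add: algebra_simps power_add)
      then show ?thesis
        using that by (simp add: * mp.hom_add mp.hom_mult mp.hom_power X del: map_poly_pCons)
    qed
    then show ?case by blast
  next
    case (mult h h')
    then obtain q k q' k' where
      *: "\<And>t. t \<noteq> 0 \<Longrightarrow> h t * t ^ k = poly (map_poly \<phi> q) t"
         "\<And>t. t \<noteq> 0 \<Longrightarrow> h' t * t ^ k' = poly (map_poly \<phi> q') t" by blast
    have "(h t * h' t) * t ^ (k + k') = poly (map_poly \<phi> (q * q')) t" if "t \<noteq> 0" for t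
    proof -
      have "(h t * h' t) * t ^ (k + k') = (h t * t ^ k) * (h' t * t ^ k')"
        by (simp add: algebra_simps power_add)
      then show ?thesis using that by (simp add: * mp.hom_mult)
    qed
    then show ?case by blast
  next
    case (cong h h')
    then show ?case by (metis ComplI singletonD)
  qed
qed

text \<open>In a finite field, one plus the product of all linear factors would be a nonconstant
  polynomial without a root.\<close>

lemma infinite_UNIV_alg_closed: "infinite (UNIV :: 'a::alg_closed_field set)"
proof
  assume fin: "finite (UNIV :: 'a set)"
  define p :: "'a poly" where "p = (\<Prod>a\<in>UNIV. [:- a, 1:])"
  have deg: "Polynomial.degree p = card (UNIV :: 'a set)"
    by (simp add: p_def degree_prod_eq_sum_degree)
  moreover have "card (UNIV :: 'a set) > 0" using fin by (simp add: card_gt_0_iff)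
  ultimately have "Polynomial.degree (p + 1) > 0" by (simp add: degree_add_eq_left)
  then obtain x where "poly (p + 1) x = 0" using alg_closed_imp_poly_has_root by blast
  moreover have "poly p x = 0" using fin by (simp add: p_def poly_prod)
  ultimately show False by simp
qed

text \<open>A nonzero exponent would turn infinitely many elements into roots of
  \<open>X^k - 1\<close>. This is the device by which relations between weights are read off from
  identities in powers of the parameter.\<close>

lemma power_int_eq_one_imp_zero:
  assumes "\<And>t :: 'a::alg_closed_field. t \<noteq> 0 \<Longrightarrow> t powi m = 1"
  shows "m = 0"
proof (rule ccontr)
  assume "m \<noteq> 0"
  define k where "k = nat \<bar>m\<bar>"
  have k: "k > 0" using \<open>m \<noteq> 0\<close> by (simp add: k_def)
  have "t ^ k = 1" if "t \<noteq> 0" for t :: 'a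
  proof -
    have "t powi \<bar>m\<bar> = 1"
      using assms[OF that] by (cases "m \<ge> 0") (auto simp: power_int_minus abs_if)
    then show ?thesis by (simp add: k_def power_int_def)
  qed
  then have "UNIV - {0} \<subseteq> {t :: 'a. poly (Polynomial.monom 1 k - 1) t = 0}"
    by (auto simp: poly_monom)
  moreover have "poly.coeff (Polynomial.monom 1 k - 1 :: 'a poly) k = 1"
    using k by simp
  then have "Polynomial.monom 1 k - 1 \<noteq> (0 :: 'a poly)" by (metis coeff_0 zero_neq_one)
  ultimately have "finite (UNIV - {0 :: 'a})"
    using poly_roots_finite finite_subset by blast
  then show False using infinite_UNIV_alg_closed[where 'a = 'a] by simp
qed

text \<open>The numerator of a nowhere vanishing Laurent polynomial has no root except possibly \<open>0\<close>.\<close>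

lemma nonvanishing_regular_Gm:
  fixes \<chi> :: "'a::alg_closed_field \<Rightarrow> 'a"
  assumes \<chi>: "\<chi> \<in> regular UNIV (- {0}) Gm_coords"
    and nz: "\<And>t. t \<noteq> 0 \<Longrightarrow> \<chi> t \<noteq> 0" and one: "\<chi> 1 = 1"
  shows "\<exists>m :: int. \<forall>t. t \<noteq> 0 \<longrightarrow> \<chi> t = t powi m"
proof -
  have "field_hom (id :: 'a \<Rightarrow> 'a)" by unfold_locales auto
  from regular_Gm_imp_Laurent[OF this, of \<chi>] \<chi>
  obtain q k where q: "\<And>t. t \<noteq> 0 \<Longrightarrow> \<chi> t * t ^ k = poly q t" by auto
  have "q \<noteq> 0" using q[of 1] one by auto
  then obtain r where r: "q = [:- 0, 1:] ^ order 0 q * r" "\<not> [:- 0, 1:] dvd r"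
    using order_decomp by blast
  have qr: "poly q t = t ^ order 0 q * poly r t" for t
    by (subst r(1)) simp
  have "Polynomial.degree r = 0"
  proof (rule ccontr)
    assume "Polynomial.degree r \<noteq> 0"
    then obtain x where x: "poly r x = 0" using alg_closed_imp_poly_has_root by blast
    then have "x \<noteq> 0" using r(2) by (metis poly_eq_0_iff_dvd)
    then show False using q[of x] nz[of x] qr[of x] x by auto
  qed
  then obtain c where c: "r = [:c:]" by (metis degree_eq_zeroE)
  have "c = 1" using q[of 1] qr[of 1] one c by simp
  then have "\<chi> t = t powi (int (order 0 q) - int k)" if "t \<noteq> 0" for t
    using q[OF that] qr[of t] that by (simp add: c power_int_diff field_simps)
  then show ?thesis by blast
qed

subsection \<open>The centralizer of a regular semisimple element is a torus\<close>

lemma carrier_centralizer_SL: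
  "carrier (centralizer_SL n N) = {g \<in> SL n. g * map_mat to_ac N = map_mat to_ac N * g}"
  and mult_centralizer_SL [simp]: "x \<otimes>\<^bsub>centralizer_SL n N\<^esub> y = x * y"
  by (simp_all add: centralizer_SL_def)

lemma group_torus: "group (torus r :: (nat \<Rightarrow> 'a::field) monoid)"
  unfolding torus_def by (rule product_group) (rule group_Gm)

text \<open>In an eigenbasis the centralizer consists of the diagonal matrices of determinant 1. The
  first \<open>n - 1\<close> diagonal entries are free coordinates, and \<open>ext\<close> fills in
  the last one as the inverse of their product.\<close>

lemma is_torus_centralizer_SL:
  fixes N :: "'a::field mat"
  assumes N: "N \<in> carrier_mat n n" and n: "n > 0"
    and card: "card {x. eigenvalue (map_mat to_ac N) x} = n"
  shows "is_torus n (centralizer_SL n N)"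
proof -
  define T where "T = centralizer_SL n N"
  define N' where "N' = map_mat to_ac N"
  have N': "N' \<in> carrier_mat n n" using N by (simp add: N'_def)
  have "card {x. eigenvalue N' x} = n" using card by (simp add: N'_def)
  then obtain P Q d where "frame n P Q" and N'D: "N' = frame.D n P Q d" and inj: "inj_on d {..<n}"
    by (rule diagonalizable_if_distinct_eigenvalues[OF N'])
  then interpret frame n P Q by simp
  obtain r where r: "n = Suc r" using n by (cases n) auto
  define ext :: "(nat \<Rightarrow> 'a alg_closure) \<Rightarrow> nat \<Rightarrow> 'a alg_closure"
    where "ext t i = (if i < r then t i else inverse (\<Prod>j<r. t j))" for t i
  define \<phi> where "\<phi> t = D (ext t)" for t
  define e where "e g i = (Q * g * P) $$ (i, i)" for g i
  define \<psi> where "\<psi> g = (\<lambda>i\<in>{..<r}. e g i)" for g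
  have carT: "carrier T = {g \<in> carrier_mat n n. det g = 1 \<and> g * N' = N' * g}"
    by (auto simp: T_def carrier_centralizer_SL SL_def N'_def)
  have carR: "carrier (torus r) = (\<Pi>\<^sub>E i\<in>{..<r}. - {0 :: 'a alg_closure})"
    by (simp add: torus_def)
  have \<phi>T: "\<phi> t \<in> carrier T" if "t \<in> carrier (torus r)" for t
  proof -
    have "(\<Prod>j<r. t j) \<noteq> 0" using that by (auto simp: carR PiE_def Pi_def)
    then have "(\<Prod>i<n. ext t i) = 1" by (simp add: r ext_def)
    then have "det (\<phi> t) = 1" by (simp add: \<phi>_def det_D)
    then show ?thesis by (simp add: carT \<phi>_def N'D D_mult mult.commute)
  qed
  have gD: "g = D (\<lambda>i. e g i)" if "g \<in> carrier T" for g
    using that commutes_with_D[OF _ _ inj] unfolding e_def by (auto simp: carT N'D)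
  have prod1: "(\<Prod>i<n. e g i) = 1" if "g \<in> carrier T" for g
    using arg_cong[OF gD[OF that], of det] that by (simp add: det_D carT)
  have e0: "e g i \<noteq> 0" if "g \<in> carrier T" "i < n" for g i
    using prod1[OF that(1)] prod_zero[of "{..<n}" "e g"] that(2) by auto
  have \<psi>R: "\<psi> g \<in> carrier (torus r)" if "g \<in> carrier T" for g
    using e0[OF that] by (auto simp: carR \<psi>_def r)
  have \<phi>\<psi>: "\<phi> (\<psi> g) = g" if g: "g \<in> carrier T" for g
  proof -
    have "(\<Prod>j<r. e g j) * e g r = 1"
      using prod1[OF g] by (simp add: r)
    then have "e g r = inverse (\<Prod>j<r. e g j)"
      by (metis inverse_unique)
    then have "\<phi> (\<psi> g) = D (\<lambda>i. e g i)"
      unfolding \<phi>_def by (intro D_cong) (auto simp: ext_def \<psi>_def r less_Suc_eq)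
    then show ?thesis using gD[OF g] by simp
  qed
  have injR: "inj_on \<phi> (carrier (torus r))"
  proof (rule inj_onI)
    fix s t assume s: "s \<in> carrier (torus r)" and t: "t \<in> carrier (torus r)" and eq: "\<phi> s = \<phi> t"
    have "s i = t i" if "i < r" for i
      using D_eqD[OF eq[unfolded \<phi>_def], of i] that by (simp add: ext_def r)
    then show "s = t" using s t unfolding carR by (intro PiE_ext[of s _ _ t]) auto
  qed
  have inv: "inv_into (carrier (torus r)) \<phi> g = \<psi> g" if "g \<in> carrier T" for g
    by (rule inv_into_f_eq[OF injR]) (rule \<psi>R[OF that], rule \<phi>\<psi>[OF that])
  have hom: "\<phi> \<in> hom (torus r) T"
  proof (rule homI)
    fix s t :: "nat \<Rightarrow> 'a alg_closure"
    assume st: "s \<in> carrier (torus r)" "t \<in> carrier (torus r)"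
    have "ext (s \<otimes>\<^bsub>torus r\<^esub> t) i = ext s i * ext t i" for i
      by (auto simp: ext_def torus_def prod.distrib)
    then have "ext (s \<otimes>\<^bsub>torus r\<^esub> t) = (\<lambda>i. ext s i * ext t i)" by (rule HOL.ext)
    then show "\<phi> (s \<otimes>\<^bsub>torus r\<^esub> t) = \<phi> s \<otimes>\<^bsub>T\<^esub> \<phi> t"
      by (simp add: \<phi>_def D_mult T_def)
  qed (rule \<phi>T)
  have iso: "\<phi> \<in> iso (torus r) T"
    using hom injR \<phi>T \<psi>R \<phi>\<psi> unfolding iso_def bij_betw_def by (auto intro!: image_eqI[of _ \<phi> "\<psi> _"])
  have "inv_into (carrier (torus r)) \<phi> \<in> iso T (torus r)"
    by (rule group.iso_set_sym[OF group_torus iso])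
  then have hom': "inv_into (carrier (torus r)) \<phi> \<in> hom T (torus r)"
    by (simp add: iso_def)
  let ?R = "regular UNIV (carrier (torus r)) (torus_coords r)"
  let ?T = "regular UNIV (carrier T) (GL_coords n)"
  have ext_regular: "(\<lambda>t. ext t i) \<in> ?R" for i
  proof (cases "i < r")
    case True
    then show ?thesis by (auto simp: ext_def torus_coords_def intro!: regular.gen)
  next
    case False
    have "(\<lambda>t. \<Prod>j<r. inverse (t j)) \<in> ?R"
      by (intro regular_prod regular.gen) (auto simp: torus_coords_def)
    then show ?thesis using False by (simp add: ext_def prod_inversef[unfolded comp_def])
  qed
  have "h \<circ> \<phi> \<in> ?R" if h: "h \<in> GL_coords n" for h
  proof -
    consider i j where "h = (\<lambda>g. g $$ (i, j))" "i < n" "j < n" | "h = (\<lambda>g. inverse (det g))"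
      using h unfolding GL_coords_def by blast
    then show ?thesis
    proof cases
      case 1
      have "(\<lambda>t. \<Sum>l<n. P $$ (i, l) * ext t l * Q $$ (l, j)) \<in> ?R"
        by (intro regular_sum regular.mult ext_regular regular.const) auto
      then show ?thesis using 1 by (simp add: comp_def \<phi>_def D_index)
    next
      case 2
      show ?thesis
        by (rule regular.cong[OF regular.const[of 1]]) (use 2 \<phi>T in \<open>auto simp: carT\<close>)
    qed
  qed
  then have alg: "algebraic_hom UNIV (torus r) (torus_coords r) T (GL_coords n) \<phi>"
    using hom \<phi>T by (auto simp: algebraic_hom_def variety_morphism_def)
  have entry: "(\<lambda>g. e g i) \<in> ?T" if i: "i < n" for i
  proof (rule regular.cong)
    show "(\<lambda>g. \<Sum>b<n. (\<Sum>a<n. Q $$ (i, a) * g $$ (a, b)) * P $$ (b, i)) \<in> ?T"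
      by (intro regular_sum regular.mult regular.const regular.gen) (auto simp: GL_coords_def)
    show "\<forall>g\<in>carrier T. e g i
        = (\<Sum>b<n. (\<Sum>a<n. Q $$ (i, a) * g $$ (a, b)) * P $$ (b, i))"
      using i unfolding e_def
      by (intro ballI triple_mult_index[OF Q_carrier _ P_carrier]) (auto simp: carT)
  qed
  have "h \<circ> inv_into (carrier (torus r)) \<phi> \<in> ?T" if h: "h \<in> torus_coords r" for h
  proof -
    consider i where "h = (\<lambda>t. t i)" "i < r" | i where "h = (\<lambda>t. inverse (t i))" "i < r"
      using h unfolding torus_coords_def by blast
    then show ?thesis
    proof cases
      case 1
      then show ?thesis
        by (intro regular.cong[OF entry[of i]]) (auto simp: inv \<psi>_def r)
    next
      case 2
      \<comment> \<open>The inverse of a coordinate must again be regular on the centralizer. Since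
        all diagonal entries multiply to 1, it is the product of the other entries.\<close>
      have inverse: "inverse (e g i) = (\<Prod>j\<in>{..<n} - {i}. e g j)"
        if "g \<in> carrier T" for g
      proof (rule inverse_unique)
        show "e g i * (\<Prod>j\<in>{..<n} - {i}. e g j) = 1"
          using prod1[OF that] 2 prod.remove[of "{..<n}" i "\<lambda>j. e g j"]
          by (simp add: r)
      qed
      have "(\<lambda>g. \<Prod>j\<in>{..<n} - {i}. e g j) \<in> ?T"
        by (intro regular_prod entry) auto
      then show ?thesis using 2 inverse
        by (elim regular.cong) (auto simp: inv \<psi>_def)
    qed
  qed
  then have alg': "algebraic_hom UNIV T (GL_coords n) (torus r) (torus_coords r)
      (inv_into (carrier (torus r)) \<phi>)"
    using hom' inv \<psi>R by (auto simp: algebraic_hom_def variety_morphism_def)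
  show ?thesis
    unfolding is_torus_def T_def[symmetric] using iso alg alg' by blast
qed

subsection \<open>Elliptic elements\<close>

interpretation to_ac: field_hom "to_ac :: 'a::field \<Rightarrow> 'a alg_closure"
  by unfold_locales simp_all

lemma regular_mono: "h \<in> regular C S G \<Longrightarrow> C \<subseteq> C' \<Longrightarrow> h \<in> regular C' S G"
proof (induction rule: regular.induct)
  case (cong h h')
  then show ?case using regular.cong by blast
qed (auto intro: regular.intros)

lemma poly_eqI_nonzero:
  fixes p q :: "'a::field poly"
  assumes inf: "infinite (UNIV :: 'a set)" and "\<And>t. t \<noteq> 0 \<Longrightarrow> poly p t = poly q t"
  shows "p = q"
proof (rule ccontr)
  assume "p \<noteq> q"
  then have "finite {t. poly (p - q) t = 0}" by (intro poly_roots_finite) simp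
  moreover have "UNIV - {0} \<subseteq> {t. poly (p - q) t = 0}" using assms by auto
  ultimately have "finite (UNIV - {0 :: 'a})" by (rule finite_subset[rotated])
  then show False using inf by simp
qed

lemma hom_Gm_centralizer_SL:
  assumes "\<chi> \<in> hom Gm (centralizer_SL n N)" "t \<noteq> 0" "u \<noteq> 0"
  shows "\<chi> t \<in> SL n" "\<chi> t * map_mat to_ac N = map_mat to_ac N * \<chi> t" "\<chi> (t * u) = \<chi> t * \<chi> u"
  using assms by (auto simp: hom_def Pi_def carrier_centralizer_SL)

text \<open>Over the algebraic closure a cocharacter is \<open>diag(t\<^bsup>m\<^sub>i\<^esup>)\<close> in an eigenbasis of \<open>N\<close>.  The projection
  \<open>B\<close> onto the weight space of \<open>m\<^sub>0\<close> is a Laurent coefficient of the cocharacter, hence is defined over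
  \<open>F\<close>, and so is \<open>det (B N + 1 - B)\<close>.  Its \<open>n\<close>-th power is \<open>c ^ rank B\<close>, so taking valuations gives
  \<open>n dvd rank B\<close>.\<close>

lemma cocharacter_trivial:
  fixes N :: "'k::field fls mat"
  assumes N: "N \<in> carrier_mat n n" and n: "n > 0"
    and card: "card {x. eigenvalue (map_mat to_ac N) x} = n"
    and eig: "\<And>x. eigenvalue (map_mat to_ac N) x \<Longrightarrow> x ^ n = to_ac c"
    and c: "c \<noteq> 0" "coprime (fls_subdegree c) (int n)"
    and \<chi>: "algebraic_hom (range to_ac) Gm Gm_coords (centralizer_SL n N) (GL_coords n) \<chi>"
    and t: "t \<noteq> 0"
  shows "\<chi> t = 1\<^sub>m n"
proof -
  define N' where "N' = map_mat to_ac N"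
  have N': "N' \<in> carrier_mat n n" using N by (simp add: N'_def)
  have "card {x. eigenvalue N' x} = n" using card by (simp add: N'_def)
  then obtain P Q d where "frame n P Q" and N'D: "N' = frame.D n P Q d" and inj: "inj_on d {..<n}"
    and range: "d ` {..<n} = {x. eigenvalue N' x}"
    by (rule diagonalizable_if_distinct_eigenvalues[OF N'])
  then interpret frame n P Q by simp
  have dn: "d i ^ n = to_ac c" if "i < n" for i
    using range that by (intro eig) (auto simp: N'_def)
  interpret mp: map_poly_inj_idom_hom "to_ac :: 'k fls \<Rightarrow> 'k fls alg_closure" ..
  have hom: "\<chi> \<in> hom Gm (centralizer_SL n N)"
    and reg: "\<And>h. h \<in> GL_coords n \<Longrightarrow> h \<circ> \<chi> \<in> regular (range to_ac) (- {0}) Gm_coords"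
    using \<chi> by (auto simp: algebraic_hom_def variety_morphism_def)
  have reg_entry: "(\<lambda>t. \<chi> t $$ (a, b)) \<in> regular (range to_ac) (- {0}) Gm_coords"
    if "a < n" "b < n" for a b
    using reg[of "\<lambda>g. g $$ (a, b)"] that by (auto simp: GL_coords_def comp_def)
  have \<chi>c: "\<chi> t \<in> carrier_mat n n" and \<chi>det: "det (\<chi> t) = 1" if "t \<noteq> 0" for t
    using hom_Gm_centralizer_SL(1)[OF hom that that] by (auto simp: SL_def)
  define f where "f t i = (Q * \<chi> t * P) $$ (i, i)" for t i
  have \<chi>D: "\<chi> t = D (f t)" if "t \<noteq> 0" for t
    using commutes_with_D[OF \<chi>c[OF that] _ inj] hom_Gm_centralizer_SL(2)[OF hom that that]
    unfolding f_def N'D[symmetric] N'_def by blast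
  have f_nz: "f t i \<noteq> 0" if "t \<noteq> 0" "i < n" for t i
    using \<chi>det[OF that(1)] prod_zero[of "{..<n}" "f t"] that(2) by (auto simp: \<chi>D[OF that(1)] det_D)
  have "D (f 1) = D (\<lambda>i. f 1 i * f 1 i)"
    using hom_Gm_centralizer_SL(3)[OF hom, of 1 1] by (simp add: \<chi>D D_mult)
  then have f_one: "f 1 i = 1" if "i < n" for i
    using D_eqD[of "f 1" "\<lambda>i. f 1 i * f 1 i" i] f_nz[of 1 i] that by simp
  have f_reg: "(\<lambda>t. f t i) \<in> regular UNIV (- {0}) Gm_coords" if i: "i < n" for i
  proof (rule regular.cong)
    show "(\<lambda>t. \<Sum>b<n. (\<Sum>a<n. Q $$ (i, a) * \<chi> t $$ (a, b)) * P $$ (b, i))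
        \<in> regular UNIV (- {0}) Gm_coords"
      by (intro regular_sum regular.mult regular.const regular_mono[OF reg_entry]) auto
    show "\<forall>t\<in>- {0}. f t i = (\<Sum>b<n. (\<Sum>a<n. Q $$ (i, a) * \<chi> t $$ (a, b)) * P $$ (b, i))"
      unfolding f_def using i \<chi>c
      by (intro ballI triple_mult_index[OF Q_carrier _ P_carrier]) auto
  qed
  have "\<exists>m :: int. \<forall>t. t \<noteq> 0 \<longrightarrow> f t i = t powi m" if "i < n" for i
    by (rule nonvanishing_regular_Gm) (use f_reg f_nz f_one that in auto)
  then obtain m where m: "\<And>i t. i < n \<Longrightarrow> t \<noteq> 0 \<Longrightarrow> f t i = t powi m i" by metis
  define S where "S = {i. i < n \<and> m i = m 0}"
  define A where "A = D (\<lambda>i. if i \<in> S then 1 else 0)"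
  obtain K :: nat where K: "\<And>i. i < n \<Longrightarrow> \<bar>m i\<bar> \<le> int K"
  proof -
    have "\<bar>m i\<bar> \<le> int (\<Sum>j<n. nat \<bar>m j\<bar>)" if "i < n" for i
      using member_le_sum[of i "{..<n}" "\<lambda>j. \<bar>m j\<bar>"] that by simp
    then show ?thesis using that by blast
  qed
  have A_range: "A $$ (a, b) \<in> range to_ac" if ab: "a < n" "b < n" for a b
  proof -
    obtain q k where q: "\<And>t. t \<noteq> 0 \<Longrightarrow> \<chi> t $$ (a, b) * t ^ k = poly (map_poly to_ac q) t"
      using regular_Gm_imp_Laurent[OF _ reg_entry[OF ab]] to_ac.field_hom_axioms by blast
    \<comment> \<open>Multiplying by \<open>t ^ (K + k)\<close> clears both the negative weights and
      the denominator \<open>t ^ k\<close> of this entry, and moves weight \<open>m i\<close> to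
      exponent \<open>e i\<close>. The coefficient at \<open>e 0\<close> is the entry of
      \<open>A\<close> on one side and an element of the image of \<open>to_ac\<close> on the
      other.\<close>
    define e where "e i = nat (m i + int K) + k" for i
    define L where "L = (\<Sum>i<n. Polynomial.monom (P $$ (a, i) * Q $$ (i, b)) (e i))"
    have te: "t ^ e i = t powi m i * t ^ (K + k)" if "i < n" "t \<noteq> 0"
      for i and t :: "'k fls alg_closure"
    proof -
      have e: "int (e i) = m i + int (K + k)" using K[OF that(1)] by (simp add: e_def)
      have "t powi int (e i) = t powi m i * t powi int (K + k)"
        unfolding e using that(2) by (subst power_int_add) auto
      then show ?thesis by (simp only: power_int_of_nat)
    qed
    have "poly L t = poly (map_poly to_ac (Polynomial.monom 1 K * q)) t" if "t \<noteq> 0" for t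
    proof -
      have "poly L t = (\<Sum>i<n. P $$ (a, i) * f t i * Q $$ (i, b)) * t ^ (K + k)"
        unfolding L_def poly_sum sum_distrib_right using that
        by (intro sum.cong) (simp_all add: poly_monom te m)
      also have "\<dots> = (\<chi> t $$ (a, b) * t ^ k) * t ^ K"
        using ab that by (simp add: \<chi>D D_index power_add ac_simps)
      also have "\<dots> = poly (map_poly to_ac (Polynomial.monom 1 K * q)) t"
        using that by (simp add: q mp.hom_mult poly_monom)
      finally show ?thesis .
    qed
    then have "poly.coeff L (e 0) = to_ac (poly.coeff (Polynomial.monom 1 K * q) (e 0))"
      by (subst poly_eqI_nonzero[OF infinite_UNIV_alg_closed]) auto
    moreover have "e i = e 0 \<longleftrightarrow> i \<in> S" if "i < n" for i
      using K[OF that] K[of 0] n that by (auto simp: e_def S_def)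
    then have "poly.coeff L (e 0) = A $$ (a, b)"
      using ab by (auto simp: L_def A_def D_index coeff_sum intro!: sum.cong)
    ultimately show ?thesis by auto
  qed
  define B where "B = map_mat of_ac A"
  have B: "B \<in> carrier_mat n n" by (simp add: B_def A_def)
  have BA: "map_mat to_ac B = A"
    using A_range by (intro eq_matI) (auto simp: B_def A_def to_ac_of_ac)
  \<comment> \<open>\<open>C\<close> acts as \<open>N\<close> on the image of \<open>B\<close> and
    as the identity on its kernel. Its determinant is the product of the eigenvalues indexed by
    \<open>S\<close>, which thereby lies in \<open>F\<close> although the single eigenvalues need
    not.\<close>
  define C where "C = B * N + (1\<^sub>m n - B)"
  have C: "C \<in> carrier_mat n n" using B N by (simp add: C_def minus_carrier_mat)
  have "map_mat to_ac C = map_mat to_ac (B * N) + (1\<^sub>m n - A)"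
    unfolding BA[symmetric] using B N by (intro eq_matI) (auto simp: C_def)
  also have "map_mat to_ac (B * N) = A * N'"
    using to_ac.mat_hom_mult[OF B N] by (simp add: BA N'_def)
  also have "A * N' + (1\<^sub>m n - A) = D (\<lambda>i. if i \<in> S then d i else 1)"
  proof -
    have "1\<^sub>m n - A = 1\<^sub>m n + (- 1) \<cdot>\<^sub>m A"
      by (intro eq_matI) (auto simp: A_def)
    also have "\<dots> = D (\<lambda>i. if i \<in> S then 0 else 1)"
      unfolding A_def D_smult D_one[symmetric] D_add by (rule D_cong) auto
    finally show ?thesis
      unfolding N'D A_def D_mult by (simp add: D_add) (rule D_cong, auto)
  qed
  finally have "to_ac (det C) = (\<Prod>i<n. if i \<in> S then d i else 1)"
    by (simp add: det_D flip: to_ac.hom_det)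
  also have "\<dots> = (\<Prod>i\<in>S. d i)"
    by (rule prod.mono_neutral_cong_right) (auto simp: S_def)
  finally have "to_ac (det C ^ n) = (\<Prod>i\<in>S. d i ^ n)"
    by (simp add: prod_power_distrib)
  also have "\<dots> = to_ac (c ^ card S)" using dn by (simp add: S_def)
  finally have "det C ^ n = c ^ card S" by (simp only: to_ac_eq_iff)
  then have "int n * fls_subdegree (det C) = int (card S) * fls_subdegree c"
    by (metis fls_subdegree_pow)
  then have "int n dvd int (card S) * fls_subdegree c" by (metis dvd_triv_left)
  then have "n dvd card S"
    using c(2) by (simp add: coprime_dvd_mult_left_iff coprime_commute)
  moreover have "0 \<in> S" "finite S" "S \<subseteq> {..<n}" using n by (auto simp: S_def)
  then have "card S > 0" "card S \<le> n"
    using card_mono[of "{..<n}" S] by (auto simp: card_gt_0_iff)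
  ultimately have "card S = n" using dvd_imp_le by fastforce
  then have "S = {..<n}" using \<open>S \<subseteq> {..<n}\<close> by (intro card_subset_eq) auto
  then have mi: "m i = m 0" if "i < n" for i using that unfolding S_def by blast
  have \<chi>t: "\<chi> t = D (\<lambda>_. t powi m 0)" if "t \<noteq> 0" for t
    unfolding \<chi>D[OF that] by (intro D_cong) (metis m mi that)
  \<comment> \<open>Only scalar cocharacters \<open>t powi m 0\<close> are left, and determinant 1
    makes the weight vanish.\<close>
  have "t powi (m 0 * int n) = 1" if "t \<noteq> 0" for t :: "'k fls alg_closure"
    using \<chi>det[OF that] by (simp add: \<chi>t[OF that] det_D power_int_mult)
  then have "m 0 * int n = 0" by (rule power_int_eq_one_imp_zero)
  then show ?thesis using t n by (simp add: \<chi>t D_one)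
qed

text \<open>Horner's scheme with coefficients in the base field: a projection obtained as a
  polynomial in \<open>N\<close> is automatically rational.\<close>

lemma polynomial_in_matrix:
  fixes N :: "'a::field mat" and P Q :: "'a alg_closure mat"
  assumes N: "N \<in> carrier_mat n n" and frame: "frame n P Q"
    and ND: "map_mat to_ac N = frame.D n P Q d"
  shows "\<exists>A\<in>carrier_mat n n. map_mat to_ac A = frame.D n P Q (\<lambda>i. poly (map_poly to_ac p) (d i))"
proof -
  interpret frame n P Q by fact
  show ?thesis
  proof (induction p)
    case 0
    show ?case
      using D_const[of 0] by (intro bexI[of _ "0\<^sub>m n n"]) (auto intro!: eq_matI)
  next
    case (pCons a p)
    then obtain A where A: "A \<in> carrier_mat n n"
      "map_mat to_ac A = D (\<lambda>i. poly (map_poly to_ac p) (d i))" by blast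
    let ?A = "a \<cdot>\<^sub>m 1\<^sub>m n + N * A"
    have "map_mat to_ac ?A = to_ac a \<cdot>\<^sub>m 1\<^sub>m n + map_mat to_ac (N * A)"
      using N A by (intro eq_matI) auto
    also have "\<dots> = D (\<lambda>i. to_ac a + d i * poly (map_poly to_ac p) (d i))"
      using to_ac.mat_hom_mult[OF N A(1)] by (simp add: A ND D_mult D_add flip: D_const)
    finally show ?case
      using N A pCons.hyps by (intro bexI[of _ ?A]) simp_all
  qed
qed

text \<open>With \<open>w\<close> the prime-to-\<open>X\<close> part of the characteristic polynomial of \<open>g(N)\<close>, the matrix
  \<open>A = w(g(N)) / w(0)\<close> is the projection onto the eigenspaces of the roots of \<open>g\<close>, and it is defined over
  the base field.  If \<open>A\<close> has rank \<open>r\<close>, then \<open>t \<mapsto> t\<^bsup>n-r\<^esup> A + t\<^bsup>-r\<^esup> (1 - A)\<close> is a cocharacter.\<close>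

lemma elliptic_imp_irreducible_char_poly:
  fixes N :: "'a::field mat"
  assumes N: "N \<in> carrier_mat n n"
    and card: "card {x. eigenvalue (map_mat to_ac N) x} = n"
    and ell: "elliptic n N"
    and gh: "char_poly N = g * h"
  shows "Polynomial.degree g = 0 \<or> Polynomial.degree h = 0"
proof (rule ccontr)
  assume "\<not> ?thesis"
  then have deg: "Polynomial.degree g > 0" "Polynomial.degree h > 0" by auto
  have nz: "g \<noteq> 0" "h \<noteq> 0" using deg by auto
  have deg_n: "Polynomial.degree g + Polynomial.degree h = n"
    using degree_monic_char_poly[OF N] gh nz by (simp add: degree_mult_eq)
  define N' where "N' = map_mat to_ac N"
  have N': "N' \<in> carrier_mat n n" using N by (simp add: N'_def)
  have "card {x. eigenvalue N' x} = n" using card by (simp add: N'_def)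
  then obtain P Q d where fr: "frame n P Q" and N'D: "N' = frame.D n P Q d" and inj: "inj_on d {..<n}"
    and range: "d ` {..<n} = {x. eigenvalue N' x}"
    by (rule diagonalizable_if_distinct_eigenvalues[OF N'])
  interpret frame n P Q by (rule fr)
  interpret mp: map_poly_inj_idom_hom "to_ac :: 'a \<Rightarrow> 'a alg_closure" ..
  have char': "char_poly N' = map_poly to_ac g * map_poly to_ac h"
    unfolding N'_def using to_ac.char_poly_hom[OF N] gh by (simp add: mp.hom_mult)
  define I where "I = {i. i < n \<and> poly (map_poly to_ac g) (d i) = 0}"
  have I: "finite I" "I \<subseteq> {..<n}" by (auto simp: I_def)
  have "card I \<le> card {x. poly (map_poly to_ac g) x = 0}"
    using inj nz by (intro card_inj_on_le[of d] poly_roots_finite) (auto simp: I_def inj_on_def)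
  also have "\<dots> \<le> Polynomial.degree g"
    using card_poly_roots_bound[of "map_poly to_ac g"] nz by simp
  \<comment> \<open>\<open>I\<close> is proper because \<open>h\<close> has positive degree. A root
    of \<open>g\<close>, found next, shows that it is also nonempty.\<close>
  finally have I_less: "card I < n" using deg_n deg by simp
  obtain x where x: "poly (map_poly to_ac g) x = 0"
    using alg_closed_imp_poly_has_root[of "map_poly to_ac g"] deg by auto
  then have "eigenvalue N' x" by (simp add: eigenvalue_root_char_poly[OF N'] char')
  then obtain i where i: "i \<in> I" using range x by (force simp: I_def)
  obtain G where G: "G \<in> carrier_mat n n"
    "map_mat to_ac G = D (\<lambda>i. poly (map_poly to_ac g) (d i))"
    using polynomial_in_matrix[OF N fr N'D[unfolded N'_def]] by blast
  have "char_poly G \<noteq> 0" using degree_monic_char_poly[OF G(1)] by auto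
  then obtain w where w: "char_poly G = [:- 0, 1:] ^ order 0 (char_poly G) * w" "\<not> [:- 0, 1:] dvd w"
    using order_decomp by blast
  have w0: "poly w 0 \<noteq> 0" using w(2) by (simp add: poly_eq_0_iff_dvd)
  \<comment> \<open>All nonzero eigenvalues of \<open>G\<close> are roots of \<open>w\<close>,
    whereas \<open>w(0)\<close> is nonzero. Hence \<open>w / w(0)\<close> is 1 at the value 0 and
    vanishes at every nonzero value of \<open>g\<close> on the eigenvalues of
    \<open>N\<close>.\<close>
  have w_root: "poly (map_poly to_ac w) y = 0" if y: "y \<noteq> 0" "y = poly (map_poly to_ac g) (d i)" "i < n" for y i
  proof -
    have "poly (char_poly (map_mat to_ac G)) y = 0"
    proof -
      have "similar_mat_wit (map_mat to_ac G) (mat_diag n (\<lambda>i. poly (map_poly to_ac g) (d i))) P Q"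
        unfolding G(2) D_def by (rule similar_mat_witI[of _ _ n]) (auto simp: PQ QP)
      then have "char_poly (map_mat to_ac G) = char_poly (mat_diag n (\<lambda>i. poly (map_poly to_ac g) (d i)))"
        by (intro char_poly_similar) (auto simp: similar_mat_def)
      also have "\<dots> = (\<Prod>a\<leftarrow>map (\<lambda>i. poly (map_poly to_ac g) (d i)) [0..<n]. [:- a, 1:])"
        by (subst char_poly_upper_triangular[of _ n])
           (auto simp: upper_triangular_def mat_diag_def diag_mat_def intro!: arg_cong[of _ _ prod_list])
      finally show ?thesis
        using y by (auto simp: poly_prod_list prod_list_zero_iff comp_def)
    qed
    moreover have "char_poly (map_mat to_ac G) = [:- 0, 1:] ^ order 0 (char_poly G) * map_poly to_ac w"
      unfolding to_ac.char_poly_hom[OF G(1)] by (subst w(1)) (simp add: mp.hom_mult mp.hom_power)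
    ultimately show ?thesis using y(1) by simp
  qed
  obtain A where A: "A \<in> carrier_mat n n" "map_mat to_ac A
      = D (\<lambda>i. poly (map_poly to_ac (Polynomial.smult (inverse (poly w 0)) w)) (poly (map_poly to_ac g) (d i)))"
    using polynomial_in_matrix[OF G(1) fr G(2)] by blast
  have "map_mat to_ac A = D (\<lambda>i. if i \<in> I then 1 else 0)"
    unfolding A(2)
  proof (rule D_cong)
    fix i assume "i < n"
    then show "poly (map_poly to_ac (Polynomial.smult (inverse (poly w 0)) w)) (poly (map_poly to_ac g) (d i))
        = (if i \<in> I then 1 else 0)"
      using w_root[of _ i] w0 by (auto simp: I_def hom_distribs)
  qed
  note A = A(1) this
  define r where "r = int (card I)"
  \<comment> \<open>The two weights balance: rank \<open>r\<close> with weight \<open>n - r\<close>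
    against rank \<open>n - r\<close> with weight \<open>- r\<close> gives determinant 1.\<close>
  define \<chi> where "\<chi> t = D (\<lambda>i. if i \<in> I then t powi (int n - r) else t powi (- r))" for t
  have det: "det (\<chi> t) = 1" if t: "t \<noteq> 0" for t
  proof -
    have "det (\<chi> t) = (t powi (int n - r)) ^ card I * (t powi (- r)) ^ card ({..<n} - I)"
      using I by (simp add: \<chi>_def det_D prod.If_cases Int_absorb1 Diff_eq)
    also have "card ({..<n} - I) = n - card I" using I by (simp add: card_Diff_subset)
    also have "(t powi (int n - r)) ^ card I * (t powi (- r)) ^ (n - card I)
        = t powi ((int n - r) * int (card I)) * t powi (- r * int (n - card I))"
      by (simp only: power_int_mult power_int_of_nat)
    also have "\<dots> = t powi ((int n - r) * int (card I) + - r * int (n - card I))"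
      using t by (subst power_int_add) auto
    also have "(int n - r) * int (card I) + - r * int (n - card I) = 0"
      using I_less by (simp add: r_def of_nat_diff)
    finally show ?thesis by simp
  qed
  \<comment> \<open>Expressed through \<open>A\<close>, each entry is a Laurent polynomial with
    coefficients in the image of \<open>to_ac\<close>, which is what the rationality of the
    cocharacter demands.\<close>
  have entry: "\<chi> t $$ (a, b) = t powi (int n - r) * to_ac (A $$ (a, b))
      + t powi (- r) * to_ac (1\<^sub>m n $$ (a, b) - A $$ (a, b))" if "a < n" "b < n" for a b t
  proof -
    have A': "to_ac (A $$ (a, b)) = D (\<lambda>i. if i \<in> I then 1 else 0) $$ (a, b)"
      using that A by (metis carrier_matD index_map_mat(1))
    have one: "to_ac (1\<^sub>m n $$ (a, b)) = D (\<lambda>_. 1) $$ (a, b)" using that by (simp add: D_one)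
    show ?thesis
      using that unfolding to_ac_diff A' one \<chi>_def
      by (simp add: D_index sum_distrib_left sum.distrib[symmetric] sum_subtractf[symmetric] algebra_simps)
         (intro sum.cong, auto)
  qed
  have "algebraic_hom (range to_ac) Gm Gm_coords (centralizer_SL n N) (GL_coords n) \<chi>"
    unfolding algebraic_hom_def variety_morphism_def
  proof (intro conjI ballI)
    have cl: "\<chi> t \<in> carrier (centralizer_SL n N)" if "t \<noteq> 0" for t
      using det[OF that] unfolding carrier_centralizer_SL N'_def[symmetric] N'D
      by (auto simp: SL_def \<chi>_def D_mult mult.commute)
    then show "\<chi> \<in> carrier Gm \<rightarrow> carrier (centralizer_SL n N)" by auto
    show "\<chi> \<in> hom Gm (centralizer_SL n N)"
    proof (rule homI)
      fix t u assume "t \<in> carrier (Gm :: 'a alg_closure monoid)" "u \<in> carrier (Gm :: 'a alg_closure monoid)"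
      then show "\<chi> (t \<otimes>\<^bsub>Gm\<^esub> u) = \<chi> t \<otimes>\<^bsub>centralizer_SL n N\<^esub> \<chi> u"
        unfolding mult_centralizer_SL mult_Gm \<chi>_def D_mult
        by (intro D_cong) (simp add: power_int_mult_distrib)
    qed (use cl in auto)
    fix h :: "'a alg_closure mat \<Rightarrow> 'a alg_closure" assume "h \<in> GL_coords n"
    then consider a b where "h = (\<lambda>g. g $$ (a, b))" "a < n" "b < n" | "h = (\<lambda>g. inverse (det g))"
      unfolding GL_coords_def by blast
    then show "h \<circ> \<chi> \<in> regular (range to_ac) (carrier Gm) Gm_coords"
    proof cases
      case 1
      have "(\<lambda>t. t powi (int n - r) * to_ac (A $$ (a, b)) + t powi (- r) * to_ac (1\<^sub>m n $$ (a, b) - A $$ (a, b)))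
          \<in> regular (range to_ac) (carrier Gm) Gm_coords"
        by (intro regular.add regular.mult regular.const regular_Gm_powi)
           (auto intro: range_eqI[of _ _ 1] simp del: to_ac_diff)
      then show ?thesis
        by (rule regular.cong) (use 1 in \<open>auto simp: entry\<close>)
    next
      case 2
      show ?thesis
        by (rule regular.cong[OF regular.const[of 1]])
           (use 2 det in \<open>auto intro: range_eqI[of _ _ 1]\<close>)
    qed
  qed
  then have \<chi>1: "\<chi> t = 1\<^sub>m n" if "t \<noteq> 0" for t
    using ell that by (auto simp: elliptic_def)
  \<comment> \<open>An index in \<open>I\<close> exhibits the weight \<open>n - r\<close> on the
    diagonal of the identity, so it is zero, against \<open>I_less\<close>.\<close>
  have "t powi (int n - r) = 1" if "t \<noteq> 0" for t :: "'a alg_closure"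
  proof -
    have "D (\<lambda>i. if i \<in> I then t powi (int n - r) else t powi (- r)) = D (\<lambda>_. 1)"
      using \<chi>1[OF that] by (simp only: \<chi>_def D_one)
    from D_eqD[OF this, of i] show ?thesis using i I by auto
  qed
  then have "int n - r = 0" by (rule power_int_eq_one_imp_zero)
  then show False using I_less by (simp add: r_def)
qed

subsection \<open>Separability of the characteristic polynomial\<close>

lemma degree_linear_mult:
  "q \<noteq> 0 \<Longrightarrow> Polynomial.degree ([:- x, 1:] * q) = Suc (Polynomial.degree q)" for q :: "'a::idom poly"
  by (subst degree_mult_eq) auto

lemma degree_binomial:
  "n > 0 \<Longrightarrow> Polynomial.degree (Polynomial.monom 1 n - [:a :: 'a::comm_ring_1:]) = n"
  unfolding diff_conv_add_uminus by (subst degree_add_eq_left) (auto simp: degree_monom_eq)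

text \<open>Induction by splitting off a root \<open>x\<close>: the derivative of \<open>p\<close>
  at \<open>x\<close> equals \<open>poly q x\<close>, so a simple root of \<open>p\<close> is no
  root of \<open>q\<close>, and the roots of \<open>q\<close> stay simple.\<close>

lemma card_roots_eq_degree:
  fixes p :: "'a::alg_closed_field poly"
  assumes "p \<noteq> 0" "\<And>x. poly p x = 0 \<Longrightarrow> poly (pderiv p) x \<noteq> 0"
  shows "card {x. poly p x = 0} = Polynomial.degree p"
  using assms
proof (induction "Polynomial.degree p" arbitrary: p)
  case 0
  then obtain c where "p = [:c:]" "c \<noteq> 0" by (metis degree_eq_zeroE pCons_0_0)
  then show ?case by simp
next
  case (Suc k)
  then obtain x where x: "poly p x = 0" using alg_closed_imp_poly_has_root[of p] by auto
  then obtain q where q: "p = [:- x, 1:] * q" using poly_eq_0_iff_dvd by blast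
  have q0: "q \<noteq> 0" using q Suc.prems(1) by auto
  have deriv: "poly (pderiv p) y = poly q y + (y - x) * poly (pderiv q) y" for y
    unfolding q pderiv_mult by (simp add: pderiv_pCons algebra_simps)
  have "poly q x \<noteq> 0" using Suc.prems(2)[OF x] deriv[of x] by simp
  moreover have deg: "Polynomial.degree p = Suc (Polynomial.degree q)"
    unfolding q by (rule degree_linear_mult[OF q0])
  moreover have "poly (pderiv q) y \<noteq> 0" if "poly q y = 0" for y
    using Suc.prems(2)[of y] deriv[of y] that by (auto simp: q)
  then have "card {y. poly q y = 0} = Polynomial.degree q"
    using Suc.hyps deg q0 by simp
  moreover have "{y. poly p y = 0} = insert x {y. poly q y = 0}" by (auto simp: q)
  ultimately show ?case using q0 by (simp add: poly_roots_finite)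
qed

text \<open>The derivative of \<open>X^n - a\<close> is \<open>n X^(n-1)\<close>. If
  \<open>n\<close> is nonzero in the field, it vanishes at no root, because \<open>a\<close> is
  nonzero. If \<open>n\<close> is zero there, every root is multiple, so removing one linear factor
  lowers the degree without losing a root.\<close>

lemma card_nth_roots_alg_closed:
  fixes a :: "'a::alg_closed_field"
  assumes n: "n > 0" and a: "a \<noteq> 0"
  shows "card {x. x ^ n = a} = n \<longleftrightarrow> of_nat n \<noteq> (0 :: 'a) \<or> n = 1"
proof -
  define p where "p = Polynomial.monom 1 n - [:a:]"
  have root: "poly p x = 0 \<longleftrightarrow> x ^ n = a" for x by (simp add: p_def poly_monom)
  have deg: "Polynomial.degree p = n"
    unfolding p_def by (rule degree_binomial[OF n])
  have p0: "p \<noteq> 0" using deg n by auto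
  have deriv: "poly (pderiv p) x = of_nat n * x ^ (n - 1)" for x
    by (simp add: p_def pderiv_diff pderiv_monom poly_monom pderiv_pCons)
  show ?thesis
  proof
    assume L: "card {x. x ^ n = a} = n"
    show "of_nat n \<noteq> (0 :: 'a) \<or> n = 1"
    proof (rule ccontr)
      assume R: "\<not> ?thesis"
      obtain x where x: "poly p x = 0" using alg_closed_imp_poly_has_root[of p] deg n by auto
      then obtain q where q: "p = [:- x, 1:] * q" using poly_eq_0_iff_dvd by blast
      have q0: "q \<noteq> 0" using q p0 by auto
      have "poly (pderiv p) x = poly q x"
        unfolding q pderiv_mult by (simp add: pderiv_pCons)
      then have "poly q x = 0" using deriv[of x] R by simp
      then have "{y. poly p y = 0} = {y. poly q y = 0}" by (auto simp: q)
      then have "n \<le> Polynomial.degree q"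
        using L card_poly_roots_bound[OF q0] by (simp add: root)
      moreover have "Polynomial.degree p = Suc (Polynomial.degree q)"
        unfolding q by (rule degree_linear_mult[OF q0])
      ultimately show False using deg by simp
    qed
  next
    assume "of_nat n \<noteq> (0 :: 'a) \<or> n = 1"
    then have "of_nat n \<noteq> (0 :: 'a)" by auto
    then have "poly (pderiv p) x \<noteq> 0" if "poly p x = 0" for x
      using that n a by (auto simp: deriv root power_0_left)
    from card_roots_eq_degree[OF p0 this] show "card {x. x ^ n = a} = n"
      by (simp add: root deg)
  qed
qed

text \<open>A prime characteristic is coprime to \<open>n\<close> exactly when it does not divide
  \<open>n\<close>; in characteristic 0 both sides hold for positive \<open>n\<close>.\<close>

lemma coprime_char_exponent:
  assumes "n > 0"
  shows "coprime (char_exponent TYPE('k::field)) n \<longleftrightarrow> of_nat n \<noteq> (0 :: 'k)"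
proof (cases "CHAR('k) = 0")
  case True
  then show ?thesis using assms by (simp add: char_exponent_def of_nat_eq_0_iff_char_dvd)
next
  case False
  then have "prime CHAR('k)" by (intro prime_CHAR_semidom) simp
  then show ?thesis using False
    by (simp add: char_exponent_def of_nat_eq_0_iff_char_dvd)
       (metis coprime_common_divisor dvd_refl not_prime_unit prime_imp_coprime)
qed

lemma eigenvalues_binomial:
  fixes N :: "'k::field fls mat"
  assumes N: "N \<in> carrier_mat n n" and char: "char_poly N = Polynomial.monom 1 n - [:c:]"
  shows "eigenvalue (map_mat to_ac N) x \<longleftrightarrow> x ^ n = to_ac c"
proof -
  interpret mp: map_poly_inj_idom_hom "to_ac :: 'k fls \<Rightarrow> 'k fls alg_closure" ..
  have "map_poly to_ac [:c:] = [:to_ac c:]" by (cases "c = 0") simp_all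
  then have "char_poly (map_mat to_ac N) = Polynomial.monom 1 n - [:to_ac c:]"
    using to_ac.char_poly_hom[OF N] by (simp add: char mp.hom_minus del: map_poly_pCons)
  then show ?thesis
    using N by (simp add: eigenvalue_root_char_poly[of _ n] poly_monom)
qed

lemma card_eigenvalues_binomial:
  fixes N :: "'k::field fls mat"
  assumes N: "N \<in> carrier_mat n n" and n: "n \<ge> 2"
    and char: "char_poly N = Polynomial.monom 1 n - [:c:]" and c: "c \<noteq> 0"
  shows "card {x. eigenvalue (map_mat to_ac N) x} = n \<longleftrightarrow> coprime (char_exponent TYPE('k)) n"
proof -
  \<comment> \<open>\<open>k\<close>, \<open>F\<close> and the algebraic closure of \<open>F\<close>
    share their characteristic, so counting eigenvalues over the closure becomes a condition on
    \<open>k\<close>.\<close>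
  have "of_nat n = (0 :: 'k fls alg_closure) \<longleftrightarrow> of_nat n = (0 :: 'k)"
    by (simp add: of_nat_eq_0_iff_char_dvd)
  then show ?thesis
    using card_nth_roots_alg_closed[of n "to_ac c"] n c
    by (simp add: eigenvalues_binomial[OF N char] coprime_char_exponent)
qed

subsection \<open>Almost commuting pairs\<close>

lemma fls_nth_rescale [simp]: "fls_nth (rescale l h) m = l powi m * fls_nth h m"
  by transfer simp

lemma fls_nth_monomial: "fls_nth (fls_const b * fls_X_intpow s) m = (if m = s then b else (0 :: 'k::field))"
  by simp

lemma rescale_subdegree:
  assumes "l \<noteq> 0"
  shows "fls_subdegree (rescale l h) = fls_subdegree h"
proof (cases "h = 0")
  case True
  have "rescale l 0 = 0" by (rule fls_eqI) simp
  then show ?thesis using True by simp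
next
  case False
  then show ?thesis using assms
    by (intro fls_subdegree_eqI) (auto simp: power_int_eq_0_iff)
qed

text \<open>A nonzero \<open>l\<close> preserves subdegrees, so both convolutions run over the same
  range, and \<open>l powi i * l powi (m - i)\<close> recombines to \<open>l powi m\<close>.\<close>

lemma rescale_hom:
  assumes l: "l \<noteq> (0 :: 'k::field)"
  shows "field_hom (rescale l)"
proof
  show "rescale l 0 = 0" "rescale l (x + y) = rescale l x + rescale l y" for x y
    by (auto intro!: fls_eqI simp: algebra_simps)
  show "rescale l 1 = 1" by (auto intro!: fls_eqI)
  show "rescale l (x * y) = rescale l x * rescale l y" for x y
  proof (rule fls_eqI)
    fix m
    have "fls_nth (rescale l x * rescale l y) m
        = (\<Sum>i = fls_subdegree x..m - fls_subdegree y. (l powi i * fls_nth x i) * (l powi (m - i) * fls_nth y (m - i)))"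
      by (subst fls_times_nth(2)) (simp add: rescale_subdegree[OF l])
    also have "\<dots> = (\<Sum>i = fls_subdegree x..m - fls_subdegree y. l powi m * (fls_nth x i * fls_nth y (m - i)))"
    proof (rule sum.cong[OF refl])
      fix i
      have "l powi i * l powi (m - i) = l powi m"
        using l by (subst power_int_add[symmetric]) auto
      then show "(l powi i * fls_nth x i) * (l powi (m - i) * fls_nth y (m - i))
          = l powi m * (fls_nth x i * fls_nth y (m - i))"
        by (simp add: ac_simps)
    qed
    also have "\<dots> = fls_nth (rescale l (x * y)) m"
      by (simp add: fls_times_nth(2) sum_distrib_left)
    finally show "fls_nth (rescale l (x * y)) m = fls_nth (rescale l x * rescale l y) m" ..
  qed
qed

lemma infinite_UNIV_fls: "infinite (UNIV :: 'k::field fls set)"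
proof
  assume "finite (UNIV :: 'k fls set)"
  then have "finite (range (fls_X_intpow :: int \<Rightarrow> 'k fls))" by (rule finite_subset[rotated]) simp
  moreover have "inj (fls_X_intpow :: int \<Rightarrow> 'k fls)"
    by (rule injI) (metis fls_subdegree_fls_X_intpow)
  ultimately show False using finite_imageD infinite_UNIV_int by blast
qed

text \<open>Substituting \<open>a X\<close> into the characteristic polynomial of \<open>a N\<close>
  pulls \<open>a ^ n\<close> out of the determinant. Keeping \<open>a ^ i\<close> on the left avoids
  the exponent \<open>n - i\<close>.\<close>

lemma coeff_char_poly_smult:
  fixes N :: "'a::field mat"
  assumes inf: "infinite (UNIV :: 'a set)" and N: "N \<in> carrier_mat n n" and a: "a \<noteq> 0"
  shows "poly.coeff (char_poly (a \<cdot>\<^sub>m N)) i * a ^ i = a ^ n * poly.coeff (char_poly N) i"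
proof -
  have "char_poly (a \<cdot>\<^sub>m N) \<circ>\<^sub>p [:0, a:] = Polynomial.smult (a ^ n) (char_poly N)"
  proof (rule poly_eqI_nonzero[OF inf])
    fix x
    have aN: "a \<cdot>\<^sub>m N \<in> carrier_mat n n" using N by simp
    have "- char_matrix (a \<cdot>\<^sub>m N) (a * x) = a \<cdot>\<^sub>m (- char_matrix N x)"
      using N by (intro eq_matI) (auto simp: char_matrix_def algebra_simps)
    then have "det (- char_matrix (a \<cdot>\<^sub>m N) (a * x)) = a ^ n * det (- char_matrix N x)"
      using N by (simp add: char_matrix_def)
    then show "poly (char_poly (a \<cdot>\<^sub>m N) \<circ>\<^sub>p [:0, a:]) x = poly (Polynomial.smult (a ^ n) (char_poly N)) x"
      by (simp add: poly_pcompose char_poly_matrix[OF aN] char_poly_matrix[OF N] mult.commute)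
  qed
  then have "poly.coeff (char_poly (a \<cdot>\<^sub>m N) \<circ>\<^sub>p [:0, a:]) i = a ^ n * poly.coeff (char_poly N) i" by simp
  then show ?thesis by (simp add: coeff_pcompose_linear mult.commute)
qed

section \<open>The action of projective matrices over \<open>k\<close> on matrices over
  \<open>F\<close>\<close>

lemma scalar_coset:
  fixes g :: "'k::field mat"
  assumes "g \<in> carrier_mat n n"
  shows "{c \<cdot>\<^sub>m 1\<^sub>m n | c. c \<noteq> 0} #>\<^bsub>GL n\<^esub> g = {c \<cdot>\<^sub>m g | c. c \<noteq> 0}"
proof -
  have "(c \<cdot>\<^sub>m 1\<^sub>m n) * g = c \<cdot>\<^sub>m g" for c
    using assms by (simp add: mult_smult_assoc_mat[of _ n n _ n] left_mult_one_mat[of _ n n])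
  then show ?thesis by (auto simp: r_coset_def)
qed

lemma carrier_PGL:
  assumes "x \<in> carrier (PGL n)"
  obtains g where "g \<in> carrier_mat n n" "det g \<noteq> 0" "x = {c \<cdot>\<^sub>m g | c. c \<noteq> 0}"
proof -
  obtain g where g: "g \<in> carrier (GL n)" "x = {c \<cdot>\<^sub>m 1\<^sub>m n | c. c \<noteq> 0} #>\<^bsub>GL n\<^esub> g"
    using assms by (auto simp: PGL_def FactGroup_def RCOSETS_def)
  then have gc: "g \<in> carrier_mat n n" by (simp add: mem_carrier_GL)
  then have "x = {c \<cdot>\<^sub>m g | c. c \<noteq> 0}" using g(2) by (simp only: scalar_coset)
  with gc show ?thesis using g(1) by (intro that[of g]) (simp_all add: mem_carrier_GL)
qed

interpretation fls_const: field_hom "fls_const :: 'k::field \<Rightarrow> 'k fls"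
  by unfold_locales (simp_all add: fls_plus_const fls_const_mult_const)

lemma one_smult_mat: "1 \<cdot>\<^sub>m M = M" for M :: "'a::monoid_mult mat"
  by (rule eq_matI) auto

lemma smult_smult_mat: "a \<cdot>\<^sub>m (b \<cdot>\<^sub>m M) = (a * b) \<cdot>\<^sub>m M" for a b :: "'a::semigroup_mult"
  by (rule eq_matI) (auto simp: mult.assoc)

lemma Ad_smult:
  fixes P :: "'a::field mat"
  assumes P: "P \<in> carrier_mat n n" "det P \<noteq> 0" and M: "M \<in> carrier_mat n n" and c: "c \<noteq> 0"
  shows "Ad n (c \<cdot>\<^sub>m P) M = Ad n P M"
proof -
  obtain R where R: "R \<in> carrier_mat n n" "P * R = 1\<^sub>m n"
    using det_nonzero_inverse[OF P] .
  have "(c \<cdot>\<^sub>m P) * (inverse c \<cdot>\<^sub>m R) = 1\<^sub>m n"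
    using P R c
    by (simp add: mult_smult_assoc_mat[of _ n n _ n] mult_smult_distrib[of _ n n _ n] smult_smult_mat one_smult_mat)
  then have "Ad n (c \<cdot>\<^sub>m P) M = (c \<cdot>\<^sub>m P) * M * (inverse c \<cdot>\<^sub>m R)"
    using P R by (intro Ad_eq) auto
  also have "\<dots> = P * M * R"
    using P R M c
    by (simp add: mult_smult_assoc_mat[of _ n n _ n] mult_smult_distrib[of _ n n _ n]
        mult_carrier_mat[of _ n n] smult_smult_mat one_smult_mat)
  also have "\<dots> = Ad n P M" using P R by (simp add: Ad_eq)
  finally show ?thesis .
qed

text \<open>\<open>QSL_act\<close> takes \<open>the_elem\<close> of an image over a coset. Scalars
  cancel in \<open>Ad\<close>, so this image is a singleton and any representative computes the
  action.\<close>

lemma QSL_act_eq: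
  fixes g :: "'k::field mat"
  assumes g: "g \<in> carrier_mat n n" "det g \<noteq> 0" and N: "N \<in> carrier_mat n n"
  shows "QSL_act n ({c \<cdot>\<^sub>m g | c. c \<noteq> 0}, l) N = Ad n (map_mat fls_const g) (map_mat (rescale l) N)"
proof -
  define F where "F h = Ad n (map_mat fls_const h) (map_mat (rescale l) N)" for h :: "'k mat"
  have "F (c \<cdot>\<^sub>m g) = F g" if "c \<noteq> 0" for c
  proof -
    have "map_mat fls_const (c \<cdot>\<^sub>m g) = fls_const c \<cdot>\<^sub>m map_mat fls_const g"
      by (intro eq_matI) simp_all
    then show ?thesis
      unfolding F_def using g N that by (simp only: Ad_smult[of _ n] map_carrier_mat
          fls_const.hom_det fls_const_eq_0_iff not_False_eq_True)
  qed
  moreover have "g \<in> {c \<cdot>\<^sub>m g | c. c \<noteq> 0}"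
    by (intro CollectI exI[of _ 1]) (simp add: one_smult_mat)
  ultimately have "F ` {c \<cdot>\<^sub>m g | c. c \<noteq> 0} = {F g}" by blast
  then show ?thesis by (simp add: QSL_act_def F_def)
qed

lemma char_poly_Ad:
  fixes M :: "'a::field mat"
  assumes P: "P \<in> carrier_mat n n" "det P \<noteq> 0" and M: "M \<in> carrier_mat n n"
  shows "char_poly (Ad n P M) = char_poly M"
proof -
  obtain R where R: "R \<in> carrier_mat n n" "P * R = 1\<^sub>m n" "R * P = 1\<^sub>m n"
    using det_nonzero_inverse[OF P] .
  have "similar_mat_wit (P * M * R) M P R"
    using P R M by (intro similar_mat_witI[of _ _ n]) auto
  then have "similar_mat (P * M * R) M" unfolding similar_mat_def by blast
  then show ?thesis
    using P R by (simp add: Ad_eq char_poly_similar)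
qed

lemma almost_commuting_char_poly_support:
  fixes N :: "'k::alg_closed_field fls mat"
  assumes f: "QSL_action n f" and ac: "QSL_almost_commutes n N f s" and N: "N \<in> carrier_mat n n"
  shows "\<exists>d. \<forall>i m. fls_nth (poly.coeff (char_poly N) i) m \<noteq> 0 \<longrightarrow> d * m = s * (int n - int i)"
proof -
  have hom: "f \<in> hom Gm (QSL n)"
    and reg: "\<And>h. h \<in> prod_coords (PGL_coords n) Gm_coords \<Longrightarrow> h \<circ> f \<in> regular UNIV (- {0}) Gm_coords"
    using f by (auto simp: QSL_action_def algebraic_hom_def variety_morphism_def)
  have fc: "fst (f l) \<in> carrier (PGL n)" "snd (f l) \<noteq> 0" if "l \<noteq> 0" for l
  proof -
    have "f l \<in> carrier (QSL n)" using hom that by (auto simp: hom_def)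
    then show "fst (f l) \<in> carrier (PGL n)" "snd (f l) \<noteq> 0" by (auto simp: QSL_def DirProd_def)
  qed
  have "f 1 \<otimes>\<^bsub>QSL n\<^esub> f 1 = f 1" using Group.hom_mult[OF hom, of 1 1] by simp
  then have "snd (f 1) * snd (f 1) = snd (f 1)"
    unfolding QSL_def mult_DirProd' by (metis mult_Gm snd_conv)
  then have "snd (f 1) = 1" using fc(2)[of 1] by simp
  moreover have "(\<lambda>l. snd (f l)) \<in> regular UNIV (- {0}) Gm_coords"
    using reg[of "(\<lambda>t. t) \<circ> snd"] by (auto simp: prod_coords_def Gm_coords_def comp_def)
  \<comment> \<open>The second component of \<open>f\<close> is a nowhere vanishing character, hence
    a power. That \<open>d\<close> is nonzero emerges only later, from the nonzero constant
    coefficient of the characteristic polynomial.\<close>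
  ultimately obtain d where d: "\<And>l. l \<noteq> 0 \<Longrightarrow> snd (f l) = l powi d"
    using nonvanishing_regular_Gm[of "\<lambda>l. snd (f l)"] fc by blast
  have "d * m = s * (int n - int i)" if nz: "fls_nth (poly.coeff (char_poly N) i) m \<noteq> 0" for i m
  proof -
    \<comment> \<open>Comparison at \<open>pi^m\<close>: rescaling contributes \<open>d * m\<close>,
      and multiplying \<open>N\<close> by \<open>l powi s\<close> contributes \<open>s * i\<close>
      and \<open>s * n\<close> through \<open>coeff_char_poly_smult\<close>.\<close>
    have "l powi (d * m + s * int i - s * int n) = 1" if l: "l \<noteq> 0" for l :: 'k
    proof -
      define a where "a = fls_const (l powi s)"
      define y where "y = l powi d"
      have a0: "a \<noteq> 0" using l by (simp add: a_def)
      have y0: "y \<noteq> 0" using l by (simp add: y_def)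
      interpret y: field_hom "rescale y" by (rule rescale_hom[OF y0])
      obtain g where g: "g \<in> carrier_mat n n" "det g \<noteq> 0" "fst (f l) = {c \<cdot>\<^sub>m g | c. c \<noteq> 0}"
        using carrier_PGL[OF fc(1)[OF l]] .
      have "f l = ({c \<cdot>\<^sub>m g | c. c \<noteq> 0}, y)" using g(3) d[OF l] by (metis prod.collapse y_def)
      moreover have "QSL_act n (f l) N = a \<cdot>\<^sub>m N"
        using ac l by (simp add: QSL_almost_commutes_def a_def)
      ultimately have "a \<cdot>\<^sub>m N = Ad n (map_mat fls_const g) (map_mat (rescale y) N)"
        using QSL_act_eq[OF g(1,2) N, of y] by simp
      then have "char_poly (a \<cdot>\<^sub>m N) = map_poly (rescale y) (char_poly N)"
        using g N by (simp add: char_poly_Ad y.char_poly_hom)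
      then have "rescale y (poly.coeff (char_poly N) i) * a ^ i = a ^ n * poly.coeff (char_poly N) i"
        using coeff_char_poly_smult[OF infinite_UNIV_fls N a0, of i] by simp
      then have "fls_nth (fls_const ((l powi s) ^ i) * rescale y (poly.coeff (char_poly N) i)) m
          = fls_nth (fls_const ((l powi s) ^ n) * poly.coeff (char_poly N) i) m"
        by (simp add: a_def fls_const.hom_power mult.commute)
      then have "(l powi s) ^ i * (y powi m * fls_nth (poly.coeff (char_poly N) i) m)
          = (l powi s) ^ n * fls_nth (poly.coeff (char_poly N) i) m"
        by (simp only: fls_mult_const_nth fls_nth_rescale)
      then have "(l powi s) ^ i * y powi m = (l powi s) ^ n" using nz by simp
      then have "l powi (s * int i) * l powi (d * m) = l powi (s * int n)"
        unfolding y_def by (simp only: power_int_mult power_int_of_nat)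
      then have "l powi (s * int i + d * m) = l powi (s * int n)"
        using l by (subst power_int_add) auto
      then show ?thesis
        using l by (simp add: power_int_diff algebra_simps)
    qed
    then have "d * m + s * int i - s * int n = 0" by (rule power_int_eq_one_imp_zero)
    then show ?thesis by (simp add: algebra_simps)
  qed
  then show ?thesis by blast
qed

section \<open>Homogeneous characteristic polynomials and their reduction\<close>

text \<open>The support condition makes \<open>p\<close> homogeneous: with \<open>e = gcd u n\<close> it is a form of degree \<open>e\<close> in
  \<open>X\<^bsup>n/e\<^esup>\<close> and \<open>\<pi>\<^bsup>u/e\<^esup>\<close> over the algebraically closed field \<open>k\<close>, hence has a factor \<open>X\<^bsup>n/e\<^esup> - r \<pi>\<^bsup>u/e\<^esup>\<close>.\<close>

lemma irreducible_homogeneous_is_binomial: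
  fixes p :: "'k::alg_closed_field fls poly"
  assumes deg: "Polynomial.degree p = n" and monic: "poly.coeff p n = 1" and n: "n \<ge> 2"
    and supp: "\<And>i m. fls_nth (poly.coeff p i) m \<noteq> 0 \<Longrightarrow> d * m = s * (int n - int i)" and s: "s \<noteq> 0"
    and irr: "\<And>g h. p = g * h \<Longrightarrow> Polynomial.degree g = 0 \<or> Polynomial.degree h = 0"
  shows "\<exists>b u. b \<noteq> 0 \<and> coprime u (int n) \<and> p = Polynomial.monom 1 n - [:fls_const b * fls_X_intpow u:]"
proof -
  have p0: "p \<noteq> 0" using monic by auto
  have "poly.coeff p 0 \<noteq> 0"
  proof
    assume "poly.coeff p 0 = 0"
    then have "poly p 0 = 0" by (simp add: poly_0_coeff_0)
    then obtain q where q: "p = [:- 0, 1:] * q" using poly_eq_0_iff_dvd by blast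
    then have "q \<noteq> 0" using p0 by auto
    then have "Polynomial.degree p = Suc (Polynomial.degree q)"
      unfolding q by (rule degree_linear_mult)
    then show False using irr[OF q] deg n by simp
  qed
  \<comment> \<open>A single exponent \<open>u\<close> of the constant coefficient fixes the line
    \<open>n * m = u * (n - i)\<close> that carries the whole support; \<open>d\<close> is thereby
    nonzero and drops out.\<close>
  then obtain u where u: "fls_nth (poly.coeff p 0) u \<noteq> 0" by (metis fls_eqI fls_zero_nth)
  have du: "d * u = s * int n" using supp[OF u] by simp
  have d0: "d \<noteq> 0" using du s n by auto
  have nm: "int n * m = u * (int n - int i)" if "fls_nth (poly.coeff p i) m \<noteq> 0" for i m
  proof -
    have "d * (int n * m) = int n * (s * (int n - int i))" using supp[OF that] by (simp add: ac_simps)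
    also have "\<dots> = d * u * (int n - int i)" by (simp add: du ac_simps)
    finally show ?thesis using d0 by (simp add: mult.assoc)
  qed
  define e where "e = nat (gcd u (int n))"
  have e: "e > 0" "int e = gcd u (int n)" using n by (auto simp: e_def)
  define v where "v = n div e"
  define u' where "u' = u div int e"
  have "e dvd n" using e(2) by (metis gcd_dvd2 int_dvd_int_iff)
  then have v: "n = v * e" by (simp add: v_def)
  have u': "u = u' * int e" using e(2) by (simp add: u'_def)
  have v0: "v > 0" using v n by (cases v) auto
  have cop: "coprime (int v) u'"
  proof -
    have "int v = int n div int e" by (simp add: v_def zdiv_int)
    then show ?thesis using e div_gcd_coprime[of u "int n"] n by (simp add: u'_def coprime_commute)
  qed
  \<comment> \<open>Because \<open>v\<close> and \<open>u'\<close> are coprime, the lattice points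
    on this line are exactly the \<open>(v * j, u' * (e - j))\<close>.\<close>
  have supp': "\<exists>j. i = v * j \<and> m = u' * (int e - int j)" if nz: "fls_nth (poly.coeff p i) m \<noteq> 0" for i m
  proof -
    have "int e * (int v * m) = int e * (u' * (int n - int i))"
      using nm[OF nz] by (simp add: v u' ac_simps)
    then have vm: "int v * m = u' * (int n - int i)" using e(1) by simp
    then have "int v dvd u' * (int n - int i)" by (metis dvd_triv_left)
    then have "int v dvd int n - int i" using cop by (simp add: coprime_dvd_mult_right_iff)
    moreover have "int v dvd int n" by (simp add: v)
    ultimately have "int v dvd int i" by (metis dvd_diffD dvd_minus_iff minus_diff_eq dvd_diff_right_iff)
    then obtain j where j: "i = v * j" by (auto simp: int_dvd_int_iff elim: dvdE)
    have "int v * m = int v * (u' * (int e - int j))"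
      using vm by (simp add: j v algebra_simps)
    then show ?thesis using j v0 by auto
  qed
  \<comment> \<open>The dehomogenization over \<open>k\<close>: \<open>p\<close> is the sum of
    \<open>P_j Y^j pi^(u' (e - j))\<close> with \<open>Y = X^v\<close>. A root \<open>r\<close> of
    \<open>P\<close> therefore gives the zero \<open>Y = r pi^u'\<close> of the form.\<close>
  define P where "P = (\<Sum>j\<le>e. Polynomial.monom (fls_nth (poly.coeff p (v * j)) (u' * (int e - int j))) j)"
  have P: "poly.coeff P j = (if j \<le> e then fls_nth (poly.coeff p (v * j)) (u' * (int e - int j)) else 0)" for j
    by (simp add: P_def coeff_sum)
  have coeff_p: "poly.coeff p (v * j) = fls_const (poly.coeff P j) * fls_X_intpow (u' * (int e - int j))"
    if "j \<le> e" for j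
    using that supp'[of "v * j"] v0 by (intro fls_eqI) (auto simp: fls_nth_monomial P)
  have "poly.coeff P e = 1" using monic by (simp add: P flip: v)
  then have "Polynomial.degree P \<ge> e" by (intro le_degree) simp
  moreover have "Polynomial.degree P \<le> e" by (rule degree_le) (simp add: P)
  ultimately have degP: "Polynomial.degree P = e" by simp
  then obtain r where r: "poly P r = 0" using alg_closed_imp_poly_has_root[of P] e(1) by auto
  define \<rho> where "\<rho> = fls_const r * fls_X_intpow u'"
  define Y where "Y = Polynomial.monom (1 :: 'k fls) v"
  have p_sum: "p = (\<Sum>j\<le>e. [:poly.coeff p (v * j):] * Y ^ j)"
  proof (rule poly_eqI)
    fix i
    have "poly.coeff (\<Sum>j\<le>e. [:poly.coeff p (v * j):] * Y ^ j) i
        = (\<Sum>j\<le>e. if v * j = i then poly.coeff p i else 0)"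
      unfolding coeff_sum by (intro sum.cong) (auto simp: Y_def monom_power)
    also have "\<dots> = poly.coeff p i"
    proof (cases "\<exists>j\<le>e. v * j = i")
      case True
      then obtain j where j: "j \<le> e" "v * j = i" by blast
      then have "v * j' = i \<longleftrightarrow> j' = j" for j' using v0 by auto
      then show ?thesis using j by simp
    next
      case False
      have "poly.coeff p i = 0"
      proof (rule ccontr)
        assume nz: "poly.coeff p i \<noteq> 0"
        then obtain m where "fls_nth (poly.coeff p i) m \<noteq> 0" by (metis fls_eqI fls_zero_nth)
        then obtain j where j: "i = v * j" using supp' by blast
        moreover have "i \<le> n" using nz deg le_degree by blast
        ultimately show False using False v v0 by auto
      qed
      then show ?thesis using False by (auto intro!: sum.neutral)
    qed
    finally show "poly.coeff p i = poly.coeff (\<Sum>j\<le>e. [:poly.coeff p (v * j):] * Y ^ j) i" ..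
  qed
  have "(\<Sum>j\<le>e. poly.coeff p (v * j) * \<rho> ^ j) = (\<Sum>j\<le>e. fls_const (poly.coeff P j * r ^ j) * fls_X_intpow u)"
  proof (rule sum.cong[OF refl])
    fix j assume "j \<in> {..e}"
    then have cp: "poly.coeff p (v * j) = fls_const (poly.coeff P j) * fls_X_intpow (u' * (int e - int j))"
      by (intro coeff_p) simp
    have "poly.coeff p (v * j) * \<rho> ^ j
        = fls_const (poly.coeff P j) * fls_const (r ^ j)
          * (fls_X_intpow (u' * (int e - int j)) * fls_X_intpow (int j * u'))"
      unfolding cp \<rho>_def power_mult_distrib fls_X_intpow_power fls_const.hom_power by (simp only: ac_simps)
    also have "fls_X_intpow (u' * (int e - int j)) * fls_X_intpow (int j * u') = (fls_X_intpow u :: 'k fls)"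
      unfolding fls_X_intpow_times_fls_X_intpow by (simp add: u' algebra_simps)
    finally show "poly.coeff p (v * j) * \<rho> ^ j = fls_const (poly.coeff P j * r ^ j) * fls_X_intpow u"
      by (simp only: fls_const.hom_mult)
  qed
  also have "\<dots> = fls_const (poly P r) * fls_X_intpow u"
    by (simp only: poly_altdef degP fls_const.hom_sum sum_distrib_right)
  finally have sum0: "(\<Sum>j\<le>e. poly.coeff p (v * j) * \<rho> ^ j) = 0" by (simp add: r)
  \<comment> \<open>Subtracting the value at \<open>Y = \<rho>\<close>, which is zero by
    \<open>sum0\<close>, rewrites \<open>p\<close> in terms of the differences
    \<open>Y ^ j - [:\<rho>:] ^ j\<close>, each divisible by \<open>Y - [:\<rho>:]\<close>.\<close>
  have "p = (\<Sum>j\<le>e. [:poly.coeff p (v * j):] * (Y ^ j - [:\<rho>:] ^ j))"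
  proof -
    have "(\<Sum>j\<le>e. [:poly.coeff p (v * j):] * [:\<rho>:] ^ j) = [:\<Sum>j\<le>e. poly.coeff p (v * j) * \<rho> ^ j:]"
      by (simp add: poly_const_pow sum_to_poly mult.commute)
    then have "(\<Sum>j\<le>e. [:poly.coeff p (v * j):] * [:\<rho>:] ^ j) = 0" by (simp add: sum0)
    then show ?thesis
      by (subst p_sum) (simp add: right_diff_distrib sum_subtractf del: mult_pCons_left)
  qed
  moreover have "(Y - [:\<rho>:]) dvd (Y ^ j - [:\<rho>:] ^ j)" for j
    by (metis dvd_triv_left power_diff_sumr2)
  ultimately have "(Y - [:\<rho>:]) dvd p" by (metis (no_types, lifting) dvd_mult dvd_sum)
  then obtain h where h: "p = (Y - [:\<rho>:]) * h" by blast
  have degY: "Polynomial.degree (Y - [:\<rho>:]) = v"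
    unfolding Y_def by (rule degree_binomial[OF v0])
  then have "Polynomial.degree h = 0" using irr[OF h] v0 by simp
  moreover have "Y - [:\<rho>:] \<noteq> 0" "h \<noteq> 0" using p0 h by auto
  ultimately have "n = v" using deg degY h by (simp add: degree_mult_eq)
  then have e1: "e = 1" using v v0 by simp
  then have cop': "coprime u (int n)" using e(2) by (simp add: coprime_iff_gcd_eq_1)
  have "p = Polynomial.monom 1 n - [:fls_const (- poly.coeff P 0) * fls_X_intpow u:]"
  proof -
    have "p = [:poly.coeff p 0:] + [:poly.coeff p v:] * Y"
      by (subst p_sum) (simp add: e1)
    also have "\<dots> = Polynomial.monom 1 n + [:fls_const (poly.coeff P 0) * fls_X_intpow u:]"
      using coeff_p[of 0] monic \<open>n = v\<close> by (simp add: e1 u' Y_def add.commute)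
    also have "\<dots> = Polynomial.monom 1 n - [:fls_const (- poly.coeff P 0) * fls_X_intpow u:]"
      by (simp add: fls_const.hom_uminus)
    finally show ?thesis .
  qed
  moreover have "poly.coeff P 0 \<noteq> 0" using u by (simp add: P u' ac_simps)
  ultimately show ?thesis using cop' by (intro exI[of _ "- poly.coeff P 0"] exI[of _ u]) simp
qed

text \<open>A conjugate of \<open>N\<close> is integral, so the constant coefficient
  \<open>- b pi^u\<close> is a power series. Its value at \<open>pi = 0\<close> is the constant
  coefficient for a nilpotent matrix, hence 0, which excludes \<open>u = 0\<close> as well as
  negative \<open>u\<close>.\<close>

lemma nil_binomial_exponent_pos:
  fixes N :: "'k::field fls mat"
  assumes N: "N \<in> carrier_mat n n" and n: "n > 0" and nil: "nil n N" and b: "b \<noteq> 0"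
    and char: "char_poly N = Polynomial.monom 1 n - [:fls_const b * fls_X_intpow u:]"
  shows "u > 0"
proof -
  interpret A: comm_ring_hom "fps_to_fls :: 'k fps \<Rightarrow> 'k fls"
    by unfold_locales (simp_all add: fls_times_fps_to_fls)
  interpret red: comm_ring_hom "\<lambda>h :: 'k fps. fps_nth h 0"
    by unfold_locales simp_all
  obtain M r where M: "M \<in> sl n" "map_mat fps_to_fls M \<in> conj_class n N"
    and r: "map_mat (\<lambda>h. fps_nth h 0) M ^\<^sub>m r = 0\<^sub>m n n"
    using nil by (auto simp: nil_def)
  have Mc: "M \<in> carrier_mat n n" using M by (simp add: sl_def)
  define M0 where "M0 = map_mat (\<lambda>h. fps_nth h 0) M"
  have M0: "M0 \<in> carrier_mat n n" using Mc by (simp add: M0_def)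
  have "det (M0 ^\<^sub>m j) = det M0 ^ j" for j
    by (induction j) (use M0 in \<open>auto simp: det_mult[of _ n] pow_carrier_mat\<close>)
  then have "det M0 ^ r = 0" using r n by (metis M0_def det_zero)
  then have "det M0 = 0" by simp
  moreover have "char_matrix M0 0 = M0" using M0 by (auto simp: char_matrix_def intro!: eq_matI)
  ultimately have "eigenvalue M0 0" by (simp add: eigenvalue_det[OF M0])
  then have 0: "poly.coeff (char_poly M0) 0 = 0"
    by (simp add: eigenvalue_root_char_poly[OF M0] poly_0_coeff_0)
  have "map_poly fps_to_fls (char_poly M) = char_poly N"
    using A.char_poly_hom[OF Mc] char_poly_in_conj_class(2)[OF N M(2)] by simp
  then have "fps_to_fls (poly.coeff (char_poly M) 0) = poly.coeff (char_poly N) 0"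
    by (metis A.hom_zero coeff_map_poly)
  then have eq: "fps_to_fls (poly.coeff (char_poly M) 0) = - (fls_const b * fls_X_intpow u)"
    using n by (simp add: char)
  have "fps_nth (poly.coeff (char_poly M) 0) 0 = poly.coeff (char_poly M0) 0"
    unfolding M0_def red.char_poly_hom[OF Mc] by (simp add: coeff_map_poly)
  then have *: "fps_nth (poly.coeff (char_poly M) 0) 0 = 0" using 0 by simp
  have "fls_nth (fps_to_fls (poly.coeff (char_poly M) 0)) u = - b"
    unfolding eq by simp
  then show ?thesis using b * by (cases "u \<ge> 0") (auto simp: le_less split: if_splits)
qed

subsection \<open>Roots of units and surjectivity of the norm\<close>

lemma fps_power_nth_cong:
  fixes f g :: "'a::comm_ring_1 fps"
  assumes "\<And>j. j \<le> m \<Longrightarrow> fps_nth f j = fps_nth g j"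
  shows "j \<le> m \<Longrightarrow> fps_nth (f ^ n) j = fps_nth (g ^ n) j"
proof (induction n arbitrary: j)
  case (Suc n)
  then show ?case
    by (simp add: fps_mult_nth) (intro sum.cong arg_cong2[of _ _ _ _ "(*)"], auto simp: assms)
qed simp

text \<open>Since \<open>T\<close> has constant term 1, a change by \<open>c\<close> in degree
  \<open>k\<close> affects that degree of the power linearly, with factor \<open>n\<close>. This is
  the equation solved at each stage of the root extraction.\<close>

lemma fps_power_perturb_nth:
  fixes T :: "'a::comm_ring_1 fps"
  assumes T0: "fps_nth T 0 = 1" and k: "k > 0"
  shows "fps_nth ((T + fps_const c * fps_X ^ k) ^ n) k = fps_nth (T ^ n) k + of_nat n * c"
proof (induction n)
  case (Suc n)
  define U where "U = T + fps_const c * fps_X ^ k"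
  have U: "fps_nth U j = fps_nth T j" if "j < k" for j using that by (simp add: U_def fps_X_power_nth)
  have Un: "fps_nth (U ^ n) j = fps_nth (T ^ n) j" if "j < k" for j
    using fps_power_nth_cong[of "k - 1" U T j n] U that by auto
  have Tn0: "fps_nth (T ^ n) 0 = 1" using T0 by (simp add: fps_power_zeroth)
  have "fps_nth (T * U ^ n) k = fps_nth (U ^ n) k + (\<Sum>i = 1..k. fps_nth T i * fps_nth (U ^ n) (k - i))"
    by (simp add: fps_mult_nth T0 sum.atLeast_Suc_atMost)
  also have "(\<Sum>i = 1..k. fps_nth T i * fps_nth (U ^ n) (k - i)) = (\<Sum>i = 1..k. fps_nth T i * fps_nth (T ^ n) (k - i))"
    by (intro sum.cong refl) (simp add: Un)
  also have "fps_nth (U ^ n) k = fps_nth (T ^ n) k + of_nat n * c" using Suc.IH by (simp add: U_def)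
  also have "fps_nth (T ^ n) k + of_nat n * c + (\<Sum>i = 1..k. fps_nth T i * fps_nth (T ^ n) (k - i))
      = fps_nth (T * T ^ n) k + of_nat n * c"
    by (simp add: fps_mult_nth T0 sum.atLeast_Suc_atMost)
  finally have "fps_nth (T * U ^ n) k = fps_nth (T ^ Suc n) k + of_nat n * c" by simp
  moreover have "U * W = T * W + fps_const c * fps_X ^ k * W" for W
    by (simp add: U_def distrib_right)
  ultimately have "fps_nth (U ^ Suc n) k
      = fps_nth (T ^ Suc n) k + of_nat n * c + fps_nth (fps_const c * fps_X ^ k * U ^ n) k"
    unfolding power_Suc[of U] by simp
  also have "fps_nth (fps_const c * fps_X ^ k * U ^ n) k = c"
    using Un[OF k] Tn0 by (simp add: mult.assoc fps_X_power_mult_nth)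
  finally show ?case by (simp add: U_def algebra_simps)
qed simp

text \<open>Lifting one coefficient at a time; \<open>c\<close> is solvable because \<open>n\<close>
  is invertible. Later approximations agree with earlier ones in the settled degrees, so the limit
  is the diagonal series.\<close>

lemma fps_nth_root_of_one_unit:
  fixes a :: "'a::field fps"
  assumes n: "of_nat n \<noteq> (0 :: 'a)" and a: "fps_nth a 0 = 1"
  shows "\<exists>b. b ^ n = a"
proof -
  let ?P = "\<lambda>m T. fps_nth T 0 = 1 \<and> (\<forall>j\<le>m. fps_nth (T ^ n) j = fps_nth a j)"
  let ?Q = "\<lambda>m T T'. \<forall>j\<le>m. fps_nth T' j = fps_nth T j"
  have "\<exists>T. \<forall>m. ?P m (T m) \<and> ?Q m (T m) (T (Suc m))"
  proof (rule dependent_nat_choice)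
    show "\<exists>T. ?P 0 T" using a by (intro exI[of _ 1]) simp
  next
    fix T m assume T: "?P m T"
    define c where "c = (fps_nth a (Suc m) - fps_nth (T ^ n) (Suc m)) / of_nat n"
    define T' where "T' = T + fps_const c * fps_X ^ Suc m"
    have Q: "fps_nth T' j = fps_nth T j" if "j \<le> m" for j
    proof -
      have "fps_nth (fps_X ^ Suc m :: 'a fps) j = 0" using that by (simp add: fps_X_power_nth del: power_Suc) arith
      then show ?thesis
        by (simp only: T'_def fps_add_nth fps_mult_left_const_nth mult_zero_right add_0_right)
    qed
    have "fps_nth (T' ^ n) j = fps_nth a j" if "j \<le> Suc m" for j
    proof (cases "j = Suc m")
      case True
      then show ?thesis
        using fps_power_perturb_nth[of T "Suc m" c n] T n by (simp add: T'_def c_def del: power_Suc)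
    next
      case False
      then show ?thesis using fps_power_nth_cong[of m T' T j n] Q that T by auto
    qed
    then show "\<exists>T'. ?P (Suc m) T' \<and> ?Q m T T'" using Q T by (intro exI[of _ T']) auto
  qed
  then obtain T where T: "\<And>m. ?P m (T m)" "\<And>m. ?Q m (T m) (T (Suc m))" by blast
  define b where "b = Abs_fps (\<lambda>m. fps_nth (T m) m)"
  have "fps_nth (T (j + i)) j = fps_nth (T j) j" for i j
    by (induction i) (use T(2) in auto)
  then have b: "fps_nth b j = fps_nth (T m) j" if "j \<le> m" for j m
    using that by (metis b_def fps_nth_Abs_fps le_add_diff_inverse)
  have "b ^ n = a"
  proof (rule fps_ext)
    fix m
    have "fps_nth (b ^ n) m = fps_nth (T m ^ n) m" by (rule fps_power_nth_cong[of m]) (simp_all add: b)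
    then show "fps_nth (b ^ n) m = fps_nth a m" using T(1) by simp
  qed
  then show ?thesis by blast
qed

lemma fps_nth_root_of_unit:
  fixes a :: "'a::alg_closed_field fps"
  assumes n: "of_nat n \<noteq> (0 :: 'a)" and a: "fps_nth a 0 \<noteq> 0"
  shows "\<exists>b. b ^ n = a"
proof -
  have "n > 0" using n by (cases n) auto
  then obtain z where z: "z ^ n = fps_nth a 0" using nth_root_exists[of n "fps_nth a 0"] by blast
  obtain b where b: "b ^ n = fps_const (inverse (fps_nth a 0)) * a"
    using fps_nth_root_of_one_unit[OF n, of "fps_const (inverse (fps_nth a 0)) * a"] a by auto
  have "(fps_const z * b) ^ n = fps_const (fps_nth a 0) * (fps_const (inverse (fps_nth a 0)) * a)"
    by (simp only: power_mult_distrib fps_const_power b z)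
  also have "\<dots> = a" using a by (simp add: mult.assoc[symmetric])
  finally show ?thesis by blast
qed

text \<open>A nonzero Laurent series is a power of pi times a unit of \<open>A\<close>: divisibility
  handles the first factor, \<open>fps_nth_root_of_unit\<close> the second.\<close>

lemma fls_nth_root:
  fixes y :: "'k::alg_closed_field fls"
  assumes n: "of_nat n \<noteq> (0 :: 'k)" and y: "y \<noteq> 0" and dvd: "int n dvd fls_subdegree y"
  shows "\<exists>z. z ^ n = y"
proof -
  obtain q where q: "fls_subdegree y = int n * q" using dvd by blast
  obtain b where b: "b ^ n = fls_base_factor_to_fps y"
    using fps_nth_root_of_unit[OF n] fls_base_factor_to_fps_base[OF y] by blast
  have "y = fls_shift (- fls_subdegree y) (fps_to_fls (fls_base_factor_to_fps y))"
    by (rule fls_conv_base_factor_to_fps_shift_subdegree)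
  also have "\<dots> = fls_X_intpow (int n * q) * fps_to_fls b ^ n"
    by (simp only: fls_X_intpow_times_conv_shift q fps_to_fls_power flip: b)
  also have "\<dots> = (fls_X_intpow q * fps_to_fls b) ^ n"
    by (simp only: power_mult_distrib fls_X_intpow_power)
  finally show ?thesis by metis
qed

lemma det_pow_mat: "M \<in> carrier_mat n n \<Longrightarrow> det (M ^\<^sub>m j) = det M ^ j" for M :: "'a::comm_ring_1 mat"
  by (induction j) (auto simp: det_mult[of _ n] pow_carrier_mat)

lemma pow_mat_comm: "M \<in> carrier_mat n n \<Longrightarrow> M ^\<^sub>m j * M = M * M ^\<^sub>m j" for M :: "'a::semiring_1 mat"
proof (induction j)
  case (Suc j)
  then show ?case by (simp add: assoc_mult_mat[of M n n "M ^\<^sub>m j" n M n] pow_carrier_mat)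
qed simp

text \<open>Since the valuation of \<open>det N\<close> is prime to \<open>n\<close>, some power of \<open>N\<close> has the right valuation modulo
  \<open>n\<close>, and what remains is an \<open>n\<close>-th power, i.e. the determinant of a scalar.\<close>

lemma det_surjective_on_centralizer:
  fixes N :: "'k::alg_closed_field fls mat"
  assumes N: "N \<in> carrier_mat n n" and n: "of_nat n \<noteq> (0 :: 'k)"
    and detN: "det N \<noteq> 0" "coprime (fls_subdegree (det N)) (int n)" and y: "y \<noteq> 0"
  shows "\<exists>Z\<in>carrier_mat n n. Z * N = N * Z \<and> det Z = y"
proof -
  define s where "s = fls_subdegree (det N)"
  obtain u w where uw: "u * s + w * int n = 1"
    using bezout_int[of s "int n"] detN(2) by (auto simp: s_def)
  have n0: "int n > 0" using n by (cases n) auto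
  \<comment> \<open>From the Bezout relation, \<open>a\<close> solves
    \<open>s * a = fls_subdegree y\<close> modulo \<open>n\<close>. Reducing modulo \<open>n\<close>
    makes it a natural exponent.\<close>
  define a where "a = nat ((u * fls_subdegree y) mod int n)"
  have a: "int a = (u * fls_subdegree y) mod int n" using n0 by (simp add: a_def)
  have "(u * s + w * int n) * fls_subdegree y - s * (u * fls_subdegree y) = int n * (w * fls_subdegree y)"
    by (simp add: algebra_simps)
  then have "fls_subdegree y - s * (u * fls_subdegree y) = int n * (w * fls_subdegree y)"
    by (simp only: uw mult_1)
  then have "fls_subdegree y - s * int a = int n * (w * fls_subdegree y) + s * (u * fls_subdegree y - int a)"
    by (simp add: algebra_simps)
  moreover have "int n dvd u * fls_subdegree y - int a" by (simp add: a)
  ultimately have dvd: "int n dvd fls_subdegree y - s * int a" by (metis dvd_add dvd_mult dvd_triv_left)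
  have yd: "y / det N ^ a \<noteq> 0" using y detN by simp
  have "fls_subdegree y = fls_subdegree (y / det N ^ a * det N ^ a)" using detN by simp
  also have "\<dots> = fls_subdegree (y / det N ^ a) + int a * s"
    unfolding s_def using yd detN by (subst fls_subdegree_mult) (auto simp: fls_subdegree_pow)
  finally have "fls_subdegree (y / det N ^ a) = fls_subdegree y - s * int a"
    by (simp add: mult.commute)
  then obtain z where z: "z ^ n = y / det N ^ a" using fls_nth_root[OF n yd] dvd by auto
  define Z where "Z = z \<cdot>\<^sub>m (N ^\<^sub>m a)"
  have Na: "N ^\<^sub>m a \<in> carrier_mat n n" using N by (simp add: pow_carrier_mat)
  have "Z * N = N * Z"
    using N Na pow_mat_comm[OF N, of a]
    by (simp add: Z_def mult_smult_assoc_mat[of _ n n _ n] mult_smult_distrib[of _ n n _ n])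
  moreover have "det Z = y"
    using N detN z by (simp add: Z_def det_pow_mat[OF N])
  ultimately show ?thesis using Na by (intro bexI[of _ Z]) (auto simp: Z_def)
qed

subsection \<open>Conjugacy to the representative\<close>

text \<open>A kernel vector lists the coefficients of a polynomial of degree below \<open>n\<close>
  with \<open>n\<close> distinct roots. The reversed exponents match the column order in
  \<open>cyclic_vector\<close>.\<close>

lemma vandermonde_nonsingular:
  fixes d :: "nat \<Rightarrow> 'a::field"
  assumes inj: "inj_on d {..<n}"
  shows "det (mat n n (\<lambda>(i, j). d i ^ (n - 1 - j))) \<noteq> 0"
proof
  let ?V = "mat n n (\<lambda>(i, j). d i ^ (n - 1 - j))"
  assume "det ?V = 0"
  then obtain u where u: "u \<in> carrier_vec n" "u \<noteq> 0\<^sub>v n" "?V *\<^sub>v u = 0\<^sub>v n"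
    using det_0_iff_vec_prod_zero_field[of ?V n] by auto
  define p where "p = (\<Sum>j<n. Polynomial.monom (u $ j) (n - 1 - j))"
  have root: "poly p (d i) = 0" if i: "i < n" for i
  proof -
    have "poly p (d i) = (?V *\<^sub>v u) $ i"
      using i u(1) by (auto simp: p_def poly_sum poly_monom scalar_prod_def lessThan_atLeast0 mult.commute intro!: sum.cong)
    also have "\<dots> = 0" unfolding u(3) using i by simp
    finally show ?thesis .
  qed
  have coeff: "poly.coeff p (n - 1 - j) = u $ j" if j: "j < n" for j
  proof -
    have "poly.coeff p (n - 1 - j) = (\<Sum>l<n. if l = j then u $ j else 0)"
      unfolding p_def coeff_sum using j by (intro sum.cong) auto
    then show ?thesis using j by simp
  qed
  obtain j where j: "j < n" "u $ j \<noteq> 0" using u(1,2) by (metis carrier_vecD eq_vecI index_zero_vec)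
  then have p0: "p \<noteq> 0" using coeff[of j] by auto
  have "n = card (d ` {..<n})" using inj by (simp add: card_image)
  also have "\<dots> \<le> card {x. poly p x = 0}"
    using root p0 by (intro card_mono poly_roots_finite) auto
  also have "\<dots> \<le> Polynomial.degree p" by (rule card_poly_roots_bound[OF p0])
  also have "\<dots> \<le> n - 1"
    unfolding p_def by (intro degree_sum_le) (auto intro: order.trans[OF degree_monom_le])
  finally show False using j by simp
qed

text \<open>\<open>v = (1, x, \<dots>, x\<^bsup>n-1\<^esup>)\<close> is a cyclic vector as soon as \<open>x\<close> avoids the roots of the \<open>n\<close>
  polynomials giving its coordinates in an eigenbasis.\<close>

lemma cyclic_vector:
  fixes N :: "'a::field mat"
  assumes inf: "infinite (UNIV :: 'a set)" and N: "N \<in> carrier_mat n n"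
    and card: "card {x. eigenvalue (map_mat to_ac N) x} = n"
  shows "\<exists>v\<in>carrier_vec n. det (mat n n (\<lambda>(a, j). (N ^\<^sub>m (n - 1 - j) *\<^sub>v v) $ a)) \<noteq> 0"
proof -
  define N' where "N' = map_mat to_ac N"
  have N': "N' \<in> carrier_mat n n" using N by (simp add: N'_def)
  have "card {x. eigenvalue N' x} = n" using card by (simp add: N'_def)
  then obtain P Q d where "frame n P Q" and N'D: "N' = frame.D n P Q d" and inj: "inj_on d {..<n}"
    by (rule diagonalizable_if_distinct_eigenvalues[OF N'])
  then interpret frame n P Q by simp
  define q where "q i = (\<Sum>j<n. Polynomial.monom (Q $$ (i, j)) j)" for i
  have coeff_q: "poly.coeff (q i) j = Q $$ (i, j)" if "j < n" for i j
  proof -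
    have "poly.coeff (q i) j = (\<Sum>l<n. if l = j then Q $$ (i, j) else 0)"
      unfolding q_def coeff_sum by (intro sum.cong) auto
    then show ?thesis using that by simp
  qed
  have q0: "q i \<noteq> 0" if i: "i < n" for i
  proof
    assume "q i = 0"
    then have "Q $$ (i, j) = 0" if "j < n" for j using coeff_q[OF that, of i] by simp
    then have "(Q * P) $$ (i, i) = 0" using i by (simp add: scalar_prod_def)
    then show False using i by (simp add: QP)
  qed
  then have "(\<Prod>i<n. q i) \<noteq> 0" by simp
  then have "finite {x. poly (\<Prod>i<n. q i) x = 0}" by (rule poly_roots_finite)
  \<comment> \<open>The point has to come from the base field, so that \<open>v\<close> is rational
    even when the eigenbasis is not.\<close>
  moreover have "infinite (range (to_ac :: 'a \<Rightarrow> _))"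
    using inf inj_to_ac finite_imageD by blast
  ultimately obtain x where x: "poly (\<Prod>i<n. q i) (to_ac x) \<noteq> 0"
    by (metis (mono_tags, lifting) finite_subset image_subsetI mem_Collect_eq)
  define v where "v = vec n (\<lambda>i. x ^ i)"
  have v: "v \<in> carrier_vec n" by (simp add: v_def)
  define w where "w = Q *\<^sub>v map_vec to_ac v"
  have w: "w \<in> carrier_vec n" by (simp add: w_def carrier_vecI)
  have w0: "w $ i \<noteq> 0" if i: "i < n" for i
  proof -
    have "w $ i = poly (q i) (to_ac x)"
      using i by (auto simp: w_def v_def q_def scalar_prod_def poly_sum poly_monom lessThan_atLeast0 intro!: sum.cong)
    then show ?thesis using x i by (auto simp: poly_prod)
  qed
  define B where "B = mat n n (\<lambda>(a, j). (N ^\<^sub>m (n - 1 - j) *\<^sub>v v) $ a)"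
  let ?V = "mat n n (\<lambda>(i, j). d i ^ (n - 1 - j))"
  \<comment> \<open>The matrix of iterates factors into the eigenbasis, the diagonal of coordinates
    of \<open>v\<close>, and a Vandermonde matrix; each factor is nonsingular.\<close>
  have "map_mat to_ac B = P * (mat_diag n (\<lambda>i. w $ i) * ?V)"
  proof (rule eq_matI)
    fix a j assume "a < dim_row (P * (mat_diag n (\<lambda>i. w $ i) * ?V))"
      "j < dim_col (P * (mat_diag n (\<lambda>i. w $ i) * ?V))"
    then have aj: "a < n" "j < n" by simp_all
    let ?k = "n - 1 - j"
    have Nk: "N ^\<^sub>m ?k \<in> carrier_mat n n" using N by (simp add: pow_carrier_mat)
    have "map_mat to_ac B $$ (a, j) = map_vec to_ac (N ^\<^sub>m ?k *\<^sub>v v) $ a"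
      using aj carrier_matD(1)[OF Nk] by (simp add: B_def)
    also have "map_vec to_ac (N ^\<^sub>m ?k *\<^sub>v v) = D (\<lambda>i. d i ^ ?k) *\<^sub>v map_vec to_ac v"
      unfolding to_ac.mult_mat_vec_hom[OF Nk v] to_ac.mat_hom_pow[OF N] N'_def[symmetric] N'D D_pow ..
    also have "\<dots> = P *\<^sub>v (mat_diag n (\<lambda>i. d i ^ ?k) *\<^sub>v w)"
      unfolding D_def w_def using v
      by (simp add: assoc_mult_mat_vec[of _ n n _ n] mult_carrier_mat[of _ n n] mult_mat_vec_carrier[of _ n n])
    also have "\<dots> $ a = (\<Sum>i<n. P $$ (a, i) * (d i ^ ?k * w $ i))"
      unfolding mat_diag_mult_vec[OF w] using aj by (simp add: scalar_prod_def lessThan_atLeast0)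
    also have "\<dots> = (P * (mat_diag n (\<lambda>i. w $ i) * ?V)) $$ (a, j)"
      using aj by (simp add: mat_diag_mult_left[of _ n n] scalar_prod_def lessThan_atLeast0 mult.commute)
    finally show "map_mat to_ac B $$ (a, j) = (P * (mat_diag n (\<lambda>i. w $ i) * ?V)) $$ (a, j)" .
  qed (simp_all add: B_def)
  then have "to_ac (det B) = det P * (det (mat_diag n (\<lambda>i. w $ i)) * det ?V)"
    by (simp add: det_mult[of _ n] mult_carrier_mat[of _ n n] flip: to_ac.hom_det)
  moreover have "det P * det Q = 1" using det_mult[OF P_carrier Q_carrier] PQ by simp
  then have "det P \<noteq> 0" by auto
  moreover have "det (mat_diag n (\<lambda>i. w $ i)) \<noteq> 0" using w0 by (simp add: det_mat_diag)
  ultimately have "det B \<noteq> 0" using vandermonde_nonsingular[OF inj] by (metis mult_eq_0_iff to_ac_0)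
  then show ?thesis using v unfolding B_def by blast
qed

lemma binomial_nonzero: "admissible n b s \<Longrightarrow> fls_const b * fls_X_intpow s \<noteq> 0"
  by (simp add: admissible_def fls_shift_eq0_iff)

lemma binomial_subdegree: "admissible n b s \<Longrightarrow> fls_subdegree (fls_const b * fls_X_intpow s) = s"
  by (subst fls_subdegree_mult) (auto simp: admissible_def fls_shift_eq0_iff)

context
  fixes n :: nat and b :: "'k::alg_closed_field" and s :: int and N :: "'k fls mat"
  assumes n2: "n \<ge> 2" and adm: "admissible n b s" and N: "N \<in> carrier_mat n n"
    and char: "char_poly N = Polynomial.monom 1 n - [:fls_const b * fls_X_intpow s:]"
begin

lemma card_eigenvalues_admissible: "card {x. eigenvalue (map_mat to_ac N) x} = n"
  using card_eigenvalues_binomial[OF N n2 char binomial_nonzero[OF adm]] adm by (simp add: admissible_def)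

text \<open>Both identities are checked on eigenvalues and descend along \<open>to_ac\<close>. For
  the determinant the n-th power is enough, as only its valuation is extracted; this avoids tracking
  a sign.\<close>

lemma binomial_matrix_power: "N ^\<^sub>m n = (fls_const b * fls_X_intpow s) \<cdot>\<^sub>m 1\<^sub>m n" (is ?power)
  and det_binomial_power: "det N ^ n = (fls_const b * fls_X_intpow s) ^ n" (is ?det)
proof -
  define c where "c = fls_const b * fls_X_intpow s"
  define N' where "N' = map_mat to_ac N"
  have N': "N' \<in> carrier_mat n n" using N by (simp add: N'_def)
  have "card {x. eigenvalue N' x} = n" using card_eigenvalues_admissible by (simp add: N'_def)
  then obtain P Q d where "frame n P Q" and N'D: "N' = frame.D n P Q d"
    and range: "d ` {..<n} = {x. eigenvalue N' x}"
    by (rule diagonalizable_if_distinct_eigenvalues[OF N'])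
  then interpret frame n P Q by simp
  have dn: "d i ^ n = to_ac c" if "i < n" for i
    using range that eigenvalues_binomial[OF N char] unfolding N'_def c_def by blast
  have "map_mat to_ac (N ^\<^sub>m n) = D (\<lambda>_. to_ac c)"
    unfolding to_ac.mat_hom_pow[OF N] N'_def[symmetric] N'D D_pow by (rule D_cong) (rule dn)
  also have "\<dots> = map_mat to_ac (c \<cdot>\<^sub>m 1\<^sub>m n)"
    unfolding D_const by (intro eq_matI) auto
  finally show ?power unfolding c_def by (rule to_ac.mat_hom_inj)
  have "to_ac (det N ^ n) = (\<Prod>i<n. d i) ^ n"
    using N'D by (simp add: N'_def det_D flip: to_ac.hom_det)
  also have "\<dots> = (\<Prod>i<n. d i ^ n)" by (simp add: prod_power_distrib)
  also have "\<dots> = to_ac (c ^ n)" by (simp add: dn)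
  finally show ?det unfolding c_def by (simp only: to_ac_eq_iff)
qed

lemma det_binomial: "det N \<noteq> 0" "fls_subdegree (det N) = s"
proof -
  show "det N \<noteq> 0" using det_binomial_power binomial_nonzero[OF adm] n2 by (metis power_eq_0_iff zero_less_numeral less_le_trans)
  have "int n * fls_subdegree (det N) = int n * s"
    using det_binomial_power binomial_subdegree[OF adm] by (metis fls_subdegree_pow)
  then show "fls_subdegree (det N) = s" using n2 by simp
qed

text \<open>The columns of \<open>B\<close> are \<open>N^(n-1) v, ..., N v, v\<close>.
  Multiplication by \<open>N\<close> moves each column to its left neighbour, and sends the first to
  \<open>b pi^s\<close> times the last.\<close>

lemma companion_basis:
  "\<exists>B\<in>carrier_mat n n. det B \<noteq> 0 \<and> N * B = B * N_mat n b s"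
proof -
  obtain v where v: "v \<in> carrier_vec n"
    and det: "det (mat n n (\<lambda>(a, j). (N ^\<^sub>m (n - 1 - j) *\<^sub>v v) $ a)) \<noteq> 0"
    using cyclic_vector[OF infinite_UNIV_fls N card_eigenvalues_admissible] by blast
  define c where "c = fls_const b * fls_X_intpow s"
  define B where "B = mat n n (\<lambda>(a, j). (N ^\<^sub>m (n - 1 - j) *\<^sub>v v) $ a)"
  have B: "B \<in> carrier_mat n n" by (simp add: B_def)
  have Nk: "N ^\<^sub>m k \<in> carrier_mat n n" for k using N by (simp add: pow_carrier_mat)
  have step: "N *\<^sub>v (N ^\<^sub>m k *\<^sub>v v) = N ^\<^sub>m Suc k *\<^sub>v v" for k
    using N Nk v pow_mat_comm[OF N, of k] by (simp flip: assoc_mult_mat_vec[of _ n n _ n])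
  have "N * B = B * N_mat n b s"
  proof (rule eq_matI)
    fix a j assume "a < dim_row (B * N_mat n b s)" "j < dim_col (B * N_mat n b s)"
    then have aj: "a < n" "j < n" using B by (simp_all add: N_mat_def)
    have BN: "(B * N_mat n b s) $$ (a, j) = (\<Sum>l<n. B $$ (a, l) * N_mat n b s $$ (l, j))"
      using aj B by (simp add: scalar_prod_def lessThan_atLeast0 N_mat_def)
    have col: "col B j = N ^\<^sub>m (n - 1 - j) *\<^sub>v v"
      using aj N Nk by (intro eq_vecI) (auto simp: B_def)
    have "(N * B) $$ (a, j) = (N *\<^sub>v col B j) $ a" using aj N B by simp
    also have "\<dots> = (N ^\<^sub>m Suc (n - 1 - j) *\<^sub>v v) $ a" by (simp only: col step)
    also have "\<dots> = (B * N_mat n b s) $$ (a, j)"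
    proof (cases j)
      case 0
      have "(B * N_mat n b s) $$ (a, j) = (\<Sum>l<n. if l = n - 1 then B $$ (a, n - 1) * c else 0)"
        unfolding BN using n2 0 by (intro sum.cong) (auto simp: N_mat_def c_def)
      also have "\<dots> = B $$ (a, n - 1) * c" using n2 by simp
      also have "B $$ (a, n - 1) = v $ a" using aj v n2 N by (simp add: B_def)
      finally have "(B * N_mat n b s) $$ (a, j) = v $ a * c" .
      moreover have "(N ^\<^sub>m Suc (n - 1 - j) *\<^sub>v v) $ a = c * v $ a"
      proof -
        have "Suc (n - 1 - j) = n" using n2 0 by simp
        moreover have "c \<cdot>\<^sub>m 1\<^sub>m n = mat_diag n (\<lambda>_. c)" by (rule eq_matI) (auto simp: mat_diag_def)
        ultimately have "N ^\<^sub>m Suc (n - 1 - j) = mat_diag n (\<lambda>_. c)"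
          using binomial_matrix_power by (simp only: c_def)
        then show ?thesis using aj v by (simp only: mat_diag_mult_vec) simp
      qed
      ultimately show ?thesis by (simp add: mult.commute)
    next
      case (Suc j')
      have "(B * N_mat n b s) $$ (a, j) = (\<Sum>l<n. if l = j' then B $$ (a, j') else 0)"
        unfolding BN using aj Suc by (intro sum.cong) (auto simp: N_mat_def)
      also have "\<dots> = B $$ (a, j')" using aj Suc by simp
      also have "\<dots> = (N ^\<^sub>m (n - 1 - j') *\<^sub>v v) $ a" using aj Suc by (simp add: B_def)
      also have "n - 1 - j' = Suc (n - 1 - j)" using aj Suc by simp
      finally show ?thesis ..
    qed
    finally show "(N * B) $$ (a, j) = (B * N_mat n b s) $$ (a, j)" .
  qed (use N B in \<open>auto simp: N_mat_def\<close>)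
  then show ?thesis using B det unfolding B_def by blast
qed

text \<open>\<open>R * Bi\<close> already conjugates \<open>N\<close> to the wanted matrix but may
  have the wrong determinant. An element \<open>Z\<close> of the centralizer absorbs the defect
  without changing the conjugate. Taking \<open>R\<close> arbitrary serves both the standard basis
  and the given one.\<close>

lemma conj_class_meets_frame:
  assumes R: "R \<in> carrier_mat n n" "det R \<noteq> 0"
  shows "\<exists>N'\<in>conj_class n N. N' * R = R * N_mat n b s"
proof -
  obtain B where B: "B \<in> carrier_mat n n" "det B \<noteq> 0" and NB: "N * B = B * N_mat n b s"
    using companion_basis by blast
  obtain Bi where Bi: "Bi \<in> carrier_mat n n" "B * Bi = 1\<^sub>m n" "Bi * B = 1\<^sub>m n"
    using det_nonzero_inverse[OF B] .
  have nk: "of_nat n \<noteq> (0 :: 'k)" using adm n2 by (simp add: admissible_def coprime_char_exponent)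
  have "det B * det Bi = 1" using det_mult[OF B(1) Bi(1)] Bi(2) by simp
  then have detRB: "det (R * Bi) \<noteq> 0" using R Bi by (auto simp: det_mult[of _ n])
  have "coprime (fls_subdegree (det N)) (int n)" using adm by (simp add: det_binomial admissible_def)
  then obtain Z where Z: "Z \<in> carrier_mat n n" "Z * N = N * Z" "det Z = inverse (det (R * Bi))"
    using det_surjective_on_centralizer[OF N nk det_binomial(1), of "inverse (det (R * Bi))"] detRB by auto
  have "det Z \<noteq> 0" using Z(3) detRB by simp
  then obtain Zi where Zi: "Zi \<in> carrier_mat n n" "Z * Zi = 1\<^sub>m n" "Zi * Z = 1\<^sub>m n"
    using det_nonzero_inverse[OF Z(1)] by blast
  define g where "g = R * Bi * Z"
  have g: "g \<in> carrier_mat n n" using R Bi Z by (simp add: g_def mult_carrier_mat[of _ n n])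
  have "det g = det (R * Bi) * det Z"
    using R Bi Z unfolding g_def by (intro det_mult[of _ n]) (auto simp: mult_carrier_mat[of _ n n])
  then have det_g: "det g = 1" using Z(3) detRB by simp
  then obtain h where h: "h \<in> carrier_mat n n" "g * h = 1\<^sub>m n" "h * g = 1\<^sub>m n"
    using det_nonzero_inverse[OF g] by auto
  note carr = R(1) B(1) Bi(1) Z(1) Zi(1) g h(1) N mult_carrier_mat[of _ n n]
  note assoc = assoc_mult_mat[of _ n n _ n _ n]
  have Nm: "N_mat n b s \<in> carrier_mat n n" by (simp add: N_mat_def)
  have gZB: "g * (Zi * B) = R"
  proof -
    have "g * (Zi * B) = R * (Bi * (Z * Zi) * B)" unfolding g_def by (simp add: carr assoc)
    also have "\<dots> = R"
      by (simp add: Zi(2) Bi(3) right_mult_one_mat[OF Bi(1)] right_mult_one_mat[OF R(1)])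
    finally show ?thesis .
  qed
  have comm: "N * Zi = Zi * N"
  proof -
    have "N * Zi = Zi * (Z * N) * Zi" using Zi(3) left_mult_one_mat[OF N] by (simp add: carr assoc[symmetric])
    also have "\<dots> = Zi * (N * Z) * Zi" by (simp only: Z(2))
    also have "\<dots> = Zi * N * (Z * Zi)" by (simp add: carr assoc)
    finally show ?thesis by (simp add: Zi(2) right_mult_one_mat[of _ n n] carr)
  qed
  have "Ad n g N * R = g * N * h * (g * (Zi * B))"
    using g h by (simp add: Ad_eq gZB)
  also have "\<dots> = g * N * (h * g) * (Zi * B)" by (simp add: carr assoc)
  also have "\<dots> = g * (N * Zi) * B" by (simp add: h(3) carr assoc left_mult_one_mat[of _ n n])
  also have "\<dots> = g * (Zi * B) * N_mat n b s"
    unfolding comm using Nm by (simp add: carr assoc NB)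
  finally have "Ad n g N * R = R * N_mat n b s" by (simp only: gZB)
  moreover have "Ad n g N \<in> conj_class n N"
    unfolding conj_class_def using g det_g by (auto simp: SL_def)
  ultimately show ?thesis by blast
qed

end

subsection \<open>From \<open>GL\<close>-actions to \<open>PGL\<close>-actions\<close>

lemma scalar_coset_in_PGL:
  fixes g :: "'k::field mat"
  assumes "g \<in> carrier (GL n)"
  shows "{c \<cdot>\<^sub>m g | c. c \<noteq> 0} \<in> carrier (PGL n)"
proof -
  have "{c \<cdot>\<^sub>m g | c. c \<noteq> 0} = {c \<cdot>\<^sub>m 1\<^sub>m n | c. c \<noteq> 0} #>\<^bsub>GL n\<^esub> g"
    using assms by (intro scalar_coset[symmetric]) (simp add: mem_carrier_GL)
  then show ?thesis using assms unfolding PGL_def FactGroup_def RCOSETS_def by auto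
qed

lemma scalar_coset_mult:
  fixes g h :: "'k::field mat"
  assumes g: "g \<in> carrier_mat n n" and h: "h \<in> carrier_mat n n"
  shows "{c \<cdot>\<^sub>m g | c. c \<noteq> 0} \<otimes>\<^bsub>PGL n\<^esub> {c \<cdot>\<^sub>m h | c. c \<noteq> 0} = {c \<cdot>\<^sub>m (g * h) | c. c \<noteq> 0}"
proof -
  have m: "(a \<cdot>\<^sub>m g) * (b \<cdot>\<^sub>m h) = (a * b) \<cdot>\<^sub>m (g * h)" for a b
    using g h by (simp add: mult_smult_assoc_mat[of _ n n _ n] mult_smult_distrib[of _ n n _ n]
        smult_smult_mat mult_carrier_mat[of _ n n] mult.commute)
  show ?thesis
  proof (intro equalityI subsetI)
    fix x assume "x \<in> {c \<cdot>\<^sub>m g | c. c \<noteq> 0} \<otimes>\<^bsub>PGL n\<^esub> {c \<cdot>\<^sub>m h | c. c \<noteq> 0}"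
    then obtain a b where "a \<noteq> 0" "b \<noteq> 0" "x = (a \<cdot>\<^sub>m g) * (b \<cdot>\<^sub>m h)"
      by (auto simp: PGL_def set_mult_def)
    then show "x \<in> {c \<cdot>\<^sub>m (g * h) | c. c \<noteq> 0}" unfolding m by auto
  next
    fix x assume "x \<in> {c \<cdot>\<^sub>m (g * h) | c. c \<noteq> 0}"
    then obtain c where c: "c \<noteq> 0" "x = (c \<cdot>\<^sub>m g) * (1 \<cdot>\<^sub>m h)" unfolding m by auto
    have "c \<cdot>\<^sub>m g \<in> {c \<cdot>\<^sub>m g | c. c \<noteq> 0}" using c(1) by blast
    moreover have "1 \<cdot>\<^sub>m h \<in> {c \<cdot>\<^sub>m h | c. c \<noteq> 0}"
      by (intro CollectI exI[of _ 1]) simp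
    ultimately show "x \<in> {c \<cdot>\<^sub>m g | c. c \<noteq> 0} \<otimes>\<^bsub>PGL n\<^esub> {c \<cdot>\<^sub>m h | c. c \<noteq> 0}"
      unfolding c(2) PGL_def mult_FactGroup set_mult_def mult_GL by blast
  qed
qed

lemma PGL_coord_value:
  fixes g :: "'k::field mat"
  assumes g: "g \<in> carrier_mat n n" "det g \<noteq> 0" and ps: "length ps = r * n" "set ps \<subseteq> {..<n} \<times> {..<n}"
  shows "the_elem ((\<lambda>g. prod_list (map (\<lambda>ij. g $$ ij) ps) / det g ^ r) ` {c \<cdot>\<^sub>m g | c. c \<noteq> 0})
    = prod_list (map (\<lambda>ij. g $$ ij) ps) / det g ^ r"
proof -
  define F where "F h = prod_list (map (\<lambda>ij. h $$ ij) ps) / det h ^ r" for h :: "'k mat"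
  have "F (c \<cdot>\<^sub>m g) = F g" if c: "c \<noteq> 0" for c
  proof -
    have "prod_list (map (\<lambda>ij. (c \<cdot>\<^sub>m g) $$ ij) qs) = c ^ length qs * prod_list (map (\<lambda>ij. g $$ ij) qs)"
      if "set qs \<subseteq> {..<n} \<times> {..<n}" for qs
      using that g by (induction qs) auto
    then show ?thesis
      using c g ps by (simp add: F_def power_mult_distrib power_mult[symmetric] mult.commute)
  qed
  moreover have "g \<in> {c \<cdot>\<^sub>m g | c. c \<noteq> 0}"
    by (intro CollectI exI[of _ 1]) (simp add: one_smult_mat)
  ultimately have "F ` {c \<cdot>\<^sub>m g | c. c \<noteq> 0} = {F g}" by blast
  then show ?thesis by (simp add: F_def)
qed

lemma smult_mat_mult_vec:
  fixes A :: "'a::comm_semiring_0 mat"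
  assumes "A \<in> carrier_mat n m" "v \<in> carrier_vec m"
  shows "(c \<cdot>\<^sub>m A) *\<^sub>v v = c \<cdot>\<^sub>v (A *\<^sub>v v)"
  using assms by (intro eq_vecI) (auto simp: scalar_prod_def sum_distrib_left mult.assoc)

lemma mat_unit_vec_col:
  fixes A :: "'a::semiring_1 mat"
  assumes "A \<in> carrier_mat n m" "j < m"
  shows "A *\<^sub>v unit_vec m j = col A j"
  using assms by (intro eq_vecI) auto

lemma regular_prod_list:
  assumes "1 \<in> C" "\<And>a. a \<in> set as \<Longrightarrow> h a \<in> regular C S G"
  shows "(\<lambda>x. prod_list (map (\<lambda>a. h a x) as)) \<in> regular C S G"
  using assms(2)
proof (induction as)
  case Nil
  show ?case using regular.const[OF assms(1)] by simp
next
  case (Cons a as)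
  then show ?case using regular.mult[of "h a" C S G "\<lambda>x. prod_list (map (\<lambda>a. h a x) as)"] by simp
qed

text \<open>Coordinates of \<open>PGL\<close> pull back to monomials in the matrix entries times
  powers of the inverse determinant, which are regular on \<open>GL\<close>.\<close>

lemma Q_action_imp_QSL_action:
  fixes f :: "'k::field \<Rightarrow> 'k mat \<times> 'k"
  assumes f: "Q_action n f"
  shows "QSL_action n (\<lambda>l. ({c \<cdot>\<^sub>m fst (f l) | c. c \<noteq> 0}, snd (f l)))"
proof -
  define F where "F l = ({c \<cdot>\<^sub>m fst (f l) | c. c \<noteq> 0}, snd (f l))" for l
  have hom: "f \<in> hom Gm (Q n)"
    and reg: "\<And>h. h \<in> prod_coords (GL_coords n) Gm_coords \<Longrightarrow> h \<circ> f \<in> regular UNIV (- {0}) Gm_coords"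
    using f by (auto simp: Q_action_def algebraic_hom_def variety_morphism_def)
  have fc: "fst (f l) \<in> carrier (GL n)" "snd (f l) \<noteq> 0" if "l \<noteq> 0" for l
  proof -
    have "f l \<in> carrier (Q n)" using hom that by (auto simp: hom_def)
    then show "fst (f l) \<in> carrier (GL n)" "snd (f l) \<noteq> 0" by (auto simp: Q_def DirProd_def)
  qed
  have fmult: "fst (f (l * l')) = fst (f l) * fst (f l')" "snd (f (l * l')) = snd (f l) * snd (f l')"
    if "l \<noteq> 0" "l' \<noteq> 0" for l l'
    using Group.hom_mult[OF hom, of l l'] that by (simp_all add: Q_def mult_DirProd')
  have cl: "F l \<in> carrier (QSL n)" if "l \<noteq> 0" for l
    using fc[OF that] scalar_coset_in_PGL by (auto simp: F_def QSL_def DirProd_def)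
  have "F \<in> hom Gm (QSL n)"
  proof (rule homI)
    fix l l' :: 'k assume "l \<in> carrier Gm" "l' \<in> carrier Gm"
    then have l: "l \<noteq> 0" "l' \<noteq> 0" by auto
    then show "F (l \<otimes>\<^bsub>Gm\<^esub> l') = F l \<otimes>\<^bsub>QSL n\<^esub> F l'"
      using fc(1)[OF l(1)] fc(1)[OF l(2)] fmult[OF l]
      by (simp add: F_def QSL_def mult_DirProd' scalar_coset_mult mem_carrier_GL)
  qed (use cl in auto)
  moreover have "h \<circ> F \<in> regular UNIV (- {0}) Gm_coords"
    if h: "h \<in> prod_coords (PGL_coords n) Gm_coords" for h
  proof -
    consider h' where "h = h' \<circ> snd" "h' \<in> Gm_coords" | h' where "h = h' \<circ> fst" "h' \<in> PGL_coords n"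
      using h unfolding prod_coords_def by blast
    then show ?thesis
    proof cases
      case 1
      then have "h \<circ> F = (h' \<circ> snd) \<circ> f" by (auto simp: F_def)
      moreover have "h' \<circ> snd \<in> prod_coords (GL_coords n) Gm_coords" using 1 by (auto simp: prod_coords_def)
      ultimately show ?thesis using reg by metis
    next
      case 2
      then obtain ps r where h': "h' = (\<lambda>x. the_elem ((\<lambda>g. prod_list (map (\<lambda>ij. g $$ ij) ps) / det g ^ r) ` x))"
        and ps: "length ps = r * n" "set ps \<subseteq> {..<n} \<times> {..<n}"
        unfolding PGL_coords_def by blast
      have "(\<lambda>l. fst (f l) $$ ij) \<in> regular UNIV (- {0}) Gm_coords" if "ij \<in> set ps" for ij
      proof -
        have "(\<lambda>g. g $$ ij) \<circ> fst \<in> prod_coords (GL_coords n) Gm_coords"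
          using that ps(2) unfolding prod_coords_def GL_coords_def by blast
        from reg[OF this] show ?thesis by (simp add: comp_def)
      qed
      moreover have "(\<lambda>g. inverse (det g)) \<circ> fst \<in> prod_coords (GL_coords n) Gm_coords"
        unfolding prod_coords_def GL_coords_def by blast
      from reg[OF this] have "(\<lambda>l. inverse (det (fst (f l)))) \<in> regular UNIV (- {0}) Gm_coords"
        by (simp add: comp_def)
      ultimately have "(\<lambda>l. prod_list (map (\<lambda>ij. fst (f l) $$ ij) ps) * inverse (det (fst (f l))) ^ r)
          \<in> regular UNIV (- {0}) Gm_coords"
        by (intro regular.mult regular_power regular_prod_list) auto
      then show ?thesis
      proof (rule regular.cong, intro ballI)
        fix l :: 'k assume "l \<in> - {0}"
        then have "fst (f l) \<in> carrier_mat n n" "det (fst (f l)) \<noteq> 0"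
          using fc(1)[of l] by (auto simp: mem_carrier_GL)
        then show "(h \<circ> F) l = prod_list (map (\<lambda>ij. fst (f l) $$ ij) ps) * inverse (det (fst (f l))) ^ r"
          unfolding 2 h' F_def using PGL_coord_value[OF _ _ ps]
          by (simp add: divide_inverse power_inverse)
      qed
    qed
  qed
  ultimately have "QSL_action n F"
    using cl by (auto simp: QSL_action_def algebraic_hom_def variety_morphism_def)
  then show ?thesis by (simp add: F_def[abs_def])
qed

text \<open>Unit vectors are fixed by \<open>rescale\<close>, so testing the semilinear relation on
  them gives an identity of matrices. Cancelling \<open>G\<close> on the right turns it into one
  about \<open>Ad\<close>.\<close>

lemma Q_almost_commutes_imp_QSL_almost_commutes:
  fixes f :: "'k::field \<Rightarrow> 'k mat \<times> 'k"
  assumes f: "Q_action n f" and ac: "Q_almost_commutes n N f s" and N: "N \<in> carrier_mat n n"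
  shows "QSL_almost_commutes n N (\<lambda>l. ({c \<cdot>\<^sub>m fst (f l) | c. c \<noteq> 0}, snd (f l))) s"
  unfolding QSL_almost_commutes_def
proof (intro conjI ballI)
  show "s \<noteq> 0" using ac by (simp add: Q_almost_commutes_def)
  fix l :: 'k assume "l \<in> carrier Gm"
  then have l: "l \<noteq> 0" by simp
  define g where "g = fst (f l)"
  define y where "y = snd (f l)"
  have "f l \<in> carrier (Q n)"
    using f l by (auto simp: Q_action_def algebraic_hom_def hom_def)
  then have g: "g \<in> carrier_mat n n" "det g \<noteq> 0" and y: "y \<noteq> 0"
    by (auto simp: g_def y_def Q_def DirProd_def mem_carrier_GL)
  interpret y: field_hom "rescale y" by (rule rescale_hom[OF y])
  define G where "G = map_mat fls_const g"
  have G: "G \<in> carrier_mat n n" "det G \<noteq> 0" using g by (auto simp: G_def)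
  define c where "c = fls_const (l powi s)"
  have Ny: "map_mat (rescale y) N \<in> carrier_mat n n" using N by simp
  have "G * map_mat (rescale y) N = c \<cdot>\<^sub>m (N * G)"
  proof (rule mat_col_eqI)
    fix j assume "j < dim_col (c \<cdot>\<^sub>m (N * G))"
    then have j: "j < n" using G by simp
    let ?v = "unit_vec n j :: 'k fls vec"
    have ry: "map_vec (rescale y) ?v = ?v" by (intro eq_vecI) (auto simp: unit_vec_def)
    have "Q_act (f l) (N *\<^sub>v ?v) = c \<cdot>\<^sub>v (N *\<^sub>v Q_act (f l) ?v)"
      using ac l by (simp add: Q_almost_commutes_def c_def)
    then have "G *\<^sub>v map_vec (rescale y) (N *\<^sub>v ?v) = c \<cdot>\<^sub>v (N *\<^sub>v (G *\<^sub>v ?v))"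
      by (simp only: Q_act_def g_def[symmetric] y_def[symmetric] G_def[symmetric] ry)
    then have "G *\<^sub>v (map_mat (rescale y) N *\<^sub>v ?v) = c \<cdot>\<^sub>v (N *\<^sub>v (G *\<^sub>v ?v))"
      by (simp only: y.mult_mat_vec_hom[OF N unit_vec_carrier] ry)
    then have "(G * map_mat (rescale y) N) *\<^sub>v ?v = (c \<cdot>\<^sub>m (N * G)) *\<^sub>v ?v"
      using G N Ny by (simp add: assoc_mult_mat_vec[of _ n n _ n] smult_mat_mult_vec[of _ n n])
    then show "col (G * map_mat (rescale y) N) j = col (c \<cdot>\<^sub>m (N * G)) j"
      using j G N by (simp add: mat_unit_vec_col[of _ n n])
  qed (use G N in auto)
  moreover obtain H where H: "H \<in> carrier_mat n n" "G * H = 1\<^sub>m n"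
    using det_nonzero_inverse[OF G] .
  ultimately have "Ad n G (map_mat (rescale y) N) = (c \<cdot>\<^sub>m (N * G)) * H"
    using G Ny by (simp add: Ad_eq)
  also have "\<dots> = c \<cdot>\<^sub>m (N * (G * H))"
    using G N H by (simp add: mult_smult_assoc_mat[of _ n n _ n] mult_carrier_mat[of _ n n] assoc_mult_mat[of _ n n _ n _ n])
  also have "\<dots> = c \<cdot>\<^sub>m N" using N by (simp add: H(2))
  finally show "QSL_act n ({c \<cdot>\<^sub>m fst (f l) | c. c \<noteq> 0}, snd (f l)) N = fls_const (l powi s) \<cdot>\<^sub>m N"
    using QSL_act_eq[OF g N, of y] by (simp add: g_def y_def G_def c_def)
qed

subsection \<open>The representatives\<close>

lemma is_basis_matrix:
  fixes e :: "nat \<Rightarrow> 'k::field vec"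
  assumes e: "is_basis n e"
  defines "E \<equiv> mat_of_cols n (map e [1..<n + 1])"
  shows "E \<in> carrier_mat n n" "det E \<noteq> 0" "\<And>i. i < n \<Longrightarrow> col E i = e (i + 1)"
proof -
  interpret V: vec_space "TYPE('k)" n .
  have basis: "V.basis (e ` {1..n})" and inj: "inj_on e {1..n}"
    using e by (auto simp: is_basis_def)
  show E: "E \<in> carrier_mat n n"
    using mat_of_cols_carrier(1)[of n "map e [1..<n + 1]"] by (simp add: E_def del: upt_Suc)
  have ec: "set (map e [1..<n + 1]) \<subseteq> carrier_vec n"
    using basis by (auto simp: V.basis_def)
  have cols: "cols E = map e [1..<n + 1]" unfolding E_def by (rule cols_mat_of_cols[OF ec])
  have set: "set [1..<n + 1] = {1..n}" by auto
  have "distinct (cols E)"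
    unfolding cols distinct_map set using inj by (simp del: upt_Suc)
  moreover have "set (cols E) = e ` {1..n}"
    unfolding cols set_map set ..
  then have "V.lin_indpt (set (cols E))" using basis by (simp add: V.basis_def)
  ultimately have "V.rank E = n" using V.lin_indpt_full_rank[OF E] by simp
  then show "det E \<noteq> 0" using V.det_rank_iff[OF E] by simp
  show "col E i = e (i + 1)" if "i < n" for i
    using arg_cong[OF cols, of "\<lambda>xs. xs ! i"] that E by (simp del: upt_Suc)
qed

lemma (in frame) D_mult_col: "j < n \<Longrightarrow> D f *\<^sub>v col P j = f j \<cdot>\<^sub>v col P j"
proof -
  assume j: "j < n"
  have "D f * P = P * mat_diag n f * (Q * P)"
    unfolding D_def by (simp add: assoc_mult_mat[of _ n n _ n _ n] mult_carrier_mat[of _ n n])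
  also have "\<dots> = P * mat_diag n f" by (simp add: QP right_mult_one_mat[of _ n n] mult_carrier_mat[of _ n n])
  finally have "D f * P = P * mat_diag n f" .
  then have "col (D f * P) j = col (P * mat_diag n f) j" by simp
  moreover have "col (D f * P) j = D f *\<^sub>v col P j"
    using j by (intro eq_vecI) auto
  moreover have "col (P * mat_diag n f) j = f j \<cdot>\<^sub>v col P j"
    using j by (intro eq_vecI) (auto simp: mat_diag_mult_right[OF P_carrier] mult.commute)
  ultimately show ?thesis by simp
qed

context frame
begin

text \<open>The \<open>i\<close>-th basis vector is column \<open>i - 1\<close> of \<open>P\<close>, hence the weight \<open>- (i + 1) s\<close> below.\<close>

definition weight_action :: "int \<Rightarrow> 'a \<Rightarrow> 'a mat \<times> 'a" where
  "weight_action s l = (D (\<lambda>i. l powi (- (int i + 1) * s)), l ^ n)"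

lemma weight_action_is_Q_action: "Q_action n (weight_action s)"
proof -
  define w where "w i = - (int i + 1) * s" for i
  have wa: "weight_action s = (\<lambda>l. (D (\<lambda>i. l powi w i), l ^ n))"
    by (rule ext) (simp add: weight_action_def w_def)
  have det: "det (D (\<lambda>i. l powi w i)) = (\<Prod>i<n. l powi w i)" for l by (rule det_D)
  have cl: "D (\<lambda>i. l powi w i) \<in> carrier (GL n)" if "l \<noteq> 0" for l
    using that by (auto simp: mem_carrier_GL det power_int_eq_0_iff)
  have "weight_action s \<in> hom Gm (Defs.Q n)"
  proof (rule homI)
    fix l l' :: 'a assume "l \<in> carrier Gm" "l' \<in> carrier Gm"
    then show "weight_action s (l \<otimes>\<^bsub>Gm\<^esub> l') = weight_action s l \<otimes>\<^bsub>Defs.Q n\<^esub> weight_action s l'"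
      by (simp add: wa Q_def D_mult power_int_mult_distrib power_mult_distrib)
  qed (use cl in \<open>auto simp: wa Q_def\<close>)
  moreover have "h \<circ> weight_action s \<in> regular UNIV (- {0}) Gm_coords"
    if h: "h \<in> prod_coords (GL_coords n) Gm_coords" for h
  proof -
    have pow: "(\<lambda>l. l powi m) \<in> regular UNIV (- {0}) Gm_coords" for m
      by (rule regular_Gm_powi) simp
    consider i j where "h = (\<lambda>g. g $$ (i, j)) \<circ> fst" "i < n" "j < n"
      | "h = (\<lambda>g. inverse (det g)) \<circ> fst" | "h = (\<lambda>t. t) \<circ> snd" | "h = (\<lambda>t. inverse t) \<circ> snd"
      using h unfolding prod_coords_def GL_coords_def Gm_coords_def by blast
    then show ?thesis
    proof cases
      case 1
      have "(\<lambda>l. \<Sum>k<n. P $$ (i, k) * l powi w k * Q $$ (k, j)) \<in> regular UNIV (- {0}) Gm_coords"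
        by (intro regular_sum regular.mult regular.const pow) auto
      then show ?thesis using 1 by (simp add: comp_def wa D_index)
    next
      case 2
      have "(\<lambda>l. \<Prod>k<n. l powi (- w k)) \<in> regular UNIV (- {0}) Gm_coords"
        by (intro regular_prod pow) auto
      then show ?thesis using 2
        by (simp add: comp_def wa det power_int_minus prod_inversef[unfolded comp_def])
    next
      case 3
      then show ?thesis using pow[of "int n"] by (simp add: comp_def wa)
    next
      case 4
      then show ?thesis using pow[of "- int n"] by (simp add: comp_def wa power_int_minus)
    qed
  qed
  ultimately show ?thesis
    using cl by (auto simp: Q_action_def algebraic_hom_def variety_morphism_def wa Q_def)
qed

end

lemma rescale_monomial_vec:
  fixes v :: "'k::field vec"
  shows "map_vec (rescale y) (fls_X_intpow m \<cdot>\<^sub>v map_vec fls_const v)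
    = fls_const (y powi m) \<cdot>\<^sub>v (fls_X_intpow m \<cdot>\<^sub>v map_vec fls_const v)"
proof (rule eq_vecI)
  have "rescale y (fls_X_intpow m * fls_const c) = fls_const (y powi m) * (fls_X_intpow m * fls_const c)" for c
    by (rule fls_eqI) (simp add: mult.commute)
  then show "i < dim_vec (fls_const (y powi m) \<cdot>\<^sub>v (fls_X_intpow m \<cdot>\<^sub>v map_vec fls_const v)) \<Longrightarrow>
      map_vec (rescale y) (fls_X_intpow m \<cdot>\<^sub>v map_vec fls_const v) $ i
      = (fls_const (y powi m) \<cdot>\<^sub>v (fls_X_intpow m \<cdot>\<^sub>v map_vec fls_const v)) $ i" for i
    by simp
qed simp

lemma (in frame) weight_action_monomial:
  assumes l: "l \<noteq> 0" and j: "j < n"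
  shows "Q_act (weight_action s l) (fls_X_intpow m \<cdot>\<^sub>v map_vec fls_const (col P j))
    = fls_const (l powi (int n * m - int (j + 1) * s)) \<cdot>\<^sub>v (fls_X_intpow m \<cdot>\<^sub>v map_vec fls_const (col P j))"
proof -
  define g where "g = D (\<lambda>i. l powi (- (int i + 1) * s))"
  have g: "g \<in> carrier_mat n n" by (simp add: g_def)
  have P: "col P j \<in> carrier_vec n" using j by (simp add: carrier_vecI)
  define v where "v = map_vec fls_const (col P j)"
  have v: "v \<in> carrier_vec n" using P by (simp add: v_def)
  have G: "map_mat fls_const g \<in> carrier_mat n n" using g by simp
  have gv: "map_mat fls_const g *\<^sub>v v = fls_const (l powi (- (int j + 1) * s)) \<cdot>\<^sub>v v"
  proof -
    have "map_mat fls_const g *\<^sub>v v = map_vec fls_const (g *\<^sub>v col P j)"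
      unfolding v_def by (rule fls_const.mult_mat_vec_hom[OF g P, symmetric])
    also have "g *\<^sub>v col P j = (l powi (- (int j + 1) * s)) \<cdot>\<^sub>v col P j"
      unfolding g_def by (rule D_mult_col[OF j])
    also have "map_vec fls_const \<dots> = fls_const (l powi (- (int j + 1) * s)) \<cdot>\<^sub>v v"
      unfolding v_def by (intro eq_vecI) simp_all
    finally show ?thesis .
  qed
  have "Q_act (weight_action s l) (fls_X_intpow m \<cdot>\<^sub>v v)
      = map_mat fls_const g *\<^sub>v (fls_const ((l ^ n) powi m) \<cdot>\<^sub>v (fls_X_intpow m \<cdot>\<^sub>v v))"
    by (simp only: Q_act_def weight_action_def fst_conv snd_conv g_def v_def rescale_monomial_vec)
  also have "\<dots> = fls_const ((l ^ n) powi m) \<cdot>\<^sub>v (fls_X_intpow m \<cdot>\<^sub>v (map_mat fls_const g *\<^sub>v v))"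
    using v by (simp only: mult_mat_vec[OF G] smult_carrier_vec)
  also have "\<dots> = (fls_const ((l ^ n) powi m) * fls_const (l powi (- (int j + 1) * s))) \<cdot>\<^sub>v (fls_X_intpow m \<cdot>\<^sub>v v)"
    unfolding gv by (intro eq_vecI) (simp_all add: ac_simps)
  also have "fls_const ((l ^ n) powi m) * fls_const (l powi (- (int j + 1) * s))
      = fls_const (l powi (int n * m - int (j + 1) * s))"
  proof -
    have "(l ^ n) powi m = l powi (int n * m)" by (simp add: power_int_mult)
    moreover have "l powi (int n * m) * l powi (- (int j + 1) * s) = l powi (int n * m + - (int j + 1) * s)"
      using l by (subst power_int_add) auto
    moreover have "int n * m + - (int j + 1) * s = int n * m - int (j + 1) * s" by (simp add: algebra_simps)
    ultimately show ?thesis by (simp only: fls_const.hom_mult[symmetric])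
  qed
  finally show ?thesis unfolding v_def .
qed

text \<open>Along the superdiagonal the weights step by \<open>s\<close>. In the corner, pi^s is
  scaled by \<open>l^(n s)\<close>, which compensates the jump between the last and the first basis
  vector: \<open>- n s + n s = s - s\<close>. This is the origin of the factor \<open>l ^ n\<close>
  on pi.\<close>

lemma N_mat_intertwines:
  fixes b l :: "'k::field" and s :: int
  assumes l: "l \<noteq> 0" and n: "n > 0"
  defines "\<Delta> \<equiv> mat_diag n (\<lambda>i. fls_const (l powi (- (int i + 1) * s)))"
  shows "\<Delta> * map_mat (rescale (l ^ n)) (N_mat n b s) = fls_const (l powi s) \<cdot>\<^sub>m (N_mat n b s * \<Delta>)"
proof -
  have M: "N_mat n b s \<in> carrier_mat n n" by (simp add: N_mat_def)
  have M': "map_mat (rescale (l ^ n)) (N_mat n b s) \<in> carrier_mat n n" using M by simp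
  interpret y: field_hom "rescale (l ^ n)" using l by (intro rescale_hom) simp
  have X: "rescale (l ^ n) (fls_const b * fls_X_intpow s) = fls_const ((l ^ n) powi s) * (fls_const b * fls_X_intpow s)"
    by (rule fls_eqI) (simp only: fls_nth_rescale fls_mult_const_nth fls_nth_monomial, simp)
  have pw: "l powi p * l powi q = l powi (p + q)" for p q
    using l by (subst power_int_add) auto
  show ?thesis
  proof (rule eq_matI)
    fix i j assume "i < dim_row (fls_const (l powi s) \<cdot>\<^sub>m (N_mat n b s * \<Delta>))"
      "j < dim_col (fls_const (l powi s) \<cdot>\<^sub>m (N_mat n b s * \<Delta>))"
    then have ij: "i < n" "j < n" by (simp_all add: N_mat_def \<Delta>_def mat_diag_def)
    have L: "(\<Delta> * map_mat (rescale (l ^ n)) (N_mat n b s)) $$ (i, j)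
        = fls_const (l powi (- (int i + 1) * s)) * rescale (l ^ n) (N_mat n b s $$ (i, j))"
      unfolding \<Delta>_def mat_diag_mult_left[OF M'] using ij by (simp add: N_mat_def)
    have R: "(fls_const (l powi s) \<cdot>\<^sub>m (N_mat n b s * \<Delta>)) $$ (i, j)
        = fls_const (l powi s) * (N_mat n b s $$ (i, j) * fls_const (l powi (- (int j + 1) * s)))"
      unfolding \<Delta>_def mat_diag_mult_right[OF M] using ij by simp
    consider "j = i + 1" | "i = n - 1" "j = 0" "j \<noteq> i + 1" | "j \<noteq> i + 1" "\<not> (i = n - 1 \<and> j = 0)" by blast
    then show "(\<Delta> * map_mat (rescale (l ^ n)) (N_mat n b s)) $$ (i, j)
        = (fls_const (l powi s) \<cdot>\<^sub>m (N_mat n b s * \<Delta>)) $$ (i, j)"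
    proof cases
      case 1
      have "l powi (- (int i + 1) * s) = l powi s * l powi (- (int j + 1) * s)"
        unfolding pw by (rule arg_cong[of _ _ "\<lambda>x. l powi x"]) (simp add: 1 algebra_simps)
      then show ?thesis unfolding L R using ij 1 by (simp add: N_mat_def)
    next
      case 2
      have "l powi (- (int i + 1) * s) * (l ^ n) powi s = l powi s * l powi (- (int j + 1) * s)"
      proof -
        have "(l ^ n) powi s = l powi (int n * s)" by (simp add: power_int_mult)
        then show ?thesis using 2 n by (simp only: pw) (simp add: of_nat_diff algebra_simps)
      qed
      then have *: "fls_const (l powi (- (int i + 1) * s)) * fls_const ((l ^ n) powi s)
          = fls_const (l powi s) * fls_const (l powi (- (int j + 1) * s))"
        by (simp only: fls_const.hom_mult[symmetric])
      have N: "N_mat n b s $$ (i, j) = fls_const b * fls_X_intpow s" using ij 2 by (simp add: N_mat_def)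
      have "fls_const (l powi (- (int i + 1) * s)) * (fls_const ((l ^ n) powi s) * (fls_const b * fls_X_intpow s))
          = (fls_const (l powi (- (int i + 1) * s)) * fls_const ((l ^ n) powi s)) * (fls_const b * fls_X_intpow s)"
        by (simp only: mult.assoc)
      also have "\<dots> = fls_const (l powi s) * ((fls_const b * fls_X_intpow s) * fls_const (l powi (- (int j + 1) * s)))"
        unfolding * by (simp only: ac_simps)
      finally show ?thesis unfolding L R N X .
    next
      case 3
      then have "N_mat n b s $$ (i, j) = 0" using ij by (auto simp: N_mat_def)
      then show ?thesis unfolding L R by simp
    qed
  qed (simp_all add: N_mat_def \<Delta>_def mat_diag_def)
qed

lemma (in frame) weight_action_almost_commutes:
  assumes n: "n > 0" and s: "s \<noteq> 0" and N: "N \<in> carrier_mat n n"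
    and NP: "N * map_mat fls_const P = map_mat fls_const P * N_mat n b s"
  shows "Q_almost_commutes n N (weight_action s) s"
  unfolding Q_almost_commutes_def
proof (intro conjI ballI)
  fix l :: 'a and v :: "'a fls vec" assume "l \<in> carrier Gm" and v: "v \<in> carrier_vec n"
  then have l: "l \<noteq> 0" by simp
  let ?P = "map_mat fls_const P" and ?Q = "map_mat fls_const Q" and ?M = "N_mat n b s"
  define y where "y = l ^ n"
  have y: "y \<noteq> 0" using l by (simp add: y_def)
  interpret y: field_hom "rescale y" by (rule rescale_hom[OF y])
  interpret F: frame n ?P ?Q
    by unfold_locales (simp_all flip: fls_const.mat_hom_mult[of _ n n _ n] add: PQ QP fls_const.mat_hom_one)
  have M: "?M \<in> carrier_mat n n" by (simp add: N_mat_def)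
  define \<Delta> where "\<Delta> = mat_diag n (\<lambda>i. fls_const (l powi (- (int i + 1) * s)))"
  have \<Delta>: "\<Delta> \<in> carrier_mat n n" by (simp add: \<Delta>_def)
  define G where "G = map_mat fls_const (D (\<lambda>i. l powi (- (int i + 1) * s)))"
  have G: "G \<in> carrier_mat n n" by (simp add: G_def)
  have GD: "G = ?P * \<Delta> * ?Q"
  proof -
    have "map_mat fls_const (mat_diag n (\<lambda>i. l powi (- (int i + 1) * s))) = \<Delta>"
      by (rule eq_matI) (auto simp: \<Delta>_def mat_diag_def)
    then show ?thesis
      unfolding G_def D_def
      by (simp add: fls_const.mat_hom_mult[of _ n n _ n] mult_carrier_mat[of _ n n])
  qed
  have NM: "N = ?P * ?M * ?Q"
  proof -
    have "N = N * (?P * ?Q)" using N by (simp add: F.PQ)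
    also have "\<dots> = N * ?P * ?Q" using N by (simp add: assoc_mult_mat[of _ n n _ n _ n])
    finally show ?thesis by (simp only: NP)
  qed
  \<comment> \<open>The base change has entries in \<open>k\<close>, which \<open>rescale\<close>
    fixes, so only the matrix of \<open>N\<close> is affected.\<close>
  have Ny: "map_mat (rescale y) N = ?P * map_mat (rescale y) ?M * ?Q"
  proof -
    have "map_mat (rescale y) (map_mat fls_const A) = map_mat fls_const A" for A
    proof -
      have "rescale y (fls_const c) = fls_const c" for c by (rule fls_eqI) simp
      then show ?thesis by (intro eq_matI) simp_all
    qed
    then show ?thesis
      unfolding NM using M by (simp add: y.mat_hom_mult[of _ n n _ n] mult_carrier_mat[of _ n n])
  qed
  have key: "G * map_mat (rescale y) N = fls_const (l powi s) \<cdot>\<^sub>m (N * G)"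
  proof -
    have "G * map_mat (rescale y) N = ?P * (\<Delta> * map_mat (rescale y) ?M) * ?Q"
      unfolding GD Ny using M \<Delta> by (simp add: F.framed_mult)
    also have "\<Delta> * map_mat (rescale y) ?M = fls_const (l powi s) \<cdot>\<^sub>m (?M * \<Delta>)"
      unfolding \<Delta>_def y_def by (rule N_mat_intertwines[OF l n])
    also have "?P * (fls_const (l powi s) \<cdot>\<^sub>m (?M * \<Delta>)) * ?Q = fls_const (l powi s) \<cdot>\<^sub>m (?P * (?M * \<Delta>) * ?Q)"
      using M \<Delta> by (simp add: mult_smult_assoc_mat[of _ n n _ n] mult_smult_distrib[of _ n n _ n] mult_carrier_mat[of _ n n])
    also have "?P * (?M * \<Delta>) * ?Q = N * G"
      unfolding GD NM using M \<Delta> by (simp add: F.framed_mult)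
    finally show ?thesis .
  qed
  have vy: "map_vec (rescale y) v \<in> carrier_vec n" using v by simp
  have Q_act: "Q_act (weight_action s l) w = G *\<^sub>v map_vec (rescale y) w" for w
    by (simp only: Q_act_def weight_action_def fst_conv snd_conv G_def y_def)
  have "Q_act (weight_action s l) (N *\<^sub>v v) = G *\<^sub>v (map_mat (rescale y) N *\<^sub>v map_vec (rescale y) v)"
    by (simp only: Q_act y.mult_mat_vec_hom[OF N v])
  also have "\<dots> = (G * map_mat (rescale y) N) *\<^sub>v map_vec (rescale y) v"
    using G N vy by (simp add: assoc_mult_mat_vec[of _ n n _ n])
  also have "\<dots> = fls_const (l powi s) \<cdot>\<^sub>v (N *\<^sub>v (G *\<^sub>v map_vec (rescale y) v))"
    unfolding key using G N vy by (simp add: smult_mat_mult_vec[of _ n n] assoc_mult_mat_vec[of _ n n _ n])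
  finally show "Q_act (weight_action s l) (N *\<^sub>v v)
      = fls_const (l powi s) \<cdot>\<^sub>v (N *\<^sub>v Q_act (weight_action s l) v)" by (simp only: Q_act)
qed (rule s)

section \<open>The two inclusions and the final assembly\<close>

lemma nil_if_conj_N_mat:
  fixes N :: "'k::field fls mat"
  assumes n: "n \<ge> 2" and s: "s > 0" and conj: "N_mat n b s \<in> conj_class n N"
  shows "nil n N"
proof -
  define M :: "'k fps mat" where "M = mat n n (\<lambda>(i, j). if j = i + 1 then 1
     else if i = n - 1 \<and> j = 0 then fps_const b * fps_X ^ nat s else 0)"
  have "fps_to_fls (fps_const b * fps_X ^ nat s) = fls_const b * fls_X_intpow s"
    using s by (intro fls_eqI) (auto simp: fls_nth_monomial fps_to_fls_nth fps_X_power_nth)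
  then have "map_mat fps_to_fls M = N_mat n b s"
    by (intro eq_matI) (auto simp: M_def N_mat_def)
  moreover have "M \<in> sl n"
    using n by (auto simp: sl_def trace_mat_eq_sum[of _ n] M_def intro!: sum.neutral)
  \<comment> \<open>At \<open>pi = 0\<close> the corner entry disappears because
    \<open>s > 0\<close>, leaving a nilpotent Jordan block.\<close>
  moreover have "map_mat (\<lambda>h. fps_nth h 0) M = jordan_block n 0"
    using n s by (intro eq_matI) (auto simp: M_def jordan_block_def)
  then have "map_mat (\<lambda>h. fps_nth h 0) M ^\<^sub>m n = 0\<^sub>m n n"
    by (auto simp: jordan_block_zero_pow intro!: eq_matI)
  ultimately show ?thesis using conj unfolding nil_def by metis
qed

lemma nil_elliptic_if_admissible:
  fixes N :: "'k::alg_closed_field fls mat"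
  assumes n: "n \<ge> 2" and N: "N \<in> sl n" and adm: "admissible n b s"
    and char: "char_poly N = Polynomial.monom 1 n - [:fls_const b * fls_X_intpow s:]"
  shows "nil_elliptic n N"
  unfolding nil_elliptic_def
proof (intro conjI)
  have Nc: "N \<in> carrier_mat n n" using N by (simp add: sl_def)
  note card = card_eigenvalues_admissible[OF n adm Nc char]
  show "nil n N"
  proof (rule nil_if_conj_N_mat[OF n])
    show "s > 0" using adm by (simp add: admissible_def)
    obtain N' where "N' \<in> conj_class n N" "N' * 1\<^sub>m n = 1\<^sub>m n * N_mat n b s"
      using conj_class_meets_frame[OF n adm Nc char, of "1\<^sub>m n"] by auto
    moreover have "N_mat n b s \<in> carrier_mat n n" by (simp add: N_mat_def)
    ultimately show "N_mat n b s \<in> conj_class n N"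
      using char_poly_in_conj_class(1)[OF Nc] by (metis left_mult_one_mat right_mult_one_mat)
  qed
  show "regular_semisimple n N" using N card by (simp add: regular_semisimple_def)
  have "is_torus n (centralizer_SL n N)"
    using n by (intro is_torus_centralizer_SL[OF Nc _ card]) simp
  moreover have "\<chi> t = 1\<^sub>m n"
    if "algebraic_hom (range to_ac) Gm Gm_coords (centralizer_SL n N) (GL_coords n) \<chi>" "t \<noteq> 0" for \<chi> t
  proof (rule cocharacter_trivial[OF Nc _ card _ binomial_nonzero[OF adm] _ that])
    show "n > 0" using n by simp
    show "x ^ n = to_ac (fls_const b * fls_X_intpow s)" if "eigenvalue (map_mat to_ac N) x" for x
      using that eigenvalues_binomial[OF Nc char] by blast
    show "coprime (fls_subdegree (fls_const b * fls_X_intpow s)) (int n)"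
      unfolding binomial_subdegree[OF adm] using adm by (simp add: admissible_def)
  qed
  ultimately show "elliptic n N" by (auto simp: elliptic_def)
qed

text \<open>Almost commutation holds for \<open>N\<close>, nil-ellipticity is given for another
  element \<open>N0\<close> of the class; the common characteristic polynomial transports the
  information. The exponent \<open>u\<close> found may differ from \<open>s\<close>.\<close>

lemma almost_commuting_imp_admissible:
  fixes N N0 :: "'k::alg_closed_field fls mat"
  assumes n: "n \<ge> 2" and N0: "nil_elliptic n N0" and N: "N \<in> conj_class n N0"
    and f: "QSL_action n f" "QSL_almost_commutes n N f s"
  shows "\<exists>b u. admissible n b u \<and> char_poly N0 = Polynomial.monom 1 n - [:fls_const b * fls_X_intpow u:]"
proof -
  have nil: "nil n N0" and card: "card {x. eigenvalue (map_mat to_ac N0) x} = n" and ell: "elliptic n N0"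
    and N0c: "N0 \<in> carrier_mat n n"
    using N0 by (auto simp: nil_elliptic_def regular_semisimple_def sl_def)
  have Nc: "N \<in> carrier_mat n n" and char: "char_poly N = char_poly N0"
    using char_poly_in_conj_class[OF N0c N] by auto
  obtain d where d: "\<And>i m. fls_nth (poly.coeff (char_poly N0) i) m \<noteq> 0 \<Longrightarrow> d * m = s * (int n - int i)"
    using almost_commuting_char_poly_support[OF f Nc] unfolding char by blast
  have s: "s \<noteq> 0" using f by (simp add: QSL_almost_commutes_def)
  have deg: "Polynomial.degree (char_poly N0) = n" "poly.coeff (char_poly N0) n = 1"
    using degree_monic_char_poly[OF N0c] by auto
  obtain b u where b: "b \<noteq> 0" and u: "coprime u (int n)"
    and p: "char_poly N0 = Polynomial.monom 1 n - [:fls_const b * fls_X_intpow u:]"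
    using irreducible_homogeneous_is_binomial[OF deg n d s elliptic_imp_irreducible_char_poly[OF N0c card ell]]
    by blast
  have "u > 0" using n by (intro nil_binomial_exponent_pos[OF N0c _ nil b p]) simp
  moreover have "coprime (char_exponent TYPE('k)) n"
    using card_eigenvalues_binomial[OF N0c n p] b card by (simp add: fls_shift_eq0_iff)
  ultimately show ?thesis using b u p by (auto simp: admissible_def)
qed

theorem proposition3p4:
  fixes n :: nat and e :: "nat \<Rightarrow> 'k::alg_closed_field vec"
  assumes "n \<ge> 2" and "is_basis n e"
  shows
    "{C \<in> nil_elliptic_classes n.
        \<exists>N\<in>C. \<exists>(f :: 'k \<Rightarrow> 'k mat set \<times> 'k) s. QSL_action n f \<and> QSL_almost_commutes n N f s}
     = {C \<in> conj_classes n. \<exists>(b :: 'k) s. admissible n b s \<and>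
          class_char_poly C = monom 1 n - [:fls_const b * fls_X_intpow s:]} \<and>
     (\<forall>(b :: 'k) s. admissible n b s \<longrightarrow>
        (\<forall>C \<in> conj_classes n.
           class_char_poly C = monom 1 n - [:fls_const b * fls_X_intpow s:] \<longrightarrow>
           (\<exists>N\<in>C. has_matrix n e N (N_mat n b s))) \<and>
        (\<exists>!N. has_matrix n e N (N_mat n b s)) \<and>
        (\<forall>N. has_matrix n e N (N_mat n b s) \<longrightarrow>
           (\<forall>i\<in>{1..n - 1}. N *\<^sub>v map_vec fls_const (e (i + 1)) = map_vec fls_const (e i)) \<and>
           N *\<^sub>v map_vec fls_const (e 1)
             = (fls_const b * fls_X_intpow s) \<cdot>\<^sub>v map_vec fls_const (e n) \<and>
           (\<exists>f :: 'k \<Rightarrow> 'k mat \<times> 'k. Q_action n f \<and>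
              (\<forall>l\<in>carrier Gm. \<forall>m :: int. \<forall>i\<in>{1..n}.
                 Q_act (f l) (fls_X_intpow m \<cdot>\<^sub>v map_vec fls_const (e i))
                 = fls_const (l powi (int n * m - int i * s)) \<cdot>\<^sub>v
                     (fls_X_intpow m \<cdot>\<^sub>v map_vec fls_const (e i))) \<and>
              Q_almost_commutes n N f s)))"
proof -
  define E where "E = mat_of_cols n (map e [1..<n + 1])"
  have E: "E \<in> carrier_mat n n" "det E \<noteq> 0" and col_E: "\<And>i. i < n \<Longrightarrow> col E i = e (i + 1)"
    using is_basis_matrix[OF assms(2), folded E_def] by blast+
  obtain E' where E': "E' \<in> carrier_mat n n" "E * E' = 1\<^sub>m n" "E' * E = 1\<^sub>m n"
    using det_nonzero_inverse[OF E] .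
  interpret frame n E E' by unfold_locales (use E E' in auto)
  define EF where "EF = map_mat fls_const E"
  define EF' where "EF' = map_mat fls_const E'"
  \<comment> \<open>The same basis is used twice: over \<open>k\<close> it defines the weight
    action, over \<open>F\<close> it carries the matrix of \<open>N\<close>.\<close>
  interpret F: frame n EF EF'
    unfolding EF_def EF'_def
    by unfold_locales (simp_all flip: fls_const.mat_hom_mult[of _ n n _ n] add: PQ QP fls_const.mat_hom_one)
  have det_EF: "det EF \<noteq> 0" using E(2) by (simp add: EF_def)
  have EF_cols: "mat_of_cols n (map (\<lambda>i. map_vec fls_const (e i)) [1..<n + 1]) = EF"
  proof (rule mat_col_eqI)
    fix j assume "j < dim_col EF"
    then have j: "j < n" by simp
    have ec: "e (j + 1) \<in> carrier_vec n" using col_E[OF j] E(1) by (metis carrier_matD(1) col_dim carrier_vecI)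
    have "map (\<lambda>i. map_vec fls_const (e i)) [1..<n + 1] ! j = map_vec fls_const (e (j + 1))"
      using j by (simp del: upt_Suc)
    then show "col (mat_of_cols n (map (\<lambda>i. map_vec fls_const (e i)) [1..<n + 1])) j = col EF j"
      using j ec E(1) by (subst col_mat_of_cols) (auto simp: EF_def col_E simp del: upt_Suc)
  qed (simp_all del: upt_Suc)
  have hm: "has_matrix n e N (N_mat n b s) \<longleftrightarrow> N \<in> carrier_mat n n \<and> N * EF = EF * N_mat n b s" for N b s
  proof -
    have "N_mat n b s \<in> carrier_mat n n" by (simp add: N_mat_def)
    then show ?thesis unfolding has_matrix_def Let_def EF_cols by blast
  qed
  have meets: "\<exists>N\<in>C. has_matrix n e N (N_mat n b s)"
    if C: "C \<in> conj_classes n" and adm: "admissible n b s"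
      and char: "class_char_poly C = Polynomial.monom 1 n - [:fls_const b * fls_X_intpow s:]"
    for C b s
  proof -
    obtain N where N: "N \<in> carrier_mat n n" and CN: "C = conj_class n N"
      using C by (auto simp: conj_classes_def sl_def)
    have "char_poly N = Polynomial.monom 1 n - [:fls_const b * fls_X_intpow s:]"
      using char class_char_poly_conj_class[OF N] by (simp only: CN)
    then obtain N' where "N' \<in> C" "N' * EF = EF * N_mat n b s"
      using conj_class_meets_frame[OF assms(1) adm N _ F.P_carrier det_EF] unfolding CN by blast
    then show ?thesis using char_poly_in_conj_class(1)[OF N] unfolding CN hm by blast
  qed
  have comm: "Q_almost_commutes n N (weight_action s) s"
    if "has_matrix n e N (N_mat n b s)" "admissible n b s" for N b s
    using that assms(1) unfolding hm EF_def
    by (intro weight_action_almost_commutes) (auto simp: admissible_def)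
  show ?thesis
  proof (intro conjI allI impI)
    show "{C \<in> nil_elliptic_classes n.
        \<exists>N\<in>C. \<exists>(f :: 'k \<Rightarrow> 'k mat set \<times> 'k) s. QSL_action n f \<and> QSL_almost_commutes n N f s}
     = {C \<in> conj_classes n. \<exists>(b :: 'k) s. admissible n b s \<and>
          class_char_poly C = monom 1 n - [:fls_const b * fls_X_intpow s:]}" (is "?L = ?R")
    proof (intro equalityI subsetI)
      fix C assume "C \<in> ?L"
      then obtain N0 N f s where N0: "N0 \<in> sl n" "nil_elliptic n N0" "C = conj_class n N0"
        and N: "N \<in> C" and f: "QSL_action n (f :: 'k \<Rightarrow> _)" "QSL_almost_commutes n N f s"
        by (auto simp: nil_elliptic_classes_def)
      have "N0 \<in> carrier_mat n n" using N0 by (simp add: sl_def)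
      then have "class_char_poly C = char_poly N0" using N0 by (simp add: class_char_poly_conj_class)
      moreover have "C \<in> conj_classes n" using N0 by (auto simp: conj_classes_def)
      ultimately show "C \<in> ?R"
        using almost_commuting_imp_admissible[OF assms(1) N0(2) N[unfolded N0(3)] f] by simp
    next
      fix C assume "C \<in> ?R"
      then obtain b :: 'k and s where C: "C \<in> conj_classes n" and adm: "admissible n b s"
        and char: "class_char_poly C = Polynomial.monom 1 n - [:fls_const b * fls_X_intpow s:]" by blast
      obtain N0 where N0: "N0 \<in> sl n" "C = conj_class n N0" using C by (auto simp: conj_classes_def)
      have N0c: "N0 \<in> carrier_mat n n" using N0 by (simp add: sl_def)
      have "char_poly N0 = Polynomial.monom 1 n - [:fls_const b * fls_X_intpow s:]"
        using char class_char_poly_conj_class[OF N0c] N0(2) by simp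
      then have "C \<in> nil_elliptic_classes n"
        using nil_elliptic_if_admissible[OF assms(1) N0(1) adm] N0 by (auto simp: nil_elliptic_classes_def)
      moreover obtain N where N: "N \<in> C" "has_matrix n e N (N_mat n b s)"
        using meets[OF C adm char] by blast
      \<comment> \<open>The witness is the weight action followed by passage to scalar cosets,
        applied to the element of the class with the representative as its matrix.\<close>
      moreover have "QSL_almost_commutes n N
          (\<lambda>l. ({c \<cdot>\<^sub>m fst (weight_action s l) | c. c \<noteq> 0}, snd (weight_action s l))) s"
        using N(2) hm by (intro Q_almost_commutes_imp_QSL_almost_commutes weight_action_is_Q_action
            comm[OF N(2) adm]) blast
      ultimately show "C \<in> ?L"
        using Q_action_imp_QSL_action[OF weight_action_is_Q_action] by blast
    qed
  next
    fix b :: 'k and s assume adm: "admissible n b s"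
    show "\<forall>C \<in> conj_classes n.
           class_char_poly C = monom 1 n - [:fls_const b * fls_X_intpow s:] \<longrightarrow>
           (\<exists>N\<in>C. has_matrix n e N (N_mat n b s))"
      using meets adm by blast
    have M: "N_mat n b s \<in> carrier_mat n n" by (simp add: N_mat_def)
    show "\<exists>!N. has_matrix n e N (N_mat n b s)"
    proof (rule ex1I)
      have "EF * N_mat n b s * EF' * EF = EF * N_mat n b s * (EF' * EF)"
        using M by (simp add: assoc_mult_mat[of _ n n _ n _ n] mult_carrier_mat[of _ n n])
      then show "has_matrix n e (EF * N_mat n b s * EF') (N_mat n b s)"
        using M by (simp add: hm F.QP right_mult_one_mat[of _ n n] mult_carrier_mat[of _ n n])
      fix N assume "has_matrix n e N (N_mat n b s)"
      then have N: "N \<in> carrier_mat n n" "N * EF = EF * N_mat n b s" by (auto simp: hm)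
      have "N = N * (EF * EF')" using N by (simp add: F.PQ)
      also have "\<dots> = N * EF * EF'" using N(1) by (simp add: assoc_mult_mat[of _ n n _ n _ n])
      finally show "N = EF * N_mat n b s * EF'" by (simp only: N(2))
    qed
    fix N assume has: "has_matrix n e N (N_mat n b s)"
    then have N: "N \<in> carrier_mat n n" "N * EF = EF * N_mat n b s" by (auto simp: hm)
    have col_EF: "col EF j = map_vec fls_const (e (j + 1))" if "j < n" for j
      using that E(1) by (simp add: EF_def col_E)
    have N_col: "N *\<^sub>v col EF j = EF *\<^sub>v col (N_mat n b s) j" if "j < n" for j
    proof -
      have "col (N * EF) j = N *\<^sub>v col EF j" using that N(1) by (intro eq_vecI) auto
      moreover have "col (EF * N_mat n b s) j = EF *\<^sub>v col (N_mat n b s) j"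
        using that M by (intro eq_vecI) auto
      ultimately show ?thesis using N(2) by simp
    qed
    show "\<forall>i\<in>{1..n - 1}. N *\<^sub>v map_vec fls_const (e (i + 1)) = map_vec fls_const (e i)"
    proof
      fix i assume i: "i \<in> {1..n - 1}"
      then have "i < n" by auto
      have "col (N_mat n b s) i = unit_vec n (i - 1)"
        using i by (intro eq_vecI) (auto simp: N_mat_def unit_vec_def)
      then have "N *\<^sub>v col EF i = EF *\<^sub>v unit_vec n (i - 1)" using N_col[OF \<open>i < n\<close>] by simp
      also have "\<dots> = col EF (i - 1)" using i by (intro mat_unit_vec_col[OF F.P_carrier]) auto
      finally show "N *\<^sub>v map_vec fls_const (e (i + 1)) = map_vec fls_const (e i)"
        using i \<open>i < n\<close> col_EF[OF \<open>i < n\<close>] col_EF[of "i - 1"] by simp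
    qed
    show "N *\<^sub>v map_vec fls_const (e 1) = (fls_const b * fls_X_intpow s) \<cdot>\<^sub>v map_vec fls_const (e n)"
    proof -
      have "col (N_mat n b s) 0 = (fls_const b * fls_X_intpow s) \<cdot>\<^sub>v unit_vec n (n - 1)"
        using assms(1) by (intro eq_vecI) (auto simp: N_mat_def unit_vec_def)
      then have "N *\<^sub>v col EF 0 = EF *\<^sub>v ((fls_const b * fls_X_intpow s) \<cdot>\<^sub>v unit_vec n (n - 1))"
        using N_col[of 0] assms(1) by simp
      also have "\<dots> = (fls_const b * fls_X_intpow s) \<cdot>\<^sub>v (EF *\<^sub>v unit_vec n (n - 1))"
        by (rule mult_mat_vec[OF F.P_carrier unit_vec_carrier])
      also have "EF *\<^sub>v unit_vec n (n - 1) = col EF (n - 1)"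
        using assms(1) by (intro mat_unit_vec_col[OF F.P_carrier]) auto
      finally show ?thesis using col_EF[of 0] col_EF[of "n - 1"] assms(1) by simp
    qed
    have "Q_act (weight_action s l) (fls_X_intpow m \<cdot>\<^sub>v map_vec fls_const (e i))
        = fls_const (l powi (int n * m - int i * s)) \<cdot>\<^sub>v (fls_X_intpow m \<cdot>\<^sub>v map_vec fls_const (e i))"
      if "l \<in> carrier Gm" "i \<in> {1..n}" for l m i
    proof -
      have "i - 1 < n" "i - 1 + 1 = i" using that by auto
      then show ?thesis
        using weight_action_monomial[of l "i - 1" s m] col_E[of "i - 1"] that by simp
    qed
    then show "\<exists>f :: 'k \<Rightarrow> 'k mat \<times> 'k. Q_action n f \<and>
              (\<forall>l\<in>carrier Gm. \<forall>m :: int. \<forall>i\<in>{1..n}.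
                 Q_act (f l) (fls_X_intpow m \<cdot>\<^sub>v map_vec fls_const (e i))
                 = fls_const (l powi (int n * m - int i * s)) \<cdot>\<^sub>v
                     (fls_X_intpow m \<cdot>\<^sub>v map_vec fls_const (e i))) \<and>
              Q_almost_commutes n N f s"
      using weight_action_is_Q_action comm[OF has adm] by blast
  qed
qed

end
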